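(* The following are mutually quasi-isometric: (1) $\mathrm{Diff}_+^1(I)$ as a topological group; (2) $\mathrm{Diff}_+^1(\mathbb{S}^1)$ as a topological group; (3) $C[0,1]$ as a Banach space (i.e. with the metric given by its supremum norm); (4) $C[0,1]$ as an additive topological group.
   Context: $I=[0,1]$, and $\mathbb{S}^1$ is the circle, viewed as $[0,1]$ with $0$ and $1$ identified. For $M^1=I$ or $\mathbb{S}^1$, $\mathrm{Diff}_+^1(M^1)$ is the group (under composition) of orientation-preserving $C^1$-diffeomorphisms of $M^1$ with the topology induced by $\rho_1(f,g)=\sup_{x\in M^1}d_{M^1}(f(x),g(x))+\sup_{x\in M^1}|f'(x)-g'(x)|$, where $d_I$ is the usual distance, $d_{\mathbb{S}^1}([x],[y])=|e^{2\pi i x}-e^{2\pi i y}|$, and derivatives of circle maps are those of their lifts to $\mathbb{R}$. $C[0,1]$ is the space of real-valued continuous functions on $[0,1]$; as a topological group it carries addition and the norm topology. A subset $\Sigma$ of a separable metrizable group $G$ has the property (OB) relative to $G$ if $\Sigma$ has finite diameter with respect to every right-invariant metric on $G$ compatible with the topology of $G$. (For a connected Polish group $G$ this is equivalent to: for every open neighborhood $U$ of the identity there is a positive integer $r$ with $\Sigma\subseteq U^r$.) If $G$ is generated by an open subset with the property (OB) relative to $G$ (which is the case for all groups considered here), the quasi-isometry class of $G$ as a topological group is the common quasi-isometry class of the right Cayley metrics $d_\Sigma(f,g)=\min\{n\geq 0: fg^{-1}\in\Sigma^n\}$ (with $\Sigma^0=\{e\}$), where $\Sigma$ ranges over open symmetric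 generating sets with the property (OB) relative to $G$; by results of Rosendal these metrics are all mutually quasi-isometric. A topological group is said to be quasi-isometric to a metric space (or another such group) if its metrics in this class are quasi-isometric to that space (or to the metrics in the class of the other group). Two metric spaces $(X,d_X),(Y,d_Y)$ are quasi-isometric if there are a map $\phi:X\to Y$ and constants $L\geq1$, $C\geq0$ with $\frac1L d_X(x,x')-C\leq d_Y(\phi(x),\phi(x'))\leq L d_X(x,x')+C$ for all $x,x'\in X$, and every point of $Y$ within distance $C$ of $\phi(X)$. *)

theory Defs
  imports "HOL-Analysis.Analysis" "HOL-Algebra.Bij" "HOL-Algebra.Generated_Groups"
begin

section \<open>Quasi-isometry\<close>

definition quasi_isometric ::
    "'a set \<Rightarrow> ('a \<Rightarrow> 'a \<Rightarrow> real) \<Rightarrow> 'b set \<Rightarrow> ('b \<Rightarrow> 'b \<Rightarrow> real) \<Rightarrow> bool"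
  where "quasi_isometric X dX Y dY \<longleftrightarrow>
    (\<exists>\<phi> L C. \<phi> \<in> X \<rightarrow> Y \<and> L \<ge> 1 \<and> C \<ge> 0 \<and>
      (\<forall>x\<in>X. \<forall>x'\<in>X. (1 / L) * dX x x' - C \<le> dY (\<phi> x) (\<phi> x') \<and>
                         dY (\<phi> x) (\<phi> x') \<le> L * dX x x' + C) \<and>
      (\<forall>y\<in>Y. \<exists>x\<in>X. dY y (\<phi> x) \<le> C))"


section \<open>Property (OB) and the quasi-isometry class of a topological group\<close>

text \<open>A topological group is given by a group record \<open>G\<close> together with a topology \<open>T\<close> on its
  carrier.\<close>

definition compatible_right_invariant_metric ::
    "('a, 'm) monoid_scheme \<Rightarrow> 'a topology \<Rightarrow> ('a \<Rightarrow> 'a \<Rightarrow> real) \<Rightarrow> bool"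
  where "compatible_right_invariant_metric G T d \<longleftrightarrow>
    Metric_space (carrier G) d \<and>
    Metric_space.mtopology (carrier G) d = T \<and>
    (\<forall>f\<in>carrier G. \<forall>g\<in>carrier G. \<forall>h\<in>carrier G. d (f \<otimes>\<^bsub>G\<^esub> h) (g \<otimes>\<^bsub>G\<^esub> h) = d f g)"

definition property_OB :: "('a, 'm) monoid_scheme \<Rightarrow> 'a topology \<Rightarrow> 'a set \<Rightarrow> bool"
  where "property_OB G T \<Sigma> \<longleftrightarrow> \<Sigma> \<subseteq> carrier G \<and>
    (\<forall>d. compatible_right_invariant_metric G T d \<longrightarrow>
      (\<exists>B. \<forall>f\<in>\<Sigma>. \<forall>g\<in>\<Sigma>. d f g \<le> B))"

definition OB_generating_set :: "('a, 'm) monoid_scheme \<Rightarrow> 'a topology \<Rightarrow> 'a set \<Rightarrow> bool"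
  where "OB_generating_set G T \<Sigma> \<longleftrightarrow>
    openin T \<Sigma> \<and> (\<forall>f\<in>\<Sigma>. inv\<^bsub>G\<^esub> f \<in> \<Sigma>) \<and> generate G \<Sigma> = carrier G \<and> property_OB G T \<Sigma>"

primrec set_power :: "('a, 'm) monoid_scheme \<Rightarrow> 'a set \<Rightarrow> nat \<Rightarrow> 'a set"
  where
    "set_power G \<Sigma> 0 = {\<one>\<^bsub>G\<^esub>}"
  | "set_power G \<Sigma> (Suc n) = set_power G \<Sigma> n <#>\<^bsub>G\<^esub> \<Sigma>"

definition cayley_dist :: "('a, 'm) monoid_scheme \<Rightarrow> 'a set \<Rightarrow> 'a \<Rightarrow> 'a \<Rightarrow> real"
  where "cayley_dist G \<Sigma> f g = real (LEAST n. f \<otimes>\<^bsub>G\<^esub> inv\<^bsub>G\<^esub> g \<in> set_power G \<Sigma> n)"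

text \<open>The quasi-isometry class of a topological group is represented by all right Cayley metrics
  of open symmetric generating sets with property (OB). Both notions below require that such a set
  exists, so that the class is not empty, and quantify over all of its representatives.\<close>

definition group_quasi_isometric_to_metric ::
    "('a, 'm) monoid_scheme \<Rightarrow> 'a topology \<Rightarrow> 'b set \<Rightarrow> ('b \<Rightarrow> 'b \<Rightarrow> real) \<Rightarrow> bool"
  where "group_quasi_isometric_to_metric G T Y d \<longleftrightarrow>
    (\<exists>\<Sigma>. OB_generating_set G T \<Sigma>) \<and>
    (\<forall>\<Sigma>. OB_generating_set G T \<Sigma> \<longrightarrow>
      quasi_isometric (carrier G) (cayley_dist G \<Sigma>) Y d)"

definition groups_quasi_isometric ::
    "('a, 'm) monoid_scheme \<Rightarrow> 'a topology \<Rightarrow> ('b, 'n) monoid_scheme \<Rightarrow> 'b topology \<Rightarrow> bool"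
  where "groups_quasi_isometric G T H T' \<longleftrightarrow>
    (\<exists>\<Sigma>. OB_generating_set G T \<Sigma>) \<and> (\<exists>\<Sigma>. OB_generating_set H T' \<Sigma>) \<and>
    (\<forall>\<Sigma> \<Sigma>'. OB_generating_set G T \<Sigma> \<longrightarrow> OB_generating_set H T' \<Sigma>' \<longrightarrow>
      quasi_isometric (carrier G) (cayley_dist G \<Sigma>) (carrier H) (cayley_dist H \<Sigma>'))"


section \<open>Diffeomorphisms of the interval\<close>

text \<open>At the endpoints of \<open>{0..1}\<close> the derivatives within the interval are the one-sided ones.\<close>

definition C1_on :: "real set \<Rightarrow> (real \<Rightarrow> real) \<Rightarrow> bool"
  where "C1_on S f \<longleftrightarrow>
    f differentiable_on S \<and> continuous_on S (\<lambda>x. vector_derivative f (at x within S))"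

text \<open>Maps of \<open>{0..1}\<close>, and below of the circle, are extensional (\<open>undefined\<close> outside their domain),
  so that equality of group elements is equality of maps; the product in \<^const>\<open>BijGroup\<close> is
  composition.\<close>

definition Diff_I :: "(real \<Rightarrow> real) monoid"
  where "Diff_I = (BijGroup {0..1})
    \<lparr>carrier := {f \<in> Bij {0..1}. C1_on {0..1} f \<and> C1_on {0..1} (inv_into {0..1} f) \<and>
                                 strict_mono_on {0..1} f}\<rparr>"

text \<open>The value 0 off the carrier, here and in \<open>rho_S1\<close>, only serves the library's predicate
  \<^locale>\<open>Metric_space\<close>, which asks for nonnegativity on the whole type.\<close>

definition rho_I :: "(real \<Rightarrow> real) \<Rightarrow> (real \<Rightarrow> real) \<Rightarrow> real"
  where "rho_I f g =
    (if f \<in> carrier Diff_I \<and> g \<in> carrier Diff_I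
     then (SUP x\<in>{0..1}. \<bar>f x - g x\<bar>) +
          (SUP x\<in>{0..1}. \<bar>vector_derivative f (at x within {0..1}) -
                           vector_derivative g (at x within {0..1})\<bar>)
     else 0)"

definition Diff_I_topology :: "(real \<Rightarrow> real) topology"
  where "Diff_I_topology = Metric_space.mtopology (carrier Diff_I) rho_I"


section \<open>Diffeomorphisms of the circle\<close>

text \<open>The interval with endpoints identified is realised as the unit circle in the complex plane,
  the class of \<open>x\<close> being \<open>circle_pt x\<close>, that is, \<open>exp (2 \<pi> i x)\<close>. Under this identification the
  distance \<open>d([x],[y]) = |exp (2 \<pi> i x) - exp (2 \<pi> i y)|\<close> is the distance of the complex plane.\<close>

abbreviation S1 :: "complex set"
  where "S1 \<equiv> sphere 0 1"

definition circle_pt :: "real \<Rightarrow> complex"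
  where "circle_pt x = cis (2 * pi * x)"

definition circle_lift :: "(complex \<Rightarrow> complex) \<Rightarrow> (real \<Rightarrow> real) \<Rightarrow> bool"
  where "circle_lift f F \<longleftrightarrow>
    continuous_on UNIV F \<and> (\<forall>x. f (circle_pt x) = circle_pt (F x))"

definition C1_circle :: "(complex \<Rightarrow> complex) \<Rightarrow> bool"
  where "C1_circle f \<longleftrightarrow> (\<exists>F. circle_lift f F \<and> C1_on UNIV F)"

definition orientation_preserving_circle :: "(complex \<Rightarrow> complex) \<Rightarrow> bool"
  where "orientation_preserving_circle f \<longleftrightarrow> (\<exists>F. circle_lift f F \<and> strict_mono F)"

text \<open>Two lifts of the same map differ by a constant integer, so the choice is immaterial.\<close>

definition circle_deriv :: "(complex \<Rightarrow> complex) \<Rightarrow> real \<Rightarrow> real"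
  where "circle_deriv f x = vector_derivative (SOME F. circle_lift f F) (at x)"

definition Diff_S1 :: "(complex \<Rightarrow> complex) monoid"
  where "Diff_S1 = (BijGroup S1)
    \<lparr>carrier := {f \<in> Bij S1. C1_circle f \<and> C1_circle (inv_into S1 f) \<and>
                             orientation_preserving_circle f}\<rparr>"

definition rho_S1 :: "(complex \<Rightarrow> complex) \<Rightarrow> (complex \<Rightarrow> complex) \<Rightarrow> real"
  where "rho_S1 f g =
    (if f \<in> carrier Diff_S1 \<and> g \<in> carrier Diff_S1
     then (SUP x\<in>{0..1}. dist (f (circle_pt x)) (g (circle_pt x))) +
          (SUP x\<in>{0..1}. \<bar>circle_deriv f x - circle_deriv g x\<bar>)
     else 0)"

definition Diff_S1_topology :: "(complex \<Rightarrow> complex) topology"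
  where "Diff_S1_topology = Metric_space.mtopology (carrier Diff_S1) rho_S1"


section \<open>Continuous functions on the interval\<close>

text \<open>The library's space of continuous bounded functions, with its supremum metric.\<close>

definition C01 :: "(real \<Rightarrow> real) metric"
  where "C01 = cfunspace (top_of_set {0..1}) euclidean_metric"

definition C01_group :: "(real \<Rightarrow> real) monoid"
  where "C01_group =
    \<lparr>carrier = mspace C01, mult = \<lambda>f g. \<lambda>x\<in>{0..1}. f x + g x, one = \<lambda>x\<in>{0..1}. 0\<rparr>"

end

theory Submission
  imports Defs
begin

text \<open>
  The logarithmic derivative turns composition of diffeomorphisms into a twisted addition of
  functions: \<open>log (f \<circ> g)' = (log f') \<circ> g + log g'\<close>. Hence \<open>sup |log f' - log g'|\<close> is a right-invariant
  metric on \<open>Diff_I\<close>, and it induces the \<open>C\<^sup>1\<close> topology, because \<open>exp\<close> and \<open>log\<close> are uniformly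
  continuous near the compact range of a positive continuous function and \<open>f\<close> is recovered from
  \<open>f'\<close> by integration. The map \<open>f \<mapsto> log f' - log f' 0\<close> is a bi-Lipschitz bijection from
  \<open>Diff_I\<close> with this metric onto the functions in \<open>C[0,1]\<close> that vanish at 0; its inverse sends \<open>h\<close> to
  the primitive of \<open>exp h\<close>, rescaled to have total mass 1. On the circle the uniform distance of the
  maps is added to the metric, as \<open>log f'\<close> determines a circle diffeomorphism only up to a rotation.
  That distance is at most 2 and therefore invisible on the large scale. The derivative of a lift is
  1-periodic, so the same map now has the functions that vanish at both endpoints as its range.

  Two points remain. The first is to pass from these metrics to the Cayley metrics. In each of the
  three groups every element \<open>f\<close> is joined to the identity by a path that is Lipschitz with a constant
  linear in the distance of \<open>f\<close> from the identity: scale the function that represents \<open>f\<close> by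
  \<open>t \<in> [0,1]\<close>. Cut into short steps, such a path writes \<open>f\<close> as a product of elements of any given
  neighbourhood of the identity, with a number of factors that is linear in the distance. This makes
  the unit ball an open generating set with property (OB) (\<open>OB_generating_unit_ball\<close>), and it makes
  every right Cayley metric of such a set quasi-isometric to the given metric by the identity map
  (\<open>quasi_isometric_cayley_dist\<close>).

  The second is that the functions that vanish at 0, or at 0 and 1, form a space isomorphic to
  \<open>C[0,1]\<close>. This is a Hilbert hotel: the value \<open>f 0\<close> is stored at the first of a sequence of sample
  points that tends to 0, and what was stored at each sample point moves one point further
  (\<open>quasi_isometric_vanishing_at_0\<close>).
\<close>

section \<open>Quasi-isometries and metric topologies\<close>

lemma quasi_isometric_sym:
  assumes Y: "Metric_space Y dY" and q: "quasi_isometric X dX Y dY"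
  shows "quasi_isometric Y dY X dX"
proof -
  interpret Y: Metric_space Y dY by (fact Y)
  obtain \<phi> L C where \<phi>: "\<phi> \<in> X \<rightarrow> Y" and L: "L \<ge> 1" and C: "C \<ge> 0"
    and lo: "\<And>x x'. x \<in> X \<Longrightarrow> x' \<in> X \<Longrightarrow> (1 / L) * dX x x' - C \<le> dY (\<phi> x) (\<phi> x')"
    and up: "\<And>x x'. x \<in> X \<Longrightarrow> x' \<in> X \<Longrightarrow> dY (\<phi> x) (\<phi> x') \<le> L * dX x x' + C"
    and dense: "\<And>y. y \<in> Y \<Longrightarrow> \<exists>x\<in>X. dY y (\<phi> x) \<le> C"
    using q unfolding quasi_isometric_def by blast
  from dense obtain \<psi> where \<psi>: "\<And>y. y \<in> Y \<Longrightarrow> \<psi> y \<in> X" "\<And>y. y \<in> Y \<Longrightarrow> dY y (\<phi> (\<psi> y)) \<le> C"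
    by metis
  have lo': "dX x x' \<le> L * (dY (\<phi> x) (\<phi> x') + C)" if "x \<in> X" "x' \<in> X" for x x'
    using lo[OF that] L by (simp add: field_simps)
  show ?thesis
    unfolding quasi_isometric_def
  proof (intro exI conjI ballI)
    show "\<psi> \<in> Y \<rightarrow> X" using \<psi> by blast
    show "L \<ge> 1" "3 * L * C \<ge> 0" using L C by auto
  next
    fix y y' assume y: "y \<in> Y" "y' \<in> Y"
    have py: "\<phi> (\<psi> y) \<in> Y" "\<phi> (\<psi> y') \<in> Y" using \<psi> \<phi> y by auto
    have t: "dY (\<phi> (\<psi> y)) (\<phi> (\<psi> y')) \<le> dY y y' + 2 * C"
      using Y.triangle[OF py(1) y(1) py(2)] Y.triangle[OF y(1) y(2) py(2)]
        \<psi>(2)[OF y(1)] \<psi>(2)[OF y(2)] Y.commute[of "\<phi> (\<psi> y)" y] by linarith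
    have t': "dY y y' \<le> dY (\<phi> (\<psi> y)) (\<phi> (\<psi> y')) + 2 * C"
      using Y.triangle[OF y(1) py(1) y(2)] Y.triangle[OF py(1) py(2) y(2)]
        \<psi>(2)[OF y(1)] \<psi>(2)[OF y(2)] Y.commute[of "\<phi> (\<psi> y')" y'] by linarith
    have "dX (\<psi> y) (\<psi> y') \<le> L * (dY (\<phi> (\<psi> y)) (\<phi> (\<psi> y')) + C)"
      using lo' \<psi>(1) y by blast
    also have "\<dots> \<le> L * (dY y y' + 3 * C)"
      using t L by (intro mult_left_mono) auto
    finally show "dX (\<psi> y) (\<psi> y') \<le> L * dY y y' + 3 * L * C" by (simp add: algebra_simps)
    have "dY y y' \<le> L * dX (\<psi> y) (\<psi> y') + 3 * C"
      using t' up[OF \<psi>(1)[OF y(1)] \<psi>(1)[OF y(2)]] by linarith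
    then have "(1 / L) * dY y y' \<le> (1 / L) * (L * dX (\<psi> y) (\<psi> y') + 3 * C)"
      using L by (intro mult_left_mono) auto
    also have "\<dots> = dX (\<psi> y) (\<psi> y') + (3 * C) * (1 / L)" using L by (simp add: field_simps)
    also have "\<dots> \<le> dX (\<psi> y) (\<psi> y') + (3 * C) * L"
      using L C order_trans[of "1 / L" 1 L] by (intro add_left_mono mult_left_mono) (auto simp: field_simps)
    finally show "(1 / L) * dY y y' - 3 * L * C \<le> dX (\<psi> y) (\<psi> y')" by (simp add: algebra_simps)
  next
    fix x assume x: "x \<in> X"
    then have px: "\<phi> x \<in> Y" using \<phi> by blast
    have "dX x (\<psi> (\<phi> x)) \<le> L * (dY (\<phi> x) (\<phi> (\<psi> (\<phi> x))) + C)"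
      using lo' \<psi>(1) px x by blast
    also have "\<dots> \<le> L * (3 * C)"
      using \<psi>(2)[OF px] L C by (intro mult_left_mono) linarith+
    finally show "\<exists>y\<in>Y. dX x (\<psi> y) \<le> 3 * L * C" using px by (auto simp: algebra_simps)
  qed
qed

lemma quasi_isometric_trans:
  assumes XY: "quasi_isometric X dX Y dY" and YZ: "quasi_isometric Y dY Z dZ"
    and tri: "\<And>x y z. x \<in> Z \<Longrightarrow> y \<in> Z \<Longrightarrow> z \<in> Z \<Longrightarrow> dZ x z \<le> dZ x y + dZ y z"
  shows "quasi_isometric X dX Z dZ"
proof -
  obtain \<phi> L C where \<phi>: "\<phi> \<in> X \<rightarrow> Y" and L: "L \<ge> 1" and C: "C \<ge> 0"
    and lo: "\<And>x x'. x \<in> X \<Longrightarrow> x' \<in> X \<Longrightarrow> (1 / L) * dX x x' - C \<le> dY (\<phi> x) (\<phi> x')"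
    and up: "\<And>x x'. x \<in> X \<Longrightarrow> x' \<in> X \<Longrightarrow> dY (\<phi> x) (\<phi> x') \<le> L * dX x x' + C"
    and dense: "\<And>y. y \<in> Y \<Longrightarrow> \<exists>x\<in>X. dY y (\<phi> x) \<le> C"
    using XY unfolding quasi_isometric_def by blast
  obtain \<psi> L' C' where \<psi>: "\<psi> \<in> Y \<rightarrow> Z" and L': "L' \<ge> 1" and C': "C' \<ge> 0"
    and lo': "\<And>x x'. x \<in> Y \<Longrightarrow> x' \<in> Y \<Longrightarrow> (1 / L') * dY x x' - C' \<le> dZ (\<psi> x) (\<psi> x')"
    and up': "\<And>x x'. x \<in> Y \<Longrightarrow> x' \<in> Y \<Longrightarrow> dZ (\<psi> x) (\<psi> x') \<le> L' * dY x x' + C'"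
    and dense': "\<And>y. y \<in> Z \<Longrightarrow> \<exists>x\<in>Y. dZ y (\<psi> x) \<le> C'"
    using YZ unfolding quasi_isometric_def by blast
  show ?thesis
    unfolding quasi_isometric_def
  proof (intro exI conjI ballI)
    show "\<psi> \<circ> \<phi> \<in> X \<rightarrow> Z" using \<phi> \<psi> by auto
    have "1 * 1 \<le> L' * L" using L L' by (intro mult_mono) auto
    then show "1 \<le> L' * L" by simp
    show "0 \<le> L' * C + 2 * C'" using L' C C' by simp
  next
    fix x x' assume x: "x \<in> X" "x' \<in> X"
    have y: "\<phi> x \<in> Y" "\<phi> x' \<in> Y" using \<phi> x by auto
    have "dZ (\<psi> (\<phi> x)) (\<psi> (\<phi> x')) \<le> L' * dY (\<phi> x) (\<phi> x') + C'" using up'[OF y] .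
    also have "\<dots> \<le> L' * (L * dX x x' + C) + C'"
      using up[OF x] L' by (intro add_right_mono mult_left_mono) auto
    finally show "dZ ((\<psi> \<circ> \<phi>) x) ((\<psi> \<circ> \<phi>) x') \<le> (L' * L) * dX x x' + (L' * C + 2 * C')"
      using C' by (simp add: algebra_simps)
    have "(1 / L') * ((1 / L) * dX x x' - C) \<le> (1 / L') * dY (\<phi> x) (\<phi> x')"
      using lo[OF x] L' by (intro mult_left_mono) auto
    then have "(1 / (L' * L)) * dX x x' - (1 / L') * C - C' \<le> dZ (\<psi> (\<phi> x)) (\<psi> (\<phi> x'))"
      using lo'[OF y] by (simp add: algebra_simps)
    moreover have "(1 / L') * C \<le> L' * C"
      using L' C order_trans[of "1 / L'" 1 L'] by (intro mult_right_mono) (auto simp: field_simps)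
    ultimately show "(1 / (L' * L)) * dX x x' - (L' * C + 2 * C') \<le> dZ ((\<psi> \<circ> \<phi>) x) ((\<psi> \<circ> \<phi>) x')"
      using C' by simp
  next
    fix z assume z: "z \<in> Z"
    obtain y where y: "y \<in> Y" "dZ z (\<psi> y) \<le> C'" using dense' z by blast
    obtain x where x: "x \<in> X" "dY y (\<phi> x) \<le> C" using dense y by blast
    have px: "\<phi> x \<in> Y" using \<phi> x by auto
    have "dZ z (\<psi> (\<phi> x)) \<le> dZ z (\<psi> y) + dZ (\<psi> y) (\<psi> (\<phi> x))"
      using tri z \<psi> y px by auto
    also have "\<dots> \<le> C' + (L' * dY y (\<phi> x) + C')" using y up'[OF y(1) px] by linarith
    also have "\<dots> \<le> C' + (L' * C + C')" using x L' by (intro add_mono mult_left_mono) auto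
    finally show "\<exists>x\<in>X. dZ z ((\<psi> \<circ> \<phi>) x) \<le> L' * C + 2 * C'"
      using x(1) by (intro bexI[of _ x]) auto
  qed
qed

text \<open>A surjection that preserves distances up to constants. Both bounds are multiplicative in the same
  direction, so no reciprocal of the Lipschitz constant has to be handled by its users.\<close>

lemma quasi_isometricI_onto:
  assumes Y: "Metric_space Y dY" and onto: "\<phi> ` X = Y" and L: "L \<ge> 1" and C: "C \<ge> 0"
    and up: "\<And>x x'. x \<in> X \<Longrightarrow> x' \<in> X \<Longrightarrow> dY (\<phi> x) (\<phi> x') \<le> L * dX x x' + C"
    and lo: "\<And>x x'. x \<in> X \<Longrightarrow> x' \<in> X \<Longrightarrow> dX x x' \<le> L * dY (\<phi> x) (\<phi> x') + C"
  shows "quasi_isometric X dX Y dY"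
  unfolding quasi_isometric_def
proof (intro exI conjI ballI)
  show "\<phi> \<in> X \<rightarrow> Y" "L \<ge> 1" "C \<ge> 0" using onto L C by auto
  fix x x' assume x: "x \<in> X" "x' \<in> X"
  show "dY (\<phi> x) (\<phi> x') \<le> L * dX x x' + C" using up[OF x] .
  have "C \<le> L * C" using mult_right_mono[OF L C] by simp
  then have "dX x x' \<le> L * (dY (\<phi> x) (\<phi> x') + C)"
    using lo[OF x] by (simp add: algebra_simps)
  then have "dX x x' / L \<le> dY (\<phi> x) (\<phi> x') + C"
    using L by (simp add: pos_divide_le_eq mult.commute)
  then show "(1 / L) * dX x x' - C \<le> dY (\<phi> x) (\<phi> x')" by simp
next
  fix y assume "y \<in> Y"
  then obtain x where "x \<in> X" "y = \<phi> x" using onto by blast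
  then show "\<exists>x\<in>X. dY y (\<phi> x) \<le> C"
    using C Metric_space.mdist_zero[OF Y \<open>y \<in> Y\<close>] by (intro bexI[of _ x]) auto
qed

text \<open>If closeness for \<open>d\<close> at a point forces closeness for \<open>d'\<close>, balls of \<open>d'\<close> contain balls of \<open>d\<close>.
  The modulus may depend on the point, which matters for the logarithmic metrics below.\<close>

lemma openin_mtopology_coarsen:
  assumes "Metric_space M d" "Metric_space M d'"
    and le: "\<And>x \<epsilon>. x \<in> M \<Longrightarrow> \<epsilon> > 0 \<Longrightarrow> \<exists>\<delta>>0. \<forall>y\<in>M. d x y < \<delta> \<longrightarrow> d' x y < \<epsilon>"
    and U: "openin (Metric_space.mtopology M d') U"
  shows "openin (Metric_space.mtopology M d) U"
proof -
  interpret d: Metric_space M d by fact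
  interpret d': Metric_space M d' by fact
  show ?thesis
    unfolding d.openin_mtopology
  proof (intro conjI allI impI)
    show UM: "U \<subseteq> M" using U d'.openin_mtopology by blast
    fix x assume x: "x \<in> U"
    then obtain r where r: "r > 0" "d'.mball x r \<subseteq> U" using U d'.openin_mtopology by blast
    obtain \<delta> where "\<delta> > 0" "\<forall>y\<in>M. d x y < \<delta> \<longrightarrow> d' x y < r" using le[of x r] r x UM by blast
    then show "\<exists>r>0. d.mball x r \<subseteq> U" using r x UM by (intro exI[of _ \<delta>]) force
  qed
qed

lemma mtopology_eqI:
  assumes "Metric_space M d" "Metric_space M d'"
    and "\<And>x \<epsilon>. x \<in> M \<Longrightarrow> \<epsilon> > 0 \<Longrightarrow> \<exists>\<delta>>0. \<forall>y\<in>M. d x y < \<delta> \<longrightarrow> d' x y < \<epsilon>"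
    and "\<And>x \<epsilon>. x \<in> M \<Longrightarrow> \<epsilon> > 0 \<Longrightarrow> \<exists>\<delta>>0. \<forall>y\<in>M. d' x y < \<delta> \<longrightarrow> d x y < \<epsilon>"
  shows "Metric_space.mtopology M d = Metric_space.mtopology M d'"
  unfolding topology_eq using openin_mtopology_coarsen[of M d d'] openin_mtopology_coarsen[of M d' d] assms
  by blast

section \<open>Cayley metrics of groups with paths of linear length\<close>

context group
begin

lemma set_power_closed:
  assumes "S \<subseteq> carrier G" shows "set_power G S n \<subseteq> carrier G"
  using assms by (induction n) (auto simp: set_mult_def)

lemma set_power_mult:
  assumes S: "S \<subseteq> carrier G" and x: "x \<in> set_power G S m" and y: "y \<in> set_power G S n"
  shows "x \<otimes> y \<in> set_power G S (m + n)"
  using y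
proof (induction n arbitrary: y)
  case 0
  then show ?case using x set_power_closed[OF S, of m] by auto
next
  case (Suc n)
  then obtain z s where zs: "z \<in> set_power G S n" "s \<in> S" "y = z \<otimes> s"
    by (auto simp: set_mult_def)
  then have "x \<otimes> y = (x \<otimes> z) \<otimes> s"
    using S x set_power_closed[OF S, of m] set_power_closed[OF S, of n] by (auto simp: m_assoc subset_iff)
  then show ?case using Suc.IH[OF zs(1)] zs(2) by (auto simp: set_mult_def)
qed

lemma subset_set_power_1: "S \<subseteq> carrier G \<Longrightarrow> S \<subseteq> set_power G S 1"
  by (force simp: set_mult_def)

lemma set_power_trans:
  assumes S: "S \<subseteq> carrier G" and B: "B \<subseteq> set_power G S k"
  shows "set_power G B n \<subseteq> set_power G S (k * n)"
proof (induction n)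
  case (Suc n)
  show ?case
  proof
    fix x assume "x \<in> set_power G B (Suc n)"
    then obtain z b where "z \<in> set_power G B n" "b \<in> B" "x = z \<otimes> b" by (auto simp: set_mult_def)
    then have "x \<in> set_power G S (k * n + k)" using set_power_mult[OF S] Suc B by blast
    then show "x \<in> set_power G S (k * Suc n)" by (simp add: add.commute)
  qed
qed auto

end

text \<open>A topological group with a compatible right-invariant metric in which each element is reached from
  the identity along a path whose Lipschitz constant is linear in its distance from the identity.
  The summand 1 absorbs constants: the path may turn around a bounded part of the group, such as the
  rotations of the circle, at a bounded extra cost.\<close>

locale path_group = group G for G (structure) +
  fixes T :: "'a topology" and d :: "'a \<Rightarrow> 'a \<Rightarrow> real"
  assumes compatible: "compatible_right_invariant_metric G T d"
    and paths: "\<exists>A. \<forall>f\<in>carrier G. \<exists>\<gamma>. \<gamma> 0 = \<one> \<and> \<gamma> 1 = f \<and> \<gamma> \<in> {0..1} \<rightarrow> carrier G \<and>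
      (\<forall>s\<in>{0..1::real}. \<forall>t\<in>{0..1}. d (\<gamma> s) (\<gamma> t) \<le> A * (d f \<one> + 1) * \<bar>s - t\<bar>)"
begin

sublocale Metric_space "carrier G" d
  using compatible by (simp add: compatible_right_invariant_metric_def)

lemma mtopology_T: "mtopology = T"
  using compatible by (simp add: compatible_right_invariant_metric_def)

lemma right_invariant_dist_one:
  assumes "compatible_right_invariant_metric G T d'" "f \<in> carrier G" "g \<in> carrier G"
  shows "d' (f \<otimes> inv g) \<one> = d' f g"
  using assms unfolding compatible_right_invariant_metric_def by (metis inv_closed r_inv)

text \<open>Right invariance makes the distance from the identity subadditive, whence word length controls
  it. This is stated for any compatible metric, since property (OB) speaks about all of them.\<close>

lemma right_invariant_dist_power:
  assumes d': "compatible_right_invariant_metric G T d'" and S: "S \<subseteq> carrier G"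
    and B: "\<And>s. s \<in> S \<Longrightarrow> d' s \<one> \<le> B" and x: "x \<in> set_power G S n"
  shows "d' x \<one> \<le> real n * B"
proof -
  interpret d': Metric_space "carrier G" d'
    using d' by (simp add: compatible_right_invariant_metric_def)
  show ?thesis
    using x
  proof (induction n arbitrary: x)
    case (Suc n)
    then obtain z s where zs: "z \<in> set_power G S n" "s \<in> S" "x = z \<otimes> s" by (auto simp: set_mult_def)
    have c: "z \<in> carrier G" "s \<in> carrier G" using zs S set_power_closed[OF S] by auto
    have "d' x \<one> \<le> d' (z \<otimes> s) (\<one> \<otimes> s) + d' s \<one>"
      using d'.triangle[of "z \<otimes> s" s \<one>] c zs by simp
    also have "\<dots> \<le> real n * B + B"
      using Suc.IH[OF zs(1)] B[OF zs(2)] d' c unfolding compatible_right_invariant_metric_def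
      by (metis add_mono one_closed)
    finally show ?case by (simp add: algebra_simps)
  qed simp
qed

text \<open>Sampling the path of \<open>f\<close> at \<open>n\<close> equidistant times gives \<open>\<one> = f\<^sub>0, \<dots>, f\<^sub>n = f\<close> with consecutive
  distances less than \<open>\<epsilon>\<close>. By right invariance the quotients of consecutive samples lie in the
  \<open>\<epsilon>\<close>-ball around the identity, and \<open>f\<close> is their product.\<close>

lemma ball_power:
  assumes "\<epsilon> > 0"
  shows "\<exists>K\<ge>0. \<forall>f\<in>carrier G. \<exists>n. real n \<le> K * (d f \<one> + 1) \<and> f \<in> set_power G (mball \<one> \<epsilon>) n"
proof -
  obtain A where A: "\<And>f. f \<in> carrier G \<Longrightarrow> \<exists>\<gamma>. \<gamma> 0 = \<one> \<and> \<gamma> 1 = f \<and> \<gamma> \<in> {0..1} \<rightarrow> carrier G \<and>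
      (\<forall>s\<in>{0..1::real}. \<forall>t\<in>{0..1}. d (\<gamma> s) (\<gamma> t) \<le> A * (d f \<one> + 1) * \<bar>s - t\<bar>)"
    using paths by blast
  show ?thesis
  proof (intro exI[of _ "\<bar>A\<bar> / \<epsilon> + 1"] conjI ballI)
    show "0 \<le> \<bar>A\<bar> / \<epsilon> + 1" using assms by simp
    fix f assume f: "f \<in> carrier G"
    from A[OF f] obtain \<gamma> where \<gamma>: "\<gamma> 0 = \<one>" "\<gamma> 1 = f" "\<And>t. t \<in> {0..1} \<Longrightarrow> \<gamma> t \<in> carrier G"
      and lip: "\<And>s t. s \<in> {0..1} \<Longrightarrow> t \<in> {0..1} \<Longrightarrow> d (\<gamma> s) (\<gamma> t) \<le> A * (d f \<one> + 1) * \<bar>s - t\<bar>"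
      by (auto simp: Pi_iff)
    \<comment> \<open>The extra step makes the step length strictly smaller than \<open>\<epsilon>\<close>.\<close>
    define n where "n = Suc (nat \<lfloor>\<bar>A\<bar> * (d f \<one> + 1) / \<epsilon>\<rfloor>)"
    have nonneg_q: "0 \<le> \<bar>A\<bar> * (d f \<one> + 1) / \<epsilon>" using assms by simp
    have n_le: "real n \<le> \<bar>A\<bar> * (d f \<one> + 1) / \<epsilon> + 1"
      using nonneg_q unfolding n_def by (simp add: of_nat_nat)
    have n_gt: "\<bar>A\<bar> * (d f \<one> + 1) / \<epsilon> < real n"
      using nonneg_q unfolding n_def by simp linarith
    have n0: "n > 0" by (simp add: n_def)
    have step: "d (\<gamma> (real (Suc i) / n)) (\<gamma> (real i / n)) < \<epsilon>" if "i < n" for i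
    proof -
      have "real (Suc i) / n \<in> {0..1}" "real i / n \<in> {0..1}" using that by (auto simp: field_simps)
      from lip[OF this] have "d (\<gamma> (real (Suc i) / n)) (\<gamma> (real i / n)) \<le> A * (d f \<one> + 1) * (1 / n)"
        by (simp add: divide_simps split: if_splits)
      also have "\<dots> \<le> \<bar>A\<bar> * (d f \<one> + 1) * (1 / n)"
        by (intro mult_right_mono) auto
      also have "\<dots> < \<epsilon>" using n_gt assms n0 by (simp add: field_simps)
      finally show ?thesis .
    qed
    have "\<gamma> (real i / n) \<in> set_power G (mball \<one> \<epsilon>) i" if "i \<le> n" for i
      using that
    proof (induction i)
      case 0 then show ?case using \<gamma> by simp
    next
      case (Suc i)
      let ?x = "\<gamma> (real (Suc i) / n)" and ?y = "\<gamma> (real i / n)"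
      have c: "?x \<in> carrier G" "?y \<in> carrier G" using Suc.prems by (auto intro!: \<gamma>(3) simp: field_simps)
      have "d (?x \<otimes> inv ?y) \<one> < \<epsilon>"
        using right_invariant_dist_one[OF compatible c] step[of i] Suc.prems by simp
      then have "?x \<otimes> inv ?y \<in> mball \<one> \<epsilon>" using c by (simp add: commute)
      then have "?x \<otimes> inv ?y \<in> set_power G (mball \<one> \<epsilon>) 1"
        using subset_set_power_1[OF mball_subset_mspace] by blast
      then have "(?x \<otimes> inv ?y) \<otimes> ?y \<in> set_power G (mball \<one> \<epsilon>) (1 + i)"
        using Suc by (intro set_power_mult) auto
      then show ?case using c by (simp add: m_assoc)
    qed
    from this[of n] have fin: "f \<in> set_power G (mball \<one> \<epsilon>) n" using \<gamma> n0 by simp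
    have "(\<bar>A\<bar> / \<epsilon> + 1) * (d f \<one> + 1) = \<bar>A\<bar> * (d f \<one> + 1) / \<epsilon> + 1 + d f \<one>"
      using assms by (simp add: field_simps)
    with n_le nonneg[of f \<one>] have "real n \<le> (\<bar>A\<bar> / \<epsilon> + 1) * (d f \<one> + 1)" by linarith
    with fin show "\<exists>n. real n \<le> (\<bar>A\<bar> / \<epsilon> + 1) * (d f \<one> + 1) \<and> f \<in> set_power G (mball \<one> \<epsilon>) n" by blast
  qed
qed

lemma set_power_subset_generate:
  assumes "S \<subseteq> carrier G" shows "set_power G S n \<subseteq> generate G S"
proof (induction n)
  case (Suc n)
  then show ?case by (auto simp: set_mult_def intro: generate.eng[OF _ generate.incl])
qed (auto intro: generate.one)

text \<open>For property (OB), let \<open>d'\<close> be another compatible right-invariant metric. Its unit ball contains some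
  \<open>\<epsilon>\<close>-ball of \<open>d\<close>, and elements of the unit ball of \<open>d\<close> are products of a bounded number of elements
  of that \<open>\<epsilon>\<close>-ball. So they have bounded distance from the identity for \<open>d'\<close>.\<close>

lemma OB_generating_unit_ball: "OB_generating_set G T (mball \<one> 1)"
  unfolding OB_generating_set_def property_OB_def
proof (intro conjI ballI allI impI)
  show "openin T (mball \<one> 1)" using openin_mball mtopology_T by metis
  show "inv f \<in> mball \<one> 1" if "f \<in> mball \<one> 1" for f
    using that right_invariant_dist_one[OF compatible one_closed, of f] by (auto simp: commute)
  have "mball \<one> 1 \<subseteq> carrier G" by auto
  from generate_incl[OF this] ball_power[of 1] set_power_subset_generate[OF this]
  show "generate G (mball \<one> 1) = carrier G" by (auto simp: subset_iff)
  show "mball \<one> 1 \<subseteq> carrier G" by auto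
next
  fix d' assume d': "compatible_right_invariant_metric G T d'"
  interpret d': Metric_space "carrier G" d'
    using d' by (simp add: compatible_right_invariant_metric_def)
  have "openin mtopology (d'.mball \<one> 1)"
    using d' d'.openin_mball mtopology_T unfolding compatible_right_invariant_metric_def by metis
  then obtain \<epsilon> where \<epsilon>: "\<epsilon> > 0" "mball \<one> \<epsilon> \<subseteq> d'.mball \<one> 1"
    unfolding openin_mtopology by (metis d'.centre_in_mball_iff one_closed zero_less_one)
  obtain K where K: "K \<ge> 0" "\<And>f. f \<in> carrier G \<Longrightarrow> \<exists>n. real n \<le> K * (d f \<one> + 1) \<and> f \<in> set_power G (mball \<one> \<epsilon>) n"
    using ball_power[OF \<epsilon>(1)] by blast
  have bnd: "d' f \<one> \<le> K * 2" if f: "f \<in> mball \<one> 1" for f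
  proof -
    obtain n where n: "real n \<le> K * (d f \<one> + 1)" "f \<in> set_power G (mball \<one> \<epsilon>) n"
      using K(2)[of f] f by auto
    have "d' f \<one> \<le> real n * 1"
      by (rule right_invariant_dist_power[OF d' _ _ n(2)])
        (use \<epsilon>(2) in \<open>auto simp: subset_iff d'.commute less_imp_le\<close>)
    also have "\<dots> \<le> K * (d f \<one> + 1)" using n by simp
    also have "\<dots> \<le> K * 2" using f K(1) by (intro mult_left_mono) (auto simp: commute)
    finally show ?thesis .
  qed
  show "\<exists>B. \<forall>f\<in>mball \<one> 1. \<forall>g\<in>mball \<one> 1. d' f g \<le> B"
  proof (intro exI ballI)
    fix f g assume fg: "f \<in> mball \<one> 1" "g \<in> mball \<one> 1"
    then have "d' f g \<le> d' f \<one> + d' \<one> g" by (intro d'.triangle) auto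
    also have "\<dots> \<le> K * 4" using bnd[OF fg(1)] bnd[OF fg(2)] d'.commute[of \<one> g] by simp
    finally show "d' f g \<le> K * 4" .
  qed
qed

context
  fixes \<Sigma> assumes \<Sigma>: "OB_generating_set G T \<Sigma>"
begin

lemma \<Sigma>_carrier: "\<Sigma> \<subseteq> carrier G"
  using \<Sigma> by (simp add: OB_generating_set_def property_OB_def)

text \<open>If \<open>s \<in> \<Sigma>\<close>, then \<open>\<Sigma>\<close> contains a ball around \<open>s\<close>, and multiplying by \<open>s\<inverse> \<in> \<Sigma>\<close> moves this ball to the
  identity; so a ball around the identity lies in \<open>\<Sigma>\<^sup>2\<close>. The empty set generates only the trivial
  group, where \<open>\<Sigma>\<^sup>0\<close> is everything.\<close>

lemma ball_subset_power: "\<exists>\<epsilon>>0. \<exists>k. mball \<one> \<epsilon> \<subseteq> set_power G \<Sigma> k"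
proof (cases "\<Sigma> = {}")
  case True
  have "carrier G = {\<one>}"
    using \<Sigma> generate_empty unfolding OB_generating_set_def True by auto
  then have "mball \<one> 1 \<subseteq> set_power G \<Sigma> 0" using mball_subset_mspace[of \<one> 1] by simp
  then show ?thesis by (metis zero_less_one)
next
  case False
  then obtain s where s: "s \<in> \<Sigma>" "inv s \<in> \<Sigma>" using \<Sigma> by (auto simp: OB_generating_set_def)
  have sc: "s \<in> carrier G" using s \<Sigma>_carrier by auto
  have "openin mtopology \<Sigma>" using \<Sigma> mtopology_T by (simp add: OB_generating_set_def)
  then obtain \<epsilon> where \<epsilon>: "\<epsilon> > 0" "mball s \<epsilon> \<subseteq> \<Sigma>" using s unfolding openin_mtopology by blast
  have "g \<in> set_power G \<Sigma> (1 + 1)" if g: "g \<in> mball \<one> \<epsilon>" for g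
  proof -
    have gc: "g \<in> carrier G" using g by simp
    have "d (\<one> \<otimes> s) (g \<otimes> s) = d \<one> g"
      using compatible gc sc unfolding compatible_right_invariant_metric_def by blast
    then have "g \<otimes> s \<in> mball s \<epsilon>" using g sc by simp
    then have "g \<otimes> s \<in> \<Sigma>" using \<epsilon> by blast
    then have "(g \<otimes> s) \<otimes> inv s \<in> set_power G \<Sigma> (1 + 1)"
      using s subset_set_power_1[OF \<Sigma>_carrier] by (intro set_power_mult \<Sigma>_carrier) auto
    then show ?thesis using gc sc by (simp add: m_assoc)
  qed
  then show ?thesis using \<epsilon>(1) by blast
qed

text \<open>A set containing a neighbourhood of the identity in some power inherits the linear word length
  bound from small balls. In particular the minimum in the Cayley metric is over a nonempty set.\<close>

lemma power_exhausts: "\<exists>K\<ge>0. \<forall>f\<in>carrier G. \<exists>n. real n \<le> K * (d f \<one> + 1) \<and> f \<in> set_power G \<Sigma> n"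
proof -
  obtain \<epsilon> k where \<epsilon>: "\<epsilon> > 0" "mball \<one> \<epsilon> \<subseteq> set_power G \<Sigma> k" using ball_subset_power by blast
  obtain K where K: "K \<ge> 0" "\<And>f. f \<in> carrier G \<Longrightarrow> \<exists>n. real n \<le> K * (d f \<one> + 1) \<and> f \<in> set_power G (mball \<one> \<epsilon>) n"
    using ball_power[OF \<epsilon>(1)] by blast
  have "\<exists>n. real n \<le> (real k * K) * (d f \<one> + 1) \<and> f \<in> set_power G \<Sigma> n"
    if f: "f \<in> carrier G" for f
  proof -
    obtain n where n: "real n \<le> K * (d f \<one> + 1)" "f \<in> set_power G (mball \<one> \<epsilon>) n"
      using K(2)[OF f] by blast
    then have "f \<in> set_power G \<Sigma> (k * n)" using set_power_trans[OF \<Sigma>_carrier \<epsilon>(2)] by blast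
    moreover have "real (k * n) \<le> (real k * K) * (d f \<one> + 1)"
      using mult_left_mono[OF n(1), of "real k"] by (simp add: mult.assoc)
    ultimately show ?thesis by blast
  qed
  then show ?thesis using K(1) by (intro exI[of _ "real k * K"]) auto
qed

lemma cayley_dist_power:
  assumes "f \<in> carrier G" "g \<in> carrier G"
  shows "\<exists>n. cayley_dist G \<Sigma> f g = real n \<and> f \<otimes> inv g \<in> set_power G \<Sigma> n"
proof -
  have "f \<otimes> inv g \<in> carrier G" using assms by simp
  then have "\<exists>n. f \<otimes> inv g \<in> set_power G \<Sigma> n" using power_exhausts by blast
  from LeastI_ex[OF this] show ?thesis unfolding cayley_dist_def by blast
qed

lemma cayley_dist_le: "f \<otimes> inv g \<in> set_power G \<Sigma> n \<Longrightarrow> cayley_dist G \<Sigma> f g \<le> real n"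
  unfolding cayley_dist_def by (simp add: Least_le)

lemma cayley_dist_triangle:
  assumes "f \<in> carrier G" "g \<in> carrier G" "h \<in> carrier G"
  shows "cayley_dist G \<Sigma> f h \<le> cayley_dist G \<Sigma> f g + cayley_dist G \<Sigma> g h"
proof -
  obtain m n where mn: "cayley_dist G \<Sigma> f g = real m" "f \<otimes> inv g \<in> set_power G \<Sigma> m"
    "cayley_dist G \<Sigma> g h = real n" "g \<otimes> inv h \<in> set_power G \<Sigma> n"
    using cayley_dist_power assms by meson
  have "(f \<otimes> inv g) \<otimes> (g \<otimes> inv h) = f \<otimes> inv h"
    using assms by (metis inv_closed inv_solve_left m_assoc m_closed)
  then have "f \<otimes> inv h \<in> set_power G \<Sigma> (m + n)"
    using set_power_mult[OF \<Sigma>_carrier mn(2) mn(4)] by simp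
  from cayley_dist_le[OF this] mn show ?thesis by simp
qed

text \<open>One inequality holds because \<open>\<Sigma>\<close> is bounded for \<open>d\<close>, by property (OB), and distance is subadditive
  along words; the other is the linear bound on word length.\<close>

lemma quasi_isometric_cayley_dist:
  "quasi_isometric (carrier G) (cayley_dist G \<Sigma>) (carrier G) d"
proof -
  obtain K where K: "K \<ge> 0" "\<And>f. f \<in> carrier G \<Longrightarrow> \<exists>n. real n \<le> K * (d f \<one> + 1) \<and> f \<in> set_power G \<Sigma> n"
    using power_exhausts by blast
  obtain B where B: "B \<ge> 0" "\<And>s. s \<in> \<Sigma> \<Longrightarrow> d s \<one> \<le> B"
  proof (cases "\<Sigma> = {}")
    case False
    then obtain s0 where s0: "s0 \<in> \<Sigma>" by blast
    obtain B where B: "\<And>f g. f \<in> \<Sigma> \<Longrightarrow> g \<in> \<Sigma> \<Longrightarrow> d f g \<le> B"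
      using \<Sigma> compatible unfolding OB_generating_set_def property_OB_def by blast
    have "d s \<one> \<le> \<bar>B + d s0 \<one>\<bar>" if "s \<in> \<Sigma>" for s
      using triangle[of s s0 \<one>] B[OF that s0] \<Sigma>_carrier s0 that by force
    then show ?thesis using that[of "\<bar>B + d s0 \<one>\<bar>"] by auto
  qed (use that[of 0] in auto)
  have up: "d f g \<le> B * cayley_dist G \<Sigma> f g" if fg: "f \<in> carrier G" "g \<in> carrier G" for f g
  proof -
    obtain n where n: "cayley_dist G \<Sigma> f g = real n" "f \<otimes> inv g \<in> set_power G \<Sigma> n"
      using cayley_dist_power fg by blast
    show ?thesis
      using right_invariant_dist_power[OF compatible \<Sigma>_carrier B(2) n(2)]
        right_invariant_dist_one[OF compatible fg] n(1) by (simp add: mult.commute)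
  qed
  have lo: "cayley_dist G \<Sigma> f g \<le> K * (d f g + 1)" if fg: "f \<in> carrier G" "g \<in> carrier G" for f g
  proof -
    have "f \<otimes> inv g \<in> carrier G" using fg by simp
    then obtain n where n: "real n \<le> K * (d (f \<otimes> inv g) \<one> + 1)" "f \<otimes> inv g \<in> set_power G \<Sigma> n"
      using K by blast
    show ?thesis using cayley_dist_le[OF n(2)] n(1) right_invariant_dist_one[OF compatible fg] by simp
  qed
  let ?L = "1 + B + K"
  show ?thesis
    unfolding quasi_isometric_def
  proof (intro exI conjI ballI)
    show "id \<in> carrier G \<rightarrow> carrier G" "1 \<le> ?L" "(1::real) \<ge> 0" using B K by auto
    fix f g assume fg: "f \<in> carrier G" "g \<in> carrier G"
    have c0: "cayley_dist G \<Sigma> f g \<ge> 0" by (simp add: cayley_dist_def)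
    show "d (id f) (id g) \<le> ?L * cayley_dist G \<Sigma> f g + 1"
      using up[OF fg] c0 mult_nonneg_nonneg[OF K(1) c0] unfolding distrib_right id_apply by linarith
    have "K * (d f g + 1) \<le> ?L * (d f g + 1)" using B by (intro mult_right_mono) auto
    then have "cayley_dist G \<Sigma> f g \<le> ?L * (d f g + 1)" using lo[OF fg] by linarith
    then show "(1 / ?L) * cayley_dist G \<Sigma> f g - 1 \<le> d (id f) (id g)"
    proof -
      have "?L > 0" using B(1) K(1) by linarith
      then have "cayley_dist G \<Sigma> f g / ?L \<le> d f g + 1"
        using \<open>cayley_dist G \<Sigma> f g \<le> ?L * (d f g + 1)\<close> by (simp only: pos_divide_le_eq mult.commute)
      then show ?thesis by simp
    qed
  next
    fix y assume "y \<in> carrier G"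
    then show "\<exists>x\<in>carrier G. d y (id x) \<le> 1" by (intro bexI[of _ y]) auto
  qed
qed

end

lemma group_quasi_isometric_to_metric:
  assumes Y: "Metric_space Y dY" and q: "quasi_isometric (carrier G) d Y dY"
  shows "group_quasi_isometric_to_metric G T Y dY"
  unfolding group_quasi_isometric_to_metric_def
  using OB_generating_unit_ball quasi_isometric_trans[OF quasi_isometric_cayley_dist q] Metric_space.triangle[OF Y]
  by blast

end

text \<open>The common model space \<open>Y\<close> mediates. Composing with a quasi-isometry into a Cayley metric needs the
  triangle inequality for it, which is where \<open>cayley_dist_triangle\<close> enters.\<close>

lemma groups_quasi_isometric_via_metric:
  assumes G: "path_group G T d" and H: "path_group H T' d'" and Y: "Metric_space Y dY"
    and GY: "quasi_isometric (carrier G) d Y dY" and HY: "quasi_isometric (carrier H) d' Y dY"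
  shows "groups_quasi_isometric G T H T'"
proof -
  interpret G: path_group G T d by (fact G)
  interpret H: path_group H T' d' by (fact H)
  have YH: "quasi_isometric Y dY (carrier H) d'" by (rule quasi_isometric_sym[OF Y HY])
  have "quasi_isometric (carrier G) (cayley_dist G \<Sigma>) (carrier H) (cayley_dist H \<Sigma>')"
    if s: "OB_generating_set G T \<Sigma>" "OB_generating_set H T' \<Sigma>'" for \<Sigma> \<Sigma>'
  proof -
    have "quasi_isometric (carrier G) (cayley_dist G \<Sigma>) Y dY"
      by (rule quasi_isometric_trans[OF G.quasi_isometric_cayley_dist[OF s(1)] GY Metric_space.triangle[OF Y]])
    then have "quasi_isometric (carrier G) (cayley_dist G \<Sigma>) (carrier H) d'"
      by (rule quasi_isometric_trans[OF _ YH H.triangle])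
    moreover have "quasi_isometric (carrier H) d' (carrier H) (cayley_dist H \<Sigma>')"
      by (rule quasi_isometric_sym[OF H.Metric_space_axioms H.quasi_isometric_cayley_dist[OF s(2)]])
    ultimately show ?thesis
      by (rule quasi_isometric_trans) (rule H.cayley_dist_triangle[OF s(2)])
  qed
  then show ?thesis
    unfolding groups_quasi_isometric_def using G.OB_generating_unit_ball H.OB_generating_unit_ball by blast
qed

section \<open>The space of continuous functions on the interval\<close>

lemma mspace_C01: "f \<in> mspace C01 \<longleftrightarrow> f \<in> extensional {0..1} \<and> continuous_on {0..1} f"
proof -
  have "compactin (top_of_set {0..1::real}) (topspace (top_of_set {0..1}))"
    by (simp add: compactin_subtopology)
  from compactin_mspace_cfunspace[OF this, of euclidean_metric]
  have "mspace C01 = {f \<in> extensional {0..1}. continuous_on {0..1} f}"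
    unfolding C01_def by (simp add: continuous_map_iff_continuous del: mspace_cfunspace)
  then show ?thesis by blast
qed

lemma restrict_C01: "continuous_on {0..1} f \<Longrightarrow> restrict f {0..1} \<in> mspace C01"
  unfolding mspace_C01
  by (metis restrict_extensional restrict_apply continuous_on_cong)

lemma mdist_C01_le_iff:
  assumes "f \<in> mspace C01" "g \<in> mspace C01"
  shows "mdist C01 f g \<le> c \<longleftrightarrow> (\<forall>x\<in>{0..1}. \<bar>f x - g x\<bar> \<le> c)"
  using cfunspace_mdist_le[of f "top_of_set {0..1}" euclidean_metric g c] assms
  unfolding C01_def by (simp add: dist_real_def del: mspace_cfunspace)

lemma mdist_C01_upper:
  assumes "f \<in> mspace C01" "g \<in> mspace C01" "x \<in> {0..1}"
  shows "\<bar>f x - g x\<bar> \<le> mdist C01 f g"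
  using mdist_C01_le_iff[OF assms(1,2)] assms(3) by blast

text \<open>A distance in \<open>C[0,1]\<close> is determined by its upper bounds. This form suits invariance under a change
  of variables, which permutes the points at which the bounds are tested.\<close>

lemma mdist_C01_eqI:
  assumes "f \<in> mspace C01" "g \<in> mspace C01" "f' \<in> mspace C01" "g' \<in> mspace C01"
    and "\<And>c. (\<forall>x\<in>{0..1}. \<bar>f x - g x\<bar> \<le> c) \<longleftrightarrow> (\<forall>x\<in>{0..1}. \<bar>f' x - g' x\<bar> \<le> c)"
  shows "mdist C01 f g = mdist C01 f' g'"
  using mdist_C01_le_iff[OF assms(1,2)] mdist_C01_le_iff[OF assms(3,4)] assms(5)
  by (metis dual_order.eq_iff)

lemma mdist_C01_eq_SUP:
  assumes "f \<in> mspace C01" "g \<in> mspace C01"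
  shows "mdist C01 f g = (SUP x\<in>{0..1}. \<bar>f x - g x\<bar>)"
proof (rule antisym)
  have bdd: "bdd_above ((\<lambda>x. \<bar>f x - g x\<bar>) ` {0..1})"
    using mdist_C01_upper[OF assms] by (intro bdd_aboveI2)
  show "mdist C01 f g \<le> (SUP x\<in>{0..1}. \<bar>f x - g x\<bar>)"
    unfolding mdist_C01_le_iff[OF assms] using bdd by (intro ballI cSUP_upper)
  show "(SUP x\<in>{0..1}. \<bar>f x - g x\<bar>) \<le> mdist C01 f g"
    using mdist_C01_upper[OF assms] by (intro cSUP_least) auto
qed

lemma add_C01:
  assumes "f \<in> mspace C01" "g \<in> mspace C01" shows "(\<lambda>x\<in>{0..1}. f x + g x) \<in> mspace C01"
  using assms by (intro restrict_C01 continuous_intros) (auto simp: mspace_C01)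

lemma group_C01_group: "group C01_group"
proof (rule groupI)
  show "\<one>\<^bsub>C01_group\<^esub> \<in> carrier C01_group"
    unfolding C01_group_def by (simp add: restrict_C01)
  fix f assume f: "f \<in> carrier C01_group"
  have "(\<lambda>x\<in>{0..1}. - f x) \<in> mspace C01"
    using f by (intro restrict_C01 continuous_intros) (auto simp: mspace_C01 C01_group_def)
  then show "\<exists>g\<in>carrier C01_group. g \<otimes>\<^bsub>C01_group\<^esub> f = \<one>\<^bsub>C01_group\<^esub>"
    unfolding C01_group_def by (intro bexI[of _ "\<lambda>x\<in>{0..1}. - f x"]) auto
  show "\<one>\<^bsub>C01_group\<^esub> \<otimes>\<^bsub>C01_group\<^esub> f = f"
    using f unfolding C01_group_def by (auto simp: mspace_C01 fun_eq_iff extensional_def)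
next
  fix f g assume "f \<in> carrier C01_group" "g \<in> carrier C01_group"
  then show "f \<otimes>\<^bsub>C01_group\<^esub> g \<in> carrier C01_group"
    using add_C01 by (simp add: C01_group_def)
next
  fix f g h assume "f \<in> carrier C01_group" "g \<in> carrier C01_group" "h \<in> carrier C01_group"
  then show "f \<otimes>\<^bsub>C01_group\<^esub> g \<otimes>\<^bsub>C01_group\<^esub> h = f \<otimes>\<^bsub>C01_group\<^esub> (g \<otimes>\<^bsub>C01_group\<^esub> h)"
    unfolding C01_group_def by (auto simp: fun_eq_iff)
qed

text \<open>The paths are the segments \<open>t \<mapsto> t f\<close>.\<close>

lemma path_group_C01_group: "path_group C01_group (mtopology_of C01) (mdist C01)"
proof (intro path_group.intro path_group_axioms.intro group_C01_group)
  show "compatible_right_invariant_metric C01_group (mtopology_of C01) (mdist C01)"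
    unfolding compatible_right_invariant_metric_def C01_group_def mtopology_of_def
    by (auto intro!: mdist_C01_eqI add_C01)
  show "\<exists>A. \<forall>f\<in>carrier C01_group. \<exists>\<gamma>. \<gamma> 0 = \<one>\<^bsub>C01_group\<^esub> \<and> \<gamma> 1 = f \<and>
      \<gamma> \<in> {0..1} \<rightarrow> carrier C01_group \<and>
      (\<forall>s\<in>{0..1}. \<forall>t\<in>{0..1}. mdist C01 (\<gamma> s) (\<gamma> t) \<le> A * (mdist C01 f \<one>\<^bsub>C01_group\<^esub> + 1) * \<bar>s - t\<bar>)"
  proof (intro exI[of _ 1] ballI)
    fix f assume "f \<in> carrier C01_group"
    then have f: "f \<in> mspace C01" by (simp add: C01_group_def)
    have 0: "(\<lambda>x\<in>{0..1}. 0) \<in> mspace C01" by (simp add: restrict_C01)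
    let ?\<gamma> = "\<lambda>t. \<lambda>x\<in>{0..1}. t * f x"
    have \<gamma>: "?\<gamma> t \<in> mspace C01" for t
      using f by (intro restrict_C01 continuous_intros) (auto simp: mspace_C01)
    have "mdist C01 (?\<gamma> s) (?\<gamma> t) \<le> 1 * (mdist C01 f (\<lambda>x\<in>{0..1}. 0) + 1) * \<bar>s - t\<bar>" for s t
      unfolding mdist_C01_le_iff[OF \<gamma> \<gamma>]
    proof
      fix x :: real assume x: "x \<in> {0..1}"
      have "\<bar>?\<gamma> s x - ?\<gamma> t x\<bar> = \<bar>f x\<bar> * \<bar>s - t\<bar>"
        using x by (simp add: left_diff_distrib[symmetric] abs_mult mult.commute)
      also have "\<dots> \<le> (mdist C01 f (\<lambda>x\<in>{0..1}. 0) + 1) * \<bar>s - t\<bar>"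
        using mdist_C01_upper[OF f 0 x] x by (intro mult_right_mono) auto
      finally show "\<bar>?\<gamma> s x - ?\<gamma> t x\<bar> \<le> 1 * (mdist C01 f (\<lambda>x\<in>{0..1}. 0) + 1) * \<bar>s - t\<bar>" by simp
    qed
    moreover have "?\<gamma> 1 = f" using f by (auto simp: mspace_C01 fun_eq_iff extensional_def)
    ultimately show "\<exists>\<gamma>. \<gamma> 0 = \<one>\<^bsub>C01_group\<^esub> \<and> \<gamma> 1 = f \<and> \<gamma> \<in> {0..1} \<rightarrow> carrier C01_group \<and>
      (\<forall>s\<in>{0..1}. \<forall>t\<in>{0..1}. mdist C01 (\<gamma> s) (\<gamma> t) \<le> 1 * (mdist C01 f \<one>\<^bsub>C01_group\<^esub> + 1) * \<bar>s - t\<bar>)"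
      using \<gamma> by (intro exI[of _ ?\<gamma>]) (auto simp: C01_group_def)
  qed
qed

section \<open>Absorbing boundary values: hyperplanes of \<open>C[0,1]\<close>\<close>

text \<open>In the variable \<open>1 / x\<close> these are tents of half-width 1/2 around the integers \<open>2, 3, \<dots>\<close>. The sets
  where they are nonzero are pairwise disjoint, accumulate only at 0, and avoid 0 (where
  \<open>1 / 0 = 0\<close>) and 1.\<close>

definition bump :: "nat \<Rightarrow> real \<Rightarrow> real"
  where "bump n x = max 0 (1 - 2 * \<bar>1 / x - real (n + 2)\<bar>)"

definition bump_pt :: "nat \<Rightarrow> real"
  where "bump_pt n = 1 / real (n + 2)"

text \<open>The function that takes the value \<open>a n\<close> at the \<open>n\<close>-th sample point. By disjointness the sum has
  at most one term.\<close>

definition bump_sum :: "(nat \<Rightarrow> real) \<Rightarrow> real \<Rightarrow> real"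
  where "bump_sum a x = (\<Sum>n | bump n x \<noteq> 0. a n * bump n x)"

lemma bump_nonzeroD:
  assumes "bump n x \<noteq> 0" shows "real n + 3 / 2 < 1 / x" "1 / x < real n + 5 / 2"
proof -
  define y where "y = 1 / x"
  have "max 0 (1 - 2 * \<bar>y - real (n + 2)\<bar>) \<noteq> 0"
    using assms unfolding bump_def y_def .
  then have "\<bar>y - real (n + 2)\<bar> < 1 / 2" by (simp add: max_def split: if_splits)
  then have "real n + 3 / 2 < y" "y < real n + 5 / 2" by (simp_all add: abs_if split: if_splits)
  then show "real n + 3 / 2 < 1 / x" "1 / x < real n + 5 / 2" unfolding y_def .
qed

lemma bump_disjoint:
  assumes "bump n x \<noteq> 0" "bump m x \<noteq> 0" shows "m = n"
proof -
  have "real m < real (n + 1)" "real n < real (m + 1)"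
    using bump_nonzeroD[OF assms(1)] bump_nonzeroD[OF assms(2)] by linarith+
  then show ?thesis by linarith
qed

lemma bump_cases:
  obtains "{n. bump n x \<noteq> 0} = {}" | m where "{n. bump n x \<noteq> 0} = {m}"
  using bump_disjoint by (cases "{n. bump n x \<noteq> 0} = {}") blast+

lemma abs_bump_sum_le:
  assumes "c \<ge> 0" "\<And>n. bump n x \<noteq> 0 \<Longrightarrow> \<bar>a n\<bar> \<le> c"
  shows "\<bar>bump_sum a x\<bar> \<le> c"
proof (cases rule: bump_cases[of x])
  case (2 m)
  have "\<bar>a m\<bar> * \<bar>bump m x\<bar> \<le> c * 1"
    using assms 2 by (intro mult_mono) (auto simp: bump_def)
  then show ?thesis unfolding bump_sum_def 2 by (simp add: abs_mult)
qed (use assms in \<open>simp add: bump_sum_def\<close>)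

lemma bump_sum_diff: "bump_sum a x - bump_sum b x = bump_sum (\<lambda>n. a n - b n) x"
  unfolding bump_sum_def by (simp add: sum_subtractf left_diff_distrib)

lemma bump_sum_pt: "bump_sum a (bump_pt n) = a n"
proof -
  have 1: "bump n (bump_pt n) = 1" by (simp add: bump_def bump_pt_def)
  then have "{m. bump m (bump_pt n) \<noteq> 0} = {n}" using bump_disjoint[of n "bump_pt n"] by force
  then show ?thesis unfolding bump_sum_def using 1 by simp
qed

lemma bump_sum_0: "bump_sum a 0 = 0" and bump_sum_1: "bump_sum a 1 = 0"
  by (simp_all add: bump_sum_def bump_def)

lemma bump_pt_in: "bump_pt n \<in> {0..1}"
  by (simp add: bump_pt_def)

lemma bump_pt_tendsto: "bump_pt \<longlonglongrightarrow> 0"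
  unfolding bump_pt_def using LIMSEQ_ignore_initial_segment[OF lim_1_over_n, of 2] by simp

lemma bump_eq_0:
  assumes "x > 0" "1 / x \<le> real n" shows "bump n x = 0"
  using assms unfolding bump_def by simp

text \<open>Away from 0 the sum is locally a finite sum with a fixed index range; at 0 its size is governed by
  the tail of the null sequence \<open>a\<close>.\<close>

lemma continuous_on_bump_sum:
  assumes a: "a \<longlonglongrightarrow> 0"
  shows "continuous_on {0..1} (bump_sum a)"
  unfolding continuous_on_eq_continuous_within
proof
  fix x :: real assume x: "x \<in> {0..1}"
  show "continuous (at x within {0..1}) (bump_sum a)"
  proof (cases "x = 0")
    case False
    define N where "N = nat \<lceil>2 / x\<rceil>"
    have x0: "x > 0" using False x by simp
    have eq: "bump_sum a y = (\<Sum>n<N. a n * bump n y)" if "y \<in> {x/2<..}" for y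
    proof -
      have y: "y > 0" "y \<ge> x / 2" using that x0 by auto
      have yN: "1 / y \<le> real N"
      proof -
        have "1 / y \<le> 1 / (x / 2)" using y x0 by (intro divide_left_mono) auto
        then show ?thesis unfolding N_def by (simp add: le_of_int_ceiling order_trans real_nat_ceiling_ge)
      qed
      have "{n. bump n y \<noteq> 0} \<subseteq> {..<N}"
      proof
        fix n assume "n \<in> {n. bump n y \<noteq> 0}"
        then have "\<not> 1 / y \<le> real n" using bump_eq_0[OF y(1), of n] by auto
        then show "n \<in> {..<N}" using yN by simp
      qed
      then show ?thesis unfolding bump_sum_def by (intro sum.mono_neutral_left) auto
    qed
    have "continuous (at x) (\<lambda>y. \<Sum>n<N. a n * bump n y)"
      unfolding bump_def using x0 by (intro continuous_intros) auto
    moreover have "\<forall>\<^sub>F y in nhds x. y \<in> {x/2<..}"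
      using x0 by (intro eventually_nhds_in_open) auto
    then have "\<forall>\<^sub>F y in nhds x. bump_sum a y = (\<Sum>n<N. a n * bump n y)"
      by (rule eventually_mono) (use eq in blast)
    ultimately have "continuous (at x) (bump_sum a)"
      by (subst isCont_cong)
    then show ?thesis by (rule continuous_at_imp_continuous_at_within)
  next
    case True
    show ?thesis
      unfolding True continuous_within_eps_delta
    proof (intro allI impI)
      fix e :: real assume e: "e > 0"
      from LIMSEQ_D[OF a, of "e/2"] e obtain M where M: "\<And>n. n \<ge> M \<Longrightarrow> \<bar>a n\<bar> < e / 2" by auto
      have "\<bar>bump_sum a y\<bar> \<le> e / 2" if y: "y \<in> {0..1}" "y < 1 / real (M + 3)" for y
      proof (cases "y = 0")
        case False
        then have "y > 0" using y by simp
        have big: "real (M + 3) < 1 / y" using y \<open>y > 0\<close> by (simp add: field_simps)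
        have "M \<le> n" if "bump n y \<noteq> 0" for n
        proof -
          have "real M < real n" using big bump_nonzeroD[OF that] by linarith
          then show ?thesis by simp
        qed
        then show ?thesis using M e by (intro abs_bump_sum_le) (auto simp: less_imp_le)
      qed (use e in \<open>simp add: bump_sum_0\<close>)
      then show "\<exists>d>0. \<forall>x'\<in>{0..1}. dist x' 0 < d \<longrightarrow> dist (bump_sum a x') (bump_sum a 0) < e"
        using e by (intro exI[of _ "1 / real (M + 3)"]) (fastforce simp: bump_sum_0)
    qed
  qed
qed

text \<open>The values that \<open>absorb f\<close> is to take at the sample points. After \<open>f 0\<close> come the samples of
  \<open>f x - f 0 * (1 - x)\<close>, each one place late. The factor \<open>1 - x\<close> instead of 1 leaves \<open>f 1\<close>
  untouched, so that the construction can be applied among functions with \<open>f 1 = 0\<close> as well.\<close>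

definition shift_seq :: "(real \<Rightarrow> real) \<Rightarrow> nat \<Rightarrow> real"
  where "shift_seq f n = (case n of 0 \<Rightarrow> f 0 | Suc m \<Rightarrow> f (bump_pt m) - f 0 * (1 - bump_pt m))"

text \<open>The function \<open>f x - f 0 * (1 - x)\<close> has the value \<open>shift_seq f (Suc n)\<close> at the \<open>n\<close>-th sample point;
  the bumps replace it by \<open>shift_seq f n\<close>.\<close>

definition absorb :: "(real \<Rightarrow> real) \<Rightarrow> real \<Rightarrow> real"
  where "absorb f = (\<lambda>x\<in>{0..1}. f x - f 0 * (1 - x)
     + bump_sum (\<lambda>n. shift_seq f n - shift_seq f (Suc n)) x)"

text \<open>The inverse of \<open>absorb\<close>: read off the stored value at the first sample point and move all samples
  one place back.\<close>

definition release :: "(real \<Rightarrow> real) \<Rightarrow> real \<Rightarrow> real"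
  where "release g = (\<lambda>x\<in>{0..1}. g x + g (bump_pt 0) * (1 - x)
     - bump_sum (\<lambda>n. g (bump_pt n) - g (bump_pt (Suc n))) x)"

lemma bump_pt_sampling:
  assumes "continuous_on {0..1} f" shows "(\<lambda>n. f (bump_pt n)) \<longlonglongrightarrow> f 0"
  using continuous_on_tendsto_compose[OF assms bump_pt_tendsto] bump_pt_in by simp

lemma shift_seq_tendsto:
  assumes "continuous_on {0..1} f" shows "shift_seq f \<longlonglongrightarrow> 0"
proof -
  have "(\<lambda>n. f (bump_pt n) - f 0 * (1 - bump_pt n)) \<longlonglongrightarrow> f 0 - f 0 * (1 - 0)"
    by (intro tendsto_intros bump_pt_sampling assms bump_pt_tendsto)
  then have "(\<lambda>n. shift_seq f (Suc n)) \<longlonglongrightarrow> 0" by (simp add: shift_seq_def)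
  then show ?thesis by (rule LIMSEQ_imp_Suc)
qed

lemma absorb_C01: assumes "f \<in> mspace C01" shows "absorb f \<in> mspace C01"
proof -
  have c: "continuous_on {0..1} f" using assms by (simp add: mspace_C01)
  have "(\<lambda>n. shift_seq f n - shift_seq f (Suc n)) \<longlonglongrightarrow> 0 - 0"
    using shift_seq_tendsto[OF c] by (intro tendsto_diff) (auto intro: LIMSEQ_Suc)
  then show ?thesis
    unfolding absorb_def by (intro restrict_C01 continuous_intros c continuous_on_bump_sum) auto
qed

lemma release_C01: assumes "g \<in> mspace C01" shows "release g \<in> mspace C01"
proof -
  have c: "continuous_on {0..1} g" using assms by (simp add: mspace_C01)
  have "(\<lambda>n. g (bump_pt n) - g (bump_pt (Suc n))) \<longlonglongrightarrow> g 0 - g 0"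
    using bump_pt_sampling[OF c] by (intro tendsto_diff) (auto intro: LIMSEQ_Suc)
  then show ?thesis
    unfolding release_def by (intro restrict_C01 continuous_intros c continuous_on_bump_sum) auto
qed

lemma absorb_0: "absorb f 0 = 0" and absorb_1: "absorb f 1 = f 1"
  by (simp_all add: absorb_def bump_sum_0 bump_sum_1)

lemma release_0: "g 0 = 0 \<Longrightarrow> release g 0 = g (bump_pt 0)" and release_1: "release g 1 = g 1"
  by (simp_all add: release_def bump_sum_0 bump_sum_1)

lemma absorb_pt: "absorb f (bump_pt n) = shift_seq f n"
  using bump_pt_in[of n] by (simp add: absorb_def bump_sum_pt shift_seq_def)

lemma release_absorb:
  assumes "f \<in> extensional {0..1}" shows "release (absorb f) = f"
proof
  fix x show "release (absorb f) x = f x"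
  proof (cases "x \<in> {0..1}")
    case True
    then have "release (absorb f) x = absorb f x + shift_seq f 0 * (1 - x)
      - bump_sum (\<lambda>n. shift_seq f n - shift_seq f (Suc n)) x"
      unfolding release_def absorb_pt by simp
    also have "\<dots> = f x" using True by (simp add: absorb_def shift_seq_def)
    finally show ?thesis .
  qed (use assms in \<open>auto simp: release_def extensional_def\<close>)
qed

lemma absorb_release:
  assumes "g \<in> extensional {0..1}" "g 0 = 0" shows "absorb (release g) = g"
proof
  have s: "shift_seq (release g) n = g (bump_pt n)" for n
    using bump_pt_in[of "n - 1"] assms(2)
    by (cases n) (auto simp: shift_seq_def release_0 release_def bump_sum_pt bump_sum_0)
  fix x show "absorb (release g) x = g x"
  proof (cases "x \<in> {0..1}")
    case True
    then have "absorb (release g) x = release g x - g (bump_pt 0) * (1 - x)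
      + bump_sum (\<lambda>n. g (bump_pt n) - g (bump_pt (Suc n))) x"
      unfolding absorb_def s release_0[of g, OF assms(2)] by simp
    also have "\<dots> = g x" using True by (simp add: release_def)
    finally show ?thesis .
  qed (use assms in \<open>auto simp: absorb_def extensional_def\<close>)
qed

lemma mdist_absorb_le:
  assumes f: "f \<in> mspace C01" and g: "g \<in> mspace C01"
  shows "mdist C01 (absorb f) (absorb g) \<le> 6 * mdist C01 f g"
  unfolding mdist_C01_le_iff[OF absorb_C01[OF f] absorb_C01[OF g]]
proof
  fix x :: real assume x: "x \<in> {0..1}"
  let ?D = "mdist C01 f g"
  have scaled: "\<bar>f 0 * (1 - y) - g 0 * (1 - y)\<bar> \<le> ?D" if y: "y \<in> {0..1}" for y
  proof -
    have "\<bar>f 0 * (1 - y) - g 0 * (1 - y)\<bar> = \<bar>f 0 - g 0\<bar> * \<bar>1 - y\<bar>"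
      by (simp add: left_diff_distrib[symmetric] abs_mult)
    also have "\<dots> \<le> ?D * 1"
      using y mdist_C01_upper[OF f g, of 0] by (intro mult_mono) auto
    finally show ?thesis by simp
  qed
  have s: "\<bar>shift_seq f n - shift_seq g n\<bar> \<le> 2 * ?D" for n
  proof (cases n)
    case 0
    then show ?thesis using mdist_C01_upper[OF f g, of 0] by (simp add: shift_seq_def)
  next
    case (Suc m)
    then show ?thesis
      using mdist_C01_upper[OF f g bump_pt_in[of m]] scaled[OF bump_pt_in[of m]]
      by (simp add: shift_seq_def)
  qed
  have "\<bar>bump_sum (\<lambda>n. shift_seq f n - shift_seq f (Suc n)) x
      - bump_sum (\<lambda>n. shift_seq g n - shift_seq g (Suc n)) x\<bar> \<le> 4 * ?D"
    unfolding bump_sum_diff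
  proof (rule abs_bump_sum_le)
    show "\<bar>shift_seq f n - shift_seq f (Suc n) - (shift_seq g n - shift_seq g (Suc n))\<bar> \<le> 4 * ?D" for n
      using s[of n] s[of "Suc n"] by linarith
  qed simp
  then show "\<bar>absorb f x - absorb g x\<bar> \<le> 6 * ?D"
    using mdist_C01_upper[OF f g x] scaled[OF x] x by (simp add: absorb_def)
qed

lemma mdist_release_le:
  assumes f: "f \<in> mspace C01" and g: "g \<in> mspace C01"
  shows "mdist C01 (release f) (release g) \<le> 6 * mdist C01 f g"
  unfolding mdist_C01_le_iff[OF release_C01[OF f] release_C01[OF g]]
proof
  fix x :: real assume x: "x \<in> {0..1}"
  let ?D = "mdist C01 f g"
  note pt = mdist_C01_upper[OF f g bump_pt_in]
  have "\<bar>f (bump_pt 0) * (1 - x) - g (bump_pt 0) * (1 - x)\<bar> = \<bar>f (bump_pt 0) - g (bump_pt 0)\<bar> * \<bar>1 - x\<bar>"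
    by (simp add: left_diff_distrib[symmetric] abs_mult)
  also have "\<dots> \<le> ?D * 1"
    using x pt[of 0] by (intro mult_mono) auto
  finally have 1: "\<bar>f (bump_pt 0) * (1 - x) - g (bump_pt 0) * (1 - x)\<bar> \<le> ?D" by simp
  have "\<bar>bump_sum (\<lambda>n. f (bump_pt n) - f (bump_pt (Suc n))) x
      - bump_sum (\<lambda>n. g (bump_pt n) - g (bump_pt (Suc n))) x\<bar> \<le> 2 * ?D"
    unfolding bump_sum_diff
  proof (rule abs_bump_sum_le)
    show "\<bar>f (bump_pt n) - f (bump_pt (Suc n)) - (g (bump_pt n) - g (bump_pt (Suc n)))\<bar> \<le> 2 * ?D" for n
      using pt[of n] pt[of "Suc n"] by linarith
  qed simp
  moreover have "0 \<le> ?D" by simp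
  ultimately show "\<bar>release f x - release g x\<bar> \<le> 6 * ?D"
    using mdist_C01_upper[OF f g x] 1 x unfolding release_def by simp
qed

lemma C01_subset_metric: "S \<subseteq> mspace C01 \<Longrightarrow> Metric_space S (mdist C01)"
  using Metric_space.subspace[OF Metric_space_mspace_mdist] .

text \<open>The set \<open>Z\<close> carries along a condition at the other endpoint: \<open>Z = UNIV\<close> compares \<open>C[0,1]\<close> with the
  functions vanishing at 0, and \<open>Z = {0}\<close> the functions vanishing at 1 with those vanishing at both
  ends.\<close>

lemma quasi_isometric_vanishing_at_0:
  "quasi_isometric {f \<in> mspace C01. f 1 \<in> Z} (mdist C01) {f \<in> mspace C01. f 0 = 0 \<and> f 1 \<in> Z} (mdist C01)"
  (is "quasi_isometric ?X _ ?Y _")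
proof (rule quasi_isometricI_onto[where L = 6 and C = 0 and \<phi> = absorb])
  show "Metric_space ?Y (mdist C01)" by (intro C01_subset_metric) auto
  show "absorb ` ?X = ?Y"
  proof
    show "absorb ` ?X \<subseteq> ?Y" using absorb_C01 by (auto simp: absorb_0 absorb_1)
    show "?Y \<subseteq> absorb ` ?X"
    proof
      fix g assume g: "g \<in> ?Y"
      then have "g = absorb (release g)" by (simp add: absorb_release mspace_C01)
      moreover have "release g \<in> ?X" using g release_C01 by (auto simp: release_1)
      ultimately show "g \<in> absorb ` ?X" by (rule image_eqI)
    qed
  qed
  fix f g assume fg: "f \<in> ?X" "g \<in> ?X"
  show "mdist C01 (absorb f) (absorb g) \<le> 6 * mdist C01 f g + 0"
    using fg mdist_absorb_le by auto
  show "mdist C01 f g \<le> 6 * mdist C01 (absorb f) (absorb g) + 0"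
    using fg mdist_release_le[of "absorb f" "absorb g"] by (simp add: absorb_C01 release_absorb mspace_C01[of f] mspace_C01[of g])
qed auto

lemma quasi_isometric_reflect:
  "quasi_isometric {f \<in> mspace C01. f 0 = 0} (mdist C01) {f \<in> mspace C01. f 1 = 0} (mdist C01)"
  (is "quasi_isometric ?X _ ?Y _")
proof -
  let ?R = "\<lambda>f::real \<Rightarrow> real. \<lambda>x\<in>{0..1}. f (1 - x)"
  have R: "?R f \<in> mspace C01" if "f \<in> mspace C01" for f
  proof (rule restrict_C01)
    have "continuous_on ((\<lambda>x. 1 - x) ` {0..1}) f"
      using that by (auto simp: mspace_C01 intro: continuous_on_subset)
    then show "continuous_on {0..1} (\<lambda>x. f (1 - x))"
      by (rule continuous_on_compose2) (auto intro!: continuous_intros)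
  qed
  have RR: "?R (?R f) = f" if "f \<in> mspace C01" for f
    using that by (auto simp: mspace_C01 fun_eq_iff extensional_def)
  have dR: "mdist C01 (?R f) (?R g) \<le> mdist C01 f g" if "f \<in> mspace C01" "g \<in> mspace C01" for f g
    unfolding mdist_C01_le_iff[OF R R, OF that] using mdist_C01_upper[OF that] by auto
  show ?thesis
  proof (rule quasi_isometricI_onto[where L = 1 and C = 0 and \<phi> = ?R])
    show "Metric_space ?Y (mdist C01)" by (intro C01_subset_metric) auto
    show "?R ` ?X = ?Y"
    proof
      show "?R ` ?X \<subseteq> ?Y" using R by auto
      show "?Y \<subseteq> ?R ` ?X"
      proof
        fix g assume g: "g \<in> ?Y"
        then have "g = ?R (?R g)" by (simp only: RR mem_Collect_eq)
        moreover have "?R g \<in> ?X" using g R by auto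
        ultimately show "g \<in> ?R ` ?X" by (rule image_eqI)
      qed
    qed
    fix f g assume fg: "f \<in> ?X" "g \<in> ?X"
    show "mdist C01 (?R f) (?R g) \<le> 1 * mdist C01 f g + 0"
      using fg dR by auto
    show "mdist C01 f g \<le> 1 * mdist C01 (?R f) (?R g) + 0"
      using fg dR[OF R R, of f g] RR[of f] RR[of g] by simp
  qed auto
qed

lemma quasi_isometric_vanishing_0_C01:
  "quasi_isometric {f \<in> mspace C01. f 0 = 0} (mdist C01) (mspace C01) (mdist C01)"
  using quasi_isometric_sym[OF _ quasi_isometric_vanishing_at_0[of UNIV]]
    C01_subset_metric[of "{f \<in> mspace C01. f 0 = 0}"] by auto

text \<open>Drop the condition at 0, reflect the interval to turn the condition at 1 into one at 0, and drop
  that too.\<close>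

lemma quasi_isometric_vanishing_01_C01:
  "quasi_isometric {f \<in> mspace C01. f 0 = 0 \<and> f 1 = 0} (mdist C01) (mspace C01) (mdist C01)"
proof -
  let ?left = "{f \<in> mspace C01. f 0 = 0}" and ?right = "{f \<in> mspace C01. f 1 = 0}"
    and ?both = "{f \<in> mspace C01. f 0 = 0 \<and> f 1 = 0}"
  have m: "Metric_space ?left (mdist C01)" "Metric_space ?right (mdist C01)" "Metric_space ?both (mdist C01)"
    by (intro C01_subset_metric; auto)+
  have "quasi_isometric ?both (mdist C01) ?right (mdist C01)"
    by (rule quasi_isometric_sym[OF m(3) quasi_isometric_vanishing_at_0[of "{0}", simplified]])
  moreover have "quasi_isometric ?right (mdist C01) ?left (mdist C01)"
    by (rule quasi_isometric_sym[OF m(2) quasi_isometric_reflect])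
  ultimately have "quasi_isometric ?both (mdist C01) ?left (mdist C01)"
    by (rule quasi_isometric_trans) (rule Metric_space.triangle[OF m(1)])
  then show ?thesis
    by (rule quasi_isometric_trans[OF _ quasi_isometric_vanishing_0_C01])
      (rule Metric_space.triangle[OF Metric_space_mspace_mdist])
qed

section \<open>Continuously differentiable maps with positive derivative\<close>

lemma at_within_convex_nontrivial:
  fixes S :: "real set"
  assumes "convex S" "x \<in> S" "y \<in> S" "y \<noteq> x"
  shows "at x within S \<noteq> bot"
proof -
  have "S \<noteq> {z}" for z using assms(2-4) by blast
  then have "x islimpt S" using connected_imp_perfect[OF convex_connected[OF assms(1)] assms(2)] by blast
  then show ?thesis by (simp add: trivial_limit_within)
qed

lemma vector_derivative_within_convex:
  fixes S :: "real set" and f :: "real \<Rightarrow> real"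
  assumes "convex S" "x \<in> S" "y \<in> S" "y \<noteq> x" "(f has_real_derivative D) (at x within S)"
  shows "vector_derivative f (at x within S) = D"
  using vector_derivative_within[OF at_within_convex_nontrivial[OF assms(1-4)]] assms(5)
  by (simp add: has_real_derivative_iff_has_vector_derivative)

lemma C1_on_iff:
  assumes "convex S" "a \<in> S" "b \<in> S" "a \<noteq> b"
  shows "C1_on S f \<longleftrightarrow> (\<exists>p. continuous_on S p \<and> (\<forall>x\<in>S. (f has_real_derivative p x) (at x within S)))"
proof
  assume "C1_on S f"
  then have "continuous_on S (\<lambda>x. vector_derivative f (at x within S))"
    "\<forall>x\<in>S. (f has_real_derivative vector_derivative f (at x within S)) (at x within S)"
    unfolding C1_on_def differentiable_on_def has_real_derivative_iff_has_vector_derivative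
      vector_derivative_works[symmetric] by blast+
  then show "\<exists>p. continuous_on S p \<and> (\<forall>x\<in>S. (f has_real_derivative p x) (at x within S))"
    by blast
next
  assume "\<exists>p. continuous_on S p \<and> (\<forall>x\<in>S. (f has_real_derivative p x) (at x within S))"
  then obtain p where p: "continuous_on S p" "\<And>x. x \<in> S \<Longrightarrow> (f has_real_derivative p x) (at x within S)"
    by blast
  have "vector_derivative f (at x within S) = p x" if x: "x \<in> S" for x
  proof -
    obtain y where y: "y \<in> S" "y \<noteq> x" using assms by (cases "x = a") blast+
    then show ?thesis using vector_derivative_within_convex[OF assms(1) x y p(2)[OF x]] by blast
  qed
  with p(1) have "continuous_on S (\<lambda>x. vector_derivative f (at x within S))"
    by (simp cong: continuous_on_cong)
  moreover have "f differentiable (at x within S)" if "x \<in> S" for x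
    using p(2)[OF that] by (auto simp: differentiable_def has_field_derivative_def)
  ultimately show "C1_on S f"
    unfolding C1_on_def differentiable_on_def by blast
qed

text \<open>Diffeomorphisms of the interval and lifts of circle diffeomorphisms are treated together, with
  \<open>S = {0..1}\<close> and \<open>S = UNIV\<close>. The derivative is an explicit parameter because the chain rule and
  the inverse function rule produce it in closed form.\<close>

definition pos_C1 :: "real set \<Rightarrow> (real \<Rightarrow> real) \<Rightarrow> (real \<Rightarrow> real) \<Rightarrow> bool"
  where "pos_C1 S F p \<longleftrightarrow>
    continuous_on S p \<and> (\<forall>x\<in>S. 0 < p x \<and> (F has_real_derivative p x) (at x within S))"

lemma pos_C1_continuous: "pos_C1 S F p \<Longrightarrow> continuous_on S F"
  unfolding pos_C1_def by (meson DERIV_continuous_on)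

lemma pos_C1_strict_mono:
  assumes p: "pos_C1 S F p" and S: "convex S" shows "strict_mono_on S F"
proof (rule strict_mono_onI)
  fix x y assume xy: "x \<in> S" "y \<in> S" "x < y"
  have sub: "{x..y} \<subseteq> S"
    using S xy closed_segment_subset[OF xy(1,2)] by (simp add: closed_segment_eq_real_ivl)
  show "F x < F y"
  proof (rule DERIV_pos_imp_increasing_open[OF xy(3)])
    show "continuous_on {x..y} F" by (rule continuous_on_subset[OF pos_C1_continuous[OF p] sub])
    fix z assume z: "x < z" "z < y"
    then have "z \<in> S" using sub by auto
    then have "0 < p z" "(F has_real_derivative p z) (at z within {x..y})"
      using p DERIV_subset[OF _ sub] unfolding pos_C1_def by blast+
    then show "\<exists>D. (F has_real_derivative D) (at z) \<and> D > 0"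
      unfolding at_within_Icc_at[OF z] by blast
  qed
qed

lemma pos_C1_cong:
  assumes "pos_C1 S F p" "\<And>x. x \<in> S \<Longrightarrow> G x = F x" shows "pos_C1 S G p"
  using assms unfolding pos_C1_def has_field_derivative_def by (auto intro: has_derivative_transform)

lemma pos_C1_deriv_cong:
  assumes "pos_C1 S F p" "\<And>x. x \<in> S \<Longrightarrow> q x = p x" shows "pos_C1 S F q"
proof -
  have "continuous_on S q" using assms unfolding pos_C1_def by (simp cong: continuous_on_cong)
  then show ?thesis using assms unfolding pos_C1_def by simp
qed

lemma pos_C1_compose:
  assumes F: "pos_C1 T F p" and G: "pos_C1 S G q" and "G ` S \<subseteq> T"
  shows "pos_C1 S (F \<circ> G) (\<lambda>x. p (G x) * q x)"
  unfolding pos_C1_def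
proof (intro conjI ballI)
  show "continuous_on S (\<lambda>x. p (G x) * q x)"
    using F G assms(3) pos_C1_continuous[OF G] unfolding pos_C1_def
    by (intro continuous_intros) (auto intro: continuous_on_compose2)
  fix x assume x: "x \<in> S"
  show "0 < p (G x) * q x" using F G assms(3) x unfolding pos_C1_def by auto
  show "(F \<circ> G has_real_derivative p (G x) * q x) (at x within S)"
    using F G assms(3) x unfolding pos_C1_def
    by (intro DERIV_image_chain) (auto intro: DERIV_subset)
qed

lemma pos_C1_inverse:
  assumes F: "pos_C1 S F p" and G: "continuous_on (F ` S) G" and GF: "\<And>x. x \<in> S \<Longrightarrow> G (F x) = x"
  shows "pos_C1 (F ` S) G (\<lambda>y. 1 / p (G y))"
  unfolding pos_C1_def
proof (intro conjI ballI)
  have GS: "G ` (F ` S) \<subseteq> S" using GF by auto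
  have nz: "p (G y) \<noteq> 0" if "y \<in> F ` S" for y using F GS that unfolding pos_C1_def by force
  have "continuous_on S p" using F by (simp add: pos_C1_def)
  then show "continuous_on (F ` S) (\<lambda>y. 1 / p (G y))"
    using nz GS G by (intro continuous_intros) (auto intro: continuous_on_compose2)
  fix y assume "y \<in> F ` S"
  then obtain x where x: "x \<in> S" "y = F x" by blast
  have px: "0 < p x" "(F has_derivative (\<lambda>h. p x * h)) (at x within S)"
    using F x by (auto simp: pos_C1_def has_field_derivative_def)
  show "0 < 1 / p (G y)" using px x GF by simp
  have "(G has_derivative (\<lambda>h. 1 / p x * h)) (at (F x) within F ` S)"
  proof (rule has_derivative_inverse_within[OF px(2)])
    show "continuous (at (F x) within F ` S) G"
      using G x by (auto simp: continuous_on_eq_continuous_within)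
    show "linear ((*) (1 / p x))" by (simp add: linear_times)
    show "(*) (1 / p x) \<circ> (*) (p x) = id" using px by (auto simp: fun_eq_iff)
  qed (use x GF in auto)
  then show "(G has_real_derivative 1 / p (G y)) (at y within F ` S)"
    unfolding has_field_derivative_def x(2) GF[OF x(1)] .
qed

text \<open>A differentiable left inverse, up to a translation, makes the derivative of \<open>F\<close> nowhere zero by the
  chain rule, and monotonicity excludes negative values. The translation by \<open>c\<close> is needed for lifts:
  a lift of \<open>f\<close> and a lift of its inverse are inverse to each other only up to an integer.\<close>

lemma pos_C1_of_invertible:
  assumes S: "convex S" "a \<in> S" "b \<in> S" "a \<noteq> b" and mono: "strict_mono_on S F"
    and p: "continuous_on S p" "\<And>x. x \<in> S \<Longrightarrow> (F has_real_derivative p x) (at x within S)"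
    and q: "\<And>y. y \<in> T \<Longrightarrow> (G has_real_derivative q y) (at y within T)"
    and FT: "F ` S \<subseteq> T" and GF: "\<And>x. x \<in> S \<Longrightarrow> G (F x) = x + c"
  shows "pos_C1 S F p"
  unfolding pos_C1_def
proof (intro conjI ballI p)
  fix x assume x: "x \<in> S"
  have "(G \<circ> F has_real_derivative q (F x) * p x) (at x within S)"
    using p(2)[OF x] q FT x by (intro DERIV_image_chain) (auto intro: DERIV_subset)
  moreover have "(G \<circ> F has_real_derivative 1) (at x within S)"
    unfolding has_field_derivative_def
    by (rule has_derivative_transform[OF x, of _ "\<lambda>x. x + c"])
      (auto simp: GF has_field_derivative_def[symmetric] intro!: derivative_eq_intros)
  moreover obtain y where y: "y \<in> S" "y \<noteq> x" using S by metis
  \<comment> \<open>A second point of \<open>S\<close> makes derivatives within \<open>S\<close> unique at \<open>x\<close>.\<close>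
  ultimately have "q (F x) * p x = 1"
    using vector_derivative_within_convex[OF S(1) x y] by metis
  then have nz: "p x \<noteq> 0" by auto
  show "0 < p x"
  proof (rule ccontr)
    assume "\<not> 0 < p x"
    then have neg: "p x < 0" using nz by linarith
    have seg: "x + h \<in> S" if "0 < h" "h < y - x" for h
      using mem_is_interval_1_I[of S x y "x + h"] S(1) x y that by (auto simp: is_interval_convex_1)
    have seg': "x - h \<in> S" if "0 < h" "h < x - y" for h
      using mem_is_interval_1_I[of S y x "x - h"] S(1) x y that by (auto simp: is_interval_convex_1)
    show False
    proof (cases "x < y")
      case True
      obtain d where d: "d > 0" "\<And>h. 0 < h \<Longrightarrow> x + h \<in> S \<Longrightarrow> h < d \<Longrightarrow> F x > F (x + h)"
        using has_real_derivative_neg_dec_right[OF p(2)[OF x] neg] by blast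
      define h where "h = min (d / 2) ((y - x) / 2)"
      have h: "0 < h" "h < d" "h < y - x" using d True by (auto simp: h_def min_def)
      show False using d(2)[OF h(1) seg h(2)] strict_mono_onD[OF mono x seg[OF h(1,3)]] h by auto
    next
      case False
      then have less: "y < x" using y by simp
      obtain d where d: "d > 0" "\<And>h. 0 < h \<Longrightarrow> x - h \<in> S \<Longrightarrow> h < d \<Longrightarrow> F x < F (x - h)"
        using has_real_derivative_neg_dec_left[OF p(2)[OF x] neg] by blast
      define h where "h = min (d / 2) ((x - y) / 2)"
      have h: "0 < h" "h < d" "h < x - y" using d less by (auto simp: h_def min_def)
      show False using d(2)[OF h(1) seg' h(2)] strict_mono_onD[OF mono seg'[OF h(1,3)] x] h by auto
    qed
  qed
qed

text \<open>With \<open>c = 0\<close> this says that the derivative determines the map; in general it lets the uniform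
  distance of maps be controlled by that of their derivatives.\<close>

lemma C1_diff_bound:
  assumes F: "pos_C1 {0..1} F p" and G: "pos_C1 {0..1} G q" and 0: "F 0 = G 0"
    and c: "\<And>x. x \<in> {0..1} \<Longrightarrow> \<bar>p x - q x\<bar> \<le> c" and x: "x \<in> {0..1}"
  shows "\<bar>F x - G x\<bar> \<le> c"
proof -
  have "norm ((\<lambda>x. F x - G x) x - (\<lambda>x. F x - G x) 0) \<le> c * norm (x - 0)"
  proof (rule field_differentiable_bound[of "{0..1}" _ "\<lambda>x. p x - q x"])
    show "((\<lambda>x. F x - G x) has_real_derivative p z - q z) (at z within {0..1})" if "z \<in> {0..1}" for z
      using F G that unfolding pos_C1_def by (intro derivative_intros) auto
  qed (use c x in auto)
  also have "\<dots> \<le> c * 1" using c[OF x] x by (intro mult_left_mono) auto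
  finally show ?thesis using 0 by simp
qed

text \<open>The range of \<open>u\<close> is compact, so some closed neighbourhood of it is compact and still contained in
  \<open>U\<close>, and \<open>\<theta>\<close> is uniformly continuous there.\<close>

lemma compose_uniformly_near:
  fixes u :: "real \<Rightarrow> real" and \<theta> :: "real \<Rightarrow> real"
  assumes u: "continuous_on {0..1} u" "u ` {0..1} \<subseteq> U" and U: "open U" "continuous_on U \<theta>" and e: "\<epsilon> > 0"
  shows "\<exists>\<delta>>0. \<forall>v. (\<forall>x\<in>{0..1}. \<bar>u x - v x\<bar> < \<delta>) \<longrightarrow> (\<forall>x\<in>{0..1}. \<bar>\<theta> (u x) - \<theta> (v x)\<bar> < \<epsilon>)"
proof -
  let ?K = "u ` {0..1}"
  have K: "compact ?K" using u(1) by (intro compact_continuous_image) auto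
  obtain r where r: "r > 0" "(\<Union>y\<in>?K. cball y r) \<subseteq> U"
    using compact_subset_open_imp_cball_epsilon_subset[OF K U(1) u(2)] by blast
  let ?N = "{a + b |a b. a \<in> ?K \<and> b \<in> cball 0 r}"
  have N: "compact ?N" by (intro compact_sums K compact_cball)
  have NU: "?N \<subseteq> U" using r(2) by (force simp: dist_norm)
  have "uniformly_continuous_on ?N \<theta>"
    using continuous_on_subset[OF U(2) NU] N by (rule compact_uniformly_continuous)
  then obtain d where d: "d > 0" "\<And>y z. y \<in> ?N \<Longrightarrow> z \<in> ?N \<Longrightarrow> dist z y < d \<Longrightarrow> dist (\<theta> z) (\<theta> y) < \<epsilon>"
    using e unfolding uniformly_continuous_on_def by (meson that)
  show ?thesis
  proof (intro exI[of _ "min d r"] conjI allI impI ballI)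
    show "0 < min d r" using d r by simp
    fix v x assume v: "\<forall>x\<in>{0..1}. \<bar>u x - v x\<bar> < min d r" and x: "x \<in> {0..(1::real)}"
    have "u x = u x + 0" "v x = u x + (v x - u x)" by auto
    moreover have "0 \<in> cball (0::real) r" "v x - u x \<in> cball 0 r"
      using r v x by (auto simp: dist_real_def abs_minus_commute less_imp_le)
    ultimately have "u x \<in> ?N" "v x \<in> ?N" using x by blast+
    then show "\<bar>\<theta> (u x) - \<theta> (v x)\<bar> < \<epsilon>"
      using d(2)[of "v x" "u x"] v x by (auto simp: dist_real_def)
  qed
qed

definition exp_integral :: "(real \<Rightarrow> real) \<Rightarrow> real"
  where "exp_integral h = integral {0..1} (\<lambda>t. exp (h t))"

text \<open>The map of the interval onto itself whose derivative is proportional to \<open>exp \<circ> h\<close>.\<close>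

definition exp_primitive :: "(real \<Rightarrow> real) \<Rightarrow> real \<Rightarrow> real"
  where "exp_primitive h = (\<lambda>x\<in>{0..1}. integral {0..x} (\<lambda>t. exp (h t)) / exp_integral h)"

lemma exp_integral_pos:
  assumes "continuous_on {0..1} h" shows "exp_integral h > 0"
proof -
  have "pos_C1 {0..1} (\<lambda>x. integral {0..x} (\<lambda>t. exp (h t))) (\<lambda>t. exp (h t))"
    using assms unfolding pos_C1_def by (auto intro!: continuous_intros integral_has_real_derivative)
  from strict_mono_onD[OF pos_C1_strict_mono[OF this], of 0 1] show ?thesis
    by (simp add: exp_integral_def)
qed

lemma pos_C1_exp_primitive:
  assumes h: "continuous_on {0..1} h"
  shows "pos_C1 {0..1} (exp_primitive h) (\<lambda>x. exp (h x - ln (exp_integral h)))"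
proof (rule pos_C1_cong)
  let ?F = "\<lambda>x. integral {0..x} (\<lambda>t. exp (h t)) / exp_integral h"
  note pos = exp_integral_pos[OF h]
  show "pos_C1 {0..1} ?F (\<lambda>x. exp (h x - ln (exp_integral h)))"
    unfolding pos_C1_def
  proof (intro conjI ballI)
    fix x :: real assume x: "x \<in> {0..1}"
    have "(?F has_real_derivative exp (h x) / exp_integral h) (at x within {0..1})"
      using h x by (intro DERIV_cdivide integral_has_real_derivative continuous_intros)
    then show "(?F has_real_derivative exp (h x - ln (exp_integral h))) (at x within {0..1})"
      using pos by (simp add: exp_diff)
  qed (use h in \<open>auto intro!: continuous_intros\<close>)
qed (simp add: exp_primitive_def)

lemma exp_primitive_0: "exp_primitive h 0 = 0" by (simp add: exp_primitive_def)

lemma exp_primitive_1: "continuous_on {0..1} h \<Longrightarrow> exp_primitive h 1 = 1"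
  using exp_integral_pos[of h] by (simp add: exp_primitive_def exp_integral_def)

text \<open>If \<open>h \<le> c + k\<close>, then \<open>exp h \<le> exp c * exp k\<close>, and the same holds for the integrals. So the
  normalising constant is a 1-Lipschitz function of \<open>h\<close>.\<close>

lemma ln_exp_integral_lipschitz:
  assumes h: "continuous_on {0..1} h" and k: "continuous_on {0..1} k"
    and c: "\<And>x. x \<in> {0..1} \<Longrightarrow> \<bar>h x - k x\<bar> \<le> c"
  shows "\<bar>ln (exp_integral h) - ln (exp_integral k)\<bar> \<le> c"
proof -
  have le: "ln (exp_integral f) \<le> c + ln (exp_integral g)"
    if f: "continuous_on {0..1} f" and g: "continuous_on {0..1} g"
      and fg: "\<And>x. x \<in> {0..1} \<Longrightarrow> f x \<le> c + g x" for f g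
  proof -
    have "exp_integral f \<le> integral {0..1} (\<lambda>t. exp c * exp (g t))"
      unfolding exp_integral_def
      by (intro integral_le integrable_continuous_interval continuous_intros f g)
        (use fg in \<open>auto simp: exp_add[symmetric]\<close>)
    then have "exp_integral f \<le> exp c * exp_integral g" by (simp add: exp_integral_def)
    then have "ln (exp_integral f) \<le> ln (exp c * exp_integral g)"
      using exp_integral_pos[OF f] exp_integral_pos[OF g] by simp
    then show ?thesis using exp_integral_pos[OF g] by (simp add: ln_mult)
  qed
  have "h x \<le> c + k x" "k x \<le> c + h x" if "x \<in> {0..1}" for x using c[OF that] by auto
  then show ?thesis using le[OF h k] le[OF k h] by (simp add: abs_le_iff)
qed

lemma exp_integral_log_derivative:
  assumes F: "pos_C1 {0..1} F (\<lambda>x. exp (h x))" and "F 0 = 0" "F 1 = 1"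
  shows "exp_integral h = 1"
proof -
  have "((\<lambda>x. exp (h x)) has_integral F 1 - F 0) {0..1}"
    using F unfolding pos_C1_def
    by (intro fundamental_theorem_of_calculus) (auto simp: has_real_derivative_iff_has_vector_derivative)
  then show ?thesis using assms(2,3) by (simp add: exp_integral_def integral_unique)
qed

lemma exp_integral_shift:
  assumes "continuous_on {0..1} h"
  shows "exp_integral (\<lambda>x. h x - c) = exp (- c) * exp_integral h"
  unfolding exp_integral_def by (simp add: exp_diff exp_minus divide_inverse mult.commute)

lemma exp_primitive_bounds:
  assumes h: "continuous_on {0..1} h" and x: "x \<in> {0..1}"
  shows "0 \<le> exp_primitive h x" "exp_primitive h x \<le> 1"
proof -
  have m: "strict_mono_on {0..1} (exp_primitive h)" by (rule pos_C1_strict_mono[OF pos_C1_exp_primitive[OF h]]) simp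
  show "0 \<le> exp_primitive h x" "exp_primitive h x \<le> 1"
    using strict_mono_on_leD[OF m, of 0 x] strict_mono_on_leD[OF m, of x 1] x exp_primitive_0 exp_primitive_1[OF h] by auto
qed

text \<open>The map depends on \<open>h\<close> in a Lipschitz way, with a constant that is the same for all \<open>h\<close> and \<open>k\<close>;
  this fails for its derivative, so integrating a bound on derivatives would not do.
  Numerator and normaliser each change by a factor at most \<open>exp c\<close>, so the two maps have ratio at
  most \<open>exp (2 c)\<close>; they take values in the unit interval, which makes
  \<open>exp (2 c) - 1 \<le> 4 c\<close> a bound for small \<open>c\<close>, while for large \<open>c\<close> the bound 1 is enough.\<close>

lemma exp_primitive_dist:
  assumes h: "continuous_on {0..1} h" and k: "continuous_on {0..1} k"
    and c: "\<And>x. x \<in> {0..1} \<Longrightarrow> \<bar>h x - k x\<bar> \<le> c" and x: "x \<in> {0..1}"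
  shows "\<bar>exp_primitive h x - exp_primitive k x\<bar> \<le> 4 * c"
proof -
  have c0: "0 \<le> c" using c[OF x] by linarith
  have ratio: "exp_primitive f x \<le> exp (2 * c) * exp_primitive g x"
    if f: "continuous_on {0..1} f" and g: "continuous_on {0..1} g"
      and fg: "\<And>x. x \<in> {0..1} \<Longrightarrow> \<bar>f x - g x\<bar> \<le> c" for f g
  proof -
    have sub: "{0..x} \<subseteq> {0..1}" using x by auto
    have "f t \<le> c + g t" if "t \<in> {0..x}" for t using fg[of t] sub that by force
    then have "integral {0..x} (\<lambda>t. exp (f t)) \<le> integral {0..x} (\<lambda>t. exp c * exp (g t))"
      using continuous_on_subset[OF f sub] continuous_on_subset[OF g sub]
      by (intro integral_le integrable_continuous_interval continuous_intros) (auto simp: exp_add[symmetric])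
    then have num: "integral {0..x} (\<lambda>t. exp (f t)) \<le> exp c * integral {0..x} (\<lambda>t. exp (g t))" by simp
    have "ln (exp_integral g) - c \<le> ln (exp_integral f)"
      using ln_exp_integral_lipschitz[OF f g fg] by linarith
    then have "exp (ln (exp_integral g) - c) \<le> exp (ln (exp_integral f))" by simp
    then have den: "exp_integral g / exp c \<le> exp_integral f"
      using exp_integral_pos[OF f] exp_integral_pos[OF g] by (simp add: exp_diff)
    have "integral {0..x} (\<lambda>t. exp (f t)) / exp_integral f
      \<le> (exp c * integral {0..x} (\<lambda>t. exp (g t))) / (exp_integral g / exp c)"
    proof (rule frac_le[OF _ num _ den])
      have "(\<lambda>t. exp (g t)) integrable_on {0..x}"
        by (intro integrable_continuous_interval continuous_intros continuous_on_subset[OF g sub])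
      then show "0 \<le> exp c * integral {0..x} (\<lambda>t. exp (g t))" by (simp add: integral_nonneg)
    qed (use exp_integral_pos[OF g] in simp)
    also have "\<dots> = (exp c * exp c) * (integral {0..x} (\<lambda>t. exp (g t)) / exp_integral g)" by simp
    also have "exp c * exp c = exp (2 * c)" by (simp add: exp_add[symmetric])
    finally show ?thesis using x by (simp add: exp_primitive_def)
  qed
  have kh: "\<bar>k x - h x\<bar> \<le> c" if "x \<in> {0..1}" for x using c[OF that] by simp
  note bnd = exp_primitive_bounds[OF h x] exp_primitive_bounds[OF k x]
  show ?thesis
  proof (cases "2 * c \<le> 1")
    case True
    have "exp (2 * c) \<le> 1 + 2 * c + (2 * c)\<^sup>2" using True c0 by (intro exp_bound) auto
    also have "(2 * c)\<^sup>2 \<le> 2 * c * 1" unfolding power2_eq_square using True c0 by (intro mult_left_mono) auto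
    finally have e: "exp (2 * c) - 1 \<le> 4 * c" by simp
    have "(exp (2 * c) - 1) * y \<le> 4 * c" if "0 \<le> y" "y \<le> 1" for y
    proof -
      have "(exp (2 * c) - 1) * y \<le> (exp (2 * c) - 1) * 1" using that c0 by (intro mult_left_mono) auto
      then show ?thesis using e by simp
    qed
    from this[of "exp_primitive h x"] this[of "exp_primitive k x"]
    show ?thesis using ratio[OF h k c] ratio[OF k h kh] bnd by (simp add: abs_le_iff left_diff_distrib)
  next
    case False
    then show ?thesis using bnd by (simp add: abs_le_iff)
  qed
qed

text \<open>Used with \<open>exp\<close> and \<open>ln\<close> to compare the \<open>C\<^sup>1\<close> metrics with the logarithmic metrics.\<close>

lemma mdist_C01_compose_continuous:
  assumes u: "u \<in> mspace C01" "u ` {0..1} \<subseteq> U" and U: "open U" "continuous_on U \<theta>" and e: "\<epsilon> > 0"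
  shows "\<exists>\<delta>>0. \<forall>v\<in>mspace C01. v ` {0..1} \<subseteq> U \<longrightarrow> mdist C01 u v < \<delta> \<longrightarrow>
    mdist C01 (\<lambda>x\<in>{0..1}. \<theta> (u x)) (\<lambda>x\<in>{0..1}. \<theta> (v x)) < \<epsilon>"
proof -
  have C: "(\<lambda>x\<in>{0..1}. \<theta> (v x)) \<in> mspace C01" if "v \<in> mspace C01" "v ` {0..1} \<subseteq> U" for v
    using that by (intro restrict_C01 continuous_on_compose2[OF U(2)]) (auto simp: mspace_C01)
  obtain \<delta> where d: "\<delta> > 0"
    "\<And>v. \<forall>x\<in>{0..1}. \<bar>u x - v x\<bar> < \<delta> \<Longrightarrow> \<forall>x\<in>{0..1}. \<bar>\<theta> (u x) - \<theta> (v x)\<bar> < \<epsilon> / 2"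
    using compose_uniformly_near[OF _ u(2) U, of "\<epsilon> / 2"] u(1) e unfolding mspace_C01 by (metis half_gt_zero)
  have "mdist C01 (\<lambda>x\<in>{0..1}. \<theta> (u x)) (\<lambda>x\<in>{0..1}. \<theta> (v x)) < \<epsilon>"
    if v: "v \<in> mspace C01" "v ` {0..1} \<subseteq> U" "mdist C01 u v < \<delta>" for v
  proof -
    have "\<forall>x\<in>{0..1}. \<bar>u x - v x\<bar> < \<delta>"
      using mdist_C01_upper[OF u(1) v(1)] v(3) by (meson le_less_trans)
    from d(2)[OF this]
    have "mdist C01 (\<lambda>x\<in>{0..1}. \<theta> (u x)) (\<lambda>x\<in>{0..1}. \<theta> (v x)) \<le> \<epsilon> / 2"
      unfolding mdist_C01_le_iff[OF C[OF u] C[OF v(1,2)]] by (simp add: less_imp_le)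
    then show ?thesis using e by linarith
  qed
  then show ?thesis using d(1) by blast
qed

section \<open>Diffeomorphisms of the interval\<close>

lemma Diff_I_carrier_subset: "carrier Diff_I \<subseteq> Bij {0..1}"
  by (auto simp: Diff_I_def)

lemma inv_into_pos_C1:
  assumes p: "pos_C1 {0..1} f p" and b: "bij_betw f {0..1} {0..1}"
  shows "pos_C1 {0..1} (inv_into {0..1} f) (\<lambda>y. 1 / p (inv_into {0..1} f y))"
proof -
  have im: "f ` {0..1} = {0..1}" and inj: "inj_on f {0..1}" using b by (auto simp: bij_betw_def)
  have "continuous_on (f ` {0..1}) (inv_into {0..1} f)"
    by (rule continuous_on_inv[OF pos_C1_continuous[OF p]]) (auto simp: inv_into_f_f[OF inj])
  from pos_C1_inverse[OF p this] show ?thesis using im inv_into_f_f[OF inj] by simp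
qed

text \<open>The working description of the group. Bijectivity, monotonicity and the smoothness of the inverse
  all amount to positivity of the derivative together with the endpoint values.\<close>

lemma carrier_Diff_I_iff:
  "f \<in> carrier Diff_I \<longleftrightarrow> f \<in> extensional {0..1} \<and> f 0 = 0 \<and> f 1 = 1 \<and> (\<exists>p. pos_C1 {0..1} f p)"
proof
  assume "f \<in> carrier Diff_I"
  then have f: "f \<in> extensional {0..1}" "bij_betw f {0..1} {0..1}" "C1_on {0..1} f"
    "C1_on {0..1} (inv_into {0..1} f)" "strict_mono_on {0..1} f"
    by (auto simp: Diff_I_def Bij_def)
  have im: "f ` {0..1} = {0..1}" and inj: "inj_on f {0..1}" using f(2) by (auto simp: bij_betw_def)
  have ends: "f 0 \<in> {0..1}" "f 1 \<in> {0..1}" using im by auto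
  have "0 \<in> f ` {0..1}" "1 \<in> f ` {0..1}" unfolding im by auto
  then obtain a b where ab: "a \<in> {0..1}" "f a = 0" "b \<in> {0..1}" "f b = 1"
    unfolding image_iff by auto
  have "f 0 \<le> f a" "f b \<le> f 1" using strict_mono_on_leD[OF f(5), of 0 a] strict_mono_on_leD[OF f(5), of b 1] ab by auto
  then have "f 0 = 0" "f 1 = 1" using ends ab by auto
  moreover note C1 = C1_on_iff[of "{0..1}" 0 "1::real", simplified]
  obtain p where p: "continuous_on {0..1} p" "\<And>x. x \<in> {0..1} \<Longrightarrow> (f has_real_derivative p x) (at x within {0..1})"
    using f(3) unfolding C1 by blast
  obtain q where q: "\<And>x. x \<in> {0..1} \<Longrightarrow> (inv_into {0..1} f has_real_derivative q x) (at x within {0..1})"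
    using f(4) unfolding C1 by blast
  have "pos_C1 {0..1} f p"
    by (rule pos_C1_of_invertible[OF _ _ _ _ f(5) p q, of 0 1 0])
      (simp_all add: im inv_into_f_f[OF inj])
  ultimately show "f \<in> extensional {0..1} \<and> f 0 = 0 \<and> f 1 = 1 \<and> (\<exists>p. pos_C1 {0..1} f p)"
    using f(1) by blast
next
  assume "f \<in> extensional {0..1} \<and> f 0 = 0 \<and> f 1 = 1 \<and> (\<exists>p. pos_C1 {0..1} f p)"
  then obtain p where f: "f \<in> extensional {0..1}" "f 0 = 0" "f 1 = 1" and p: "pos_C1 {0..1} f p" by blast
  have mono: "strict_mono_on {0..1} f" by (rule pos_C1_strict_mono[OF p]) simp
  have im: "f ` {0..1} = {0..1}"
  proof
    have "0 \<le> f x \<and> f x \<le> 1" if "x \<in> {0..1}" for x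
      using strict_mono_on_leD[OF mono, of 0 x] strict_mono_on_leD[OF mono, of x 1] f that by auto
    then show "f ` {0..1} \<subseteq> {0..1}" by auto
    show "{0..1} \<subseteq> f ` {0..1}"
    proof
      fix y :: real assume "y \<in> {0..1}"
      then obtain x where "0 \<le> x" "x \<le> 1" "f x = y"
        using IVT'[of f 0 y 1] f pos_C1_continuous[OF p] by auto
      then show "y \<in> f ` {0..1}" by auto
    qed
  qed
  then have b: "bij_betw f {0..1} {0..1}"
    using strict_mono_on_imp_inj_on[OF mono] by (simp add: bij_betw_def)
  note C1 = C1_on_iff[of "{0..1}" 0 "1::real", simplified]
  have "C1_on {0..1} f" "C1_on {0..1} (inv_into {0..1} f)"
    unfolding C1 using p inv_into_pos_C1[OF p b] unfolding pos_C1_def by auto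
  then show "f \<in> carrier Diff_I" using f b mono by (auto simp: Diff_I_def Bij_def)
qed

lemma subgroup_Diff_I: "subgroup (carrier Diff_I) (BijGroup {0..1})"
proof
  show "carrier Diff_I \<subseteq> carrier (BijGroup {0..1})"
    using Diff_I_carrier_subset by (simp add: BijGroup_def)
  have "pos_C1 {0..1} (\<lambda>x. x) (\<lambda>x. 1)" by (auto simp: pos_C1_def intro!: derivative_eq_intros)
  then have "pos_C1 {0..1} (\<lambda>x\<in>{0..1}. x) (\<lambda>x. 1)" by (rule pos_C1_cong) simp
  then show "\<one>\<^bsub>BijGroup {0..1}\<^esub> \<in> carrier Diff_I"
    unfolding carrier_Diff_I_iff by (auto simp: BijGroup_def)
next
  fix f g assume fg: "f \<in> carrier Diff_I" "g \<in> carrier Diff_I"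
  then have B: "f \<in> Bij {0..1}" "g \<in> Bij {0..1}" using Diff_I_carrier_subset by auto
  obtain p q where f: "f 0 = 0" "f 1 = 1" "pos_C1 {0..1} f p" and g: "g 0 = 0" "g 1 = 1" "pos_C1 {0..1} g q"
    using fg unfolding carrier_Diff_I_iff by blast
  have "g ` {0..1} \<subseteq> {0..1}" using Bij_imp_funcset[OF B(2)] by auto
  from pos_C1_cong[OF pos_C1_compose[OF f(3) g(3) this], of "compose {0..1} f g"]
  have "compose {0..1} f g \<in> carrier Diff_I"
    unfolding carrier_Diff_I_iff using f g by (auto simp: compose_def)
  then show "f \<otimes>\<^bsub>BijGroup {0..1}\<^esub> g \<in> carrier Diff_I" using B by (simp add: BijGroup_def)
next
  fix f assume f: "f \<in> carrier Diff_I"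
  then have B: "f \<in> Bij {0..1}" using Diff_I_carrier_subset by auto
  then have b: "bij_betw f {0..1} {0..1}" and inj: "inj_on f {0..1}" by (auto simp: Bij_def bij_betw_def)
  obtain p where p: "f 0 = 0" "f 1 = 1" "pos_C1 {0..1} f p" using f unfolding carrier_Diff_I_iff by blast
  have "inv_into {0..1} f 0 = 0" "inv_into {0..1} f 1 = 1"
    using inv_into_f_f[OF inj, of 0] inv_into_f_f[OF inj, of 1] p by auto
  moreover have "pos_C1 {0..1} (restrict (inv_into {0..1} f) {0..1}) (\<lambda>y. 1 / p (inv_into {0..1} f y))"
    by (rule pos_C1_cong[OF inv_into_pos_C1[OF p(3) b]]) simp
  ultimately have "restrict (inv_into {0..1} f) {0..1} \<in> carrier Diff_I"
    unfolding carrier_Diff_I_iff by (auto simp: restrict_extensional)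
  then show "inv\<^bsub>BijGroup {0..1}\<^esub> f \<in> carrier Diff_I" using inv_BijGroup[OF B] by simp
qed

lemma group_Diff_I: "group Diff_I"
proof -
  have "Diff_I = BijGroup {0..1} \<lparr>carrier := carrier Diff_I\<rparr>" by (simp add: Diff_I_def)
  then show ?thesis using subgroup.subgroup_is_group[OF subgroup_Diff_I group_BijGroup] by simp
qed

lemma mult_Diff_I:
  assumes "f \<in> carrier Diff_I" "g \<in> carrier Diff_I"
  shows "f \<otimes>\<^bsub>Diff_I\<^esub> g = compose {0..1} f g"
  using assms Diff_I_carrier_subset by (simp add: Diff_I_def BijGroup_def subset_iff)

lemma one_Diff_I: "\<one>\<^bsub>Diff_I\<^esub> = (\<lambda>x\<in>{0..1}. x)"
  by (simp add: Diff_I_def BijGroup_def)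

definition deriv_I :: "(real \<Rightarrow> real) \<Rightarrow> real \<Rightarrow> real"
  where "deriv_I f = (\<lambda>x\<in>{0..1}. vector_derivative f (at x within {0..1}))"

definition log_deriv_I :: "(real \<Rightarrow> real) \<Rightarrow> real \<Rightarrow> real"
  where "log_deriv_I f = (\<lambda>x\<in>{0..1}. ln (deriv_I f x))"

lemma deriv_I_eq:
  assumes "pos_C1 {0..1} f p" "x \<in> {0..1}" shows "deriv_I f x = p x"
proof -
  obtain y :: real where "y \<in> {0..1}" "y \<noteq> x" by (metis atLeastAtMost_iff order_refl zero_le_one zero_neq_one)
  then show ?thesis
    using assms vector_derivative_within_convex[of "{0..1}" x y f "p x"]
    by (simp add: deriv_I_def pos_C1_def)
qed

lemma pos_C1_deriv_I:
  assumes "f \<in> carrier Diff_I" shows "pos_C1 {0..1} f (deriv_I f)"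
proof -
  obtain p where p: "pos_C1 {0..1} f p" using assms carrier_Diff_I_iff by blast
  then show ?thesis using pos_C1_deriv_cong deriv_I_eq[OF p] by blast
qed

lemma deriv_I_pos: "f \<in> carrier Diff_I \<Longrightarrow> x \<in> {0..1} \<Longrightarrow> deriv_I f x > 0"
  using pos_C1_deriv_I by (simp add: pos_C1_def)

lemma deriv_I_C01: "f \<in> carrier Diff_I \<Longrightarrow> deriv_I f \<in> mspace C01"
  using pos_C1_deriv_I[of f] by (simp add: pos_C1_def mspace_C01 deriv_I_def)

lemma Diff_I_C01: "f \<in> carrier Diff_I \<Longrightarrow> f \<in> mspace C01"
  using pos_C1_continuous carrier_Diff_I_iff mspace_C01 by blast

lemma log_deriv_I_C01:
  assumes f: "f \<in> carrier Diff_I" shows "log_deriv_I f \<in> mspace C01"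
proof -
  have "deriv_I f x \<noteq> 0" if "x \<in> {0..1}" for x using deriv_I_pos[OF f that] by simp
  then show ?thesis
    unfolding log_deriv_I_def using deriv_I_C01[OF f]
    by (intro restrict_C01 continuous_intros) (auto simp: mspace_C01)
qed

lemma exp_log_deriv_I: "f \<in> carrier Diff_I \<Longrightarrow> x \<in> {0..1} \<Longrightarrow> exp (log_deriv_I f x) = deriv_I f x"
  using deriv_I_pos by (simp add: log_deriv_I_def)

lemma Diff_I_eqI:
  assumes f: "f \<in> carrier Diff_I" and g: "g \<in> carrier Diff_I"
    and eq: "\<And>x. x \<in> {0..1} \<Longrightarrow> log_deriv_I f x = log_deriv_I g x"
  shows "f = g"
proof
  fix x show "f x = g x"
  proof (cases "x \<in> {0..1}")
    case True
    have "\<bar>deriv_I f y - deriv_I g y\<bar> \<le> 0" if y: "y \<in> {0..1}" for y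
      using exp_log_deriv_I[OF f y] exp_log_deriv_I[OF g y] eq[OF y] by simp
    moreover have "f 0 = g 0" using f g unfolding carrier_Diff_I_iff by simp
    ultimately have "\<bar>f x - g x\<bar> \<le> 0"
      using True by (intro C1_diff_bound[OF pos_C1_deriv_I[OF f] pos_C1_deriv_I[OF g]])
    then show ?thesis by simp
  qed (use f g in \<open>auto simp: carrier_Diff_I_iff extensional_def\<close>)
qed

text \<open>As for the metric \<open>rho_I\<close>, the value 0 off the carrier serves the locale of metric spaces.\<close>

definition log_dist_I :: "(real \<Rightarrow> real) \<Rightarrow> (real \<Rightarrow> real) \<Rightarrow> real"
  where "log_dist_I f g = (if f \<in> carrier Diff_I \<and> g \<in> carrier Diff_I
    then mdist C01 (log_deriv_I f) (log_deriv_I g) else 0)"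

lemma rho_I_eq:
  assumes "f \<in> carrier Diff_I" "g \<in> carrier Diff_I"
  shows "rho_I f g = mdist C01 f g + mdist C01 (deriv_I f) (deriv_I g)"
  using assms unfolding rho_I_def mdist_C01_eq_SUP[OF Diff_I_C01[OF assms(1)] Diff_I_C01[OF assms(2)]]
    mdist_C01_eq_SUP[OF deriv_I_C01[OF assms(1)] deriv_I_C01[OF assms(2)]]
  by (simp add: deriv_I_def)

lemma Metric_space_rho_I: "Metric_space (carrier Diff_I) rho_I"
proof
  have off: "rho_I f g = 0" if "\<not> (f \<in> carrier Diff_I \<and> g \<in> carrier Diff_I)" for f g
    unfolding rho_I_def using that by (rule if_not_P)
  show "0 \<le> rho_I f g" for f g
    using off[of f g] rho_I_eq[of f g] by (cases "f \<in> carrier Diff_I \<and> g \<in> carrier Diff_I") auto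
  show "rho_I f g = rho_I g f" for f g
    using off[of f g] off[of g f] rho_I_eq[of f g] rho_I_eq[of g f]
    by (cases "f \<in> carrier Diff_I \<and> g \<in> carrier Diff_I") (auto simp: mdist_commute)
  fix f g h assume f: "f \<in> carrier Diff_I" and g: "g \<in> carrier Diff_I"
  show "rho_I f g = 0 \<longleftrightarrow> f = g"
    using f g by (auto simp: rho_I_eq Diff_I_C01 deriv_I_C01 add_nonneg_eq_0_iff)
  assume h: "h \<in> carrier Diff_I"
  show "rho_I f h \<le> rho_I f g + rho_I g h"
    using mdist_triangle[OF Diff_I_C01[OF f] Diff_I_C01[OF g] Diff_I_C01[OF h]]
      mdist_triangle[OF deriv_I_C01[OF f] deriv_I_C01[OF g] deriv_I_C01[OF h]] f g h
    by (simp add: rho_I_eq)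
qed

lemma Metric_space_log_dist_I: "Metric_space (carrier Diff_I) log_dist_I"
proof
  show "0 \<le> log_dist_I f g" for f g by (simp add: log_dist_I_def)
  show "log_dist_I f g = log_dist_I g f" for f g by (simp add: log_dist_I_def mdist_commute)
  fix f g h assume f: "f \<in> carrier Diff_I" and g: "g \<in> carrier Diff_I"
  show "log_dist_I f g = 0 \<longleftrightarrow> f = g"
    using f g Diff_I_eqI[OF f g] by (auto simp: log_dist_I_def log_deriv_I_C01)
  assume h: "h \<in> carrier Diff_I"
  show "log_dist_I f h \<le> log_dist_I f g + log_dist_I g h"
    using mdist_triangle[OF log_deriv_I_C01[OF f] log_deriv_I_C01[OF g] log_deriv_I_C01[OF h]] f g h
    by (simp add: log_dist_I_def)
qed

text \<open>Being close in \<open>log f'\<close> implies being close in \<open>f'\<close>, hence also in \<open>f\<close> by integration from the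
  common value at 0; conversely \<open>f'\<close> is bounded away from 0, where \<open>ln\<close> is uniformly continuous.\<close>

lemma mtopology_log_dist_I: "Metric_space.mtopology (carrier Diff_I) log_dist_I = Diff_I_topology"
  unfolding Diff_I_topology_def
proof (rule mtopology_eqI[OF Metric_space_log_dist_I Metric_space_rho_I])
  fix f and \<epsilon> :: real assume f: "f \<in> carrier Diff_I" and e: "\<epsilon> > 0"
  obtain \<delta> where d: "\<delta> > 0" "\<And>k. k \<in> mspace C01 \<Longrightarrow> mdist C01 (log_deriv_I f) k < \<delta> \<Longrightarrow>
      mdist C01 (\<lambda>x\<in>{0..1}. exp (log_deriv_I f x)) (\<lambda>x\<in>{0..1}. exp (k x)) < \<epsilon> / 2"
    using mdist_C01_compose_continuous[OF log_deriv_I_C01[OF f] subset_UNIV open_UNIV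
      continuous_on_exp[OF continuous_on_id], of "\<epsilon> / 2"] e by auto
  have ex: "(\<lambda>x\<in>{0..1}. exp (log_deriv_I g x)) = deriv_I g" if "g \<in> carrier Diff_I" for g
    using exp_log_deriv_I[OF that] by (auto simp: fun_eq_iff deriv_I_def)
  have "rho_I f g < \<epsilon>" if g: "g \<in> carrier Diff_I" "log_dist_I f g < \<delta>" for g
  proof -
    have 1: "mdist C01 (deriv_I f) (deriv_I g) < \<epsilon> / 2"
      using d(2)[OF log_deriv_I_C01[OF g(1)]] g f by (simp add: log_dist_I_def ex)
    have "mdist C01 f g \<le> mdist C01 (deriv_I f) (deriv_I g)"
      unfolding mdist_C01_le_iff[OF Diff_I_C01[OF f] Diff_I_C01[OF g(1)]]
    proof
      fix x :: real assume x: "x \<in> {0..1}"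
      have "f 0 = g 0" using f g(1) unfolding carrier_Diff_I_iff by simp
      then show "\<bar>f x - g x\<bar> \<le> mdist C01 (deriv_I f) (deriv_I g)"
        using mdist_C01_upper[OF deriv_I_C01[OF f] deriv_I_C01[OF g(1)]] x
        by (intro C1_diff_bound[OF pos_C1_deriv_I[OF f] pos_C1_deriv_I[OF g(1)]])
    qed
    with 1 show ?thesis using f g by (simp add: rho_I_eq)
  qed
  then show "\<exists>\<delta>>0. \<forall>g\<in>carrier Diff_I. log_dist_I f g < \<delta> \<longrightarrow> rho_I f g < \<epsilon>" using d(1) by blast
next
  fix f and \<epsilon> :: real assume f: "f \<in> carrier Diff_I" and e: "\<epsilon> > 0"
  have ln: "continuous_on {0<..} (ln :: real \<Rightarrow> real)" by (intro continuous_intros) auto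
  obtain \<delta> where d: "\<delta> > 0" "\<And>q. q \<in> mspace C01 \<Longrightarrow> \<forall>x\<in>{0..1}. q x > 0 \<Longrightarrow> mdist C01 (deriv_I f) q < \<delta> \<Longrightarrow>
      mdist C01 (\<lambda>x\<in>{0..1}. ln (deriv_I f x)) (\<lambda>x\<in>{0..1}. ln (q x)) < \<epsilon>"
    using mdist_C01_compose_continuous[OF deriv_I_C01[OF f], of "{0<..}" ln \<epsilon>] deriv_I_pos[OF f] e ln
    by (auto simp: image_subset_iff)
  have "log_dist_I f g < \<epsilon>" if g: "g \<in> carrier Diff_I" "rho_I f g < \<delta>" for g
  proof -
    have "mdist C01 (deriv_I f) (deriv_I g) \<le> rho_I f g" using f g by (simp add: rho_I_eq)
    then have "mdist C01 (log_deriv_I f) (log_deriv_I g) < \<epsilon>"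
      unfolding log_deriv_I_def using d(2) deriv_I_C01 deriv_I_pos g by auto
    then show ?thesis using f g by (simp add: log_dist_I_def)
  qed
  then show "\<exists>\<delta>>0. \<forall>g\<in>carrier Diff_I. rho_I f g < \<delta> \<longrightarrow> log_dist_I f g < \<epsilon>" using d(1) by blast
qed

lemma log_deriv_I_compose:
  assumes f: "f \<in> carrier Diff_I" and h: "h \<in> carrier Diff_I" and x: "x \<in> {0..1}"
  shows "log_deriv_I (compose {0..1} f h) x = log_deriv_I f (h x) + log_deriv_I h x"
proof -
  have im: "h ` {0..1} \<subseteq> {0..1}" using Bij_imp_funcset[of h] h Diff_I_carrier_subset by auto
  have "pos_C1 {0..1} (compose {0..1} f h) (\<lambda>x. deriv_I f (h x) * deriv_I h x)"
    by (rule pos_C1_cong[OF pos_C1_compose[OF pos_C1_deriv_I[OF f] pos_C1_deriv_I[OF h] im]]) (simp add: compose_def)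
  from deriv_I_eq[OF this x] show ?thesis
    using x im deriv_I_pos[OF f, of "h x"] deriv_I_pos[OF h x] by (simp add: log_deriv_I_def ln_mult image_subset_iff)
qed

text \<open>In \<open>log (f \<circ> h)' - log (g \<circ> h)' = (log f' - log g') \<circ> h\<close> the term \<open>log h'\<close> has cancelled, and \<open>h\<close>
  maps the interval onto itself.\<close>

lemma compatible_log_dist_I: "compatible_right_invariant_metric Diff_I Diff_I_topology log_dist_I"
  unfolding compatible_right_invariant_metric_def
proof (intro conjI ballI Metric_space_log_dist_I mtopology_log_dist_I)
  fix f g h assume f: "f \<in> carrier Diff_I" and g: "g \<in> carrier Diff_I" and h: "h \<in> carrier Diff_I"
  interpret group Diff_I by (rule group_Diff_I)
  have c: "compose {0..1} f h \<in> carrier Diff_I" "compose {0..1} g h \<in> carrier Diff_I"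
    using f g h m_closed mult_Diff_I by metis+
  have im: "h ` {0..1} = {0..1}" using h Diff_I_carrier_subset by (auto simp: Bij_def bij_betw_def)
  have "mdist C01 (log_deriv_I (compose {0..1} f h)) (log_deriv_I (compose {0..1} g h))
    = mdist C01 (log_deriv_I f) (log_deriv_I g)"
  proof (rule mdist_C01_eqI)
    fix b :: real
    have "(\<forall>x\<in>{0..1}. \<bar>log_deriv_I (compose {0..1} f h) x - log_deriv_I (compose {0..1} g h) x\<bar> \<le> b)
      \<longleftrightarrow> (\<forall>x\<in>{0..1}. \<bar>log_deriv_I f (h x) - log_deriv_I g (h x)\<bar> \<le> b)"
      using f g h by (simp add: log_deriv_I_compose)
    also have "\<dots> \<longleftrightarrow> (\<forall>y\<in>h ` {0..1}. \<bar>log_deriv_I f y - log_deriv_I g y\<bar> \<le> b)" by blast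
    finally show "(\<forall>x\<in>{0..1}. \<bar>log_deriv_I (compose {0..1} f h) x - log_deriv_I (compose {0..1} g h) x\<bar> \<le> b)
      \<longleftrightarrow> (\<forall>x\<in>{0..1}. \<bar>log_deriv_I f x - log_deriv_I g x\<bar> \<le> b)" unfolding im .
  qed (use f g c log_deriv_I_C01 in auto)
  then show "log_dist_I (f \<otimes>\<^bsub>Diff_I\<^esub> h) (g \<otimes>\<^bsub>Diff_I\<^esub> h) = log_dist_I f g"
    using f g h c by (simp add: mult_Diff_I log_dist_I_def)
qed

lemma exp_primitive_Diff_I:
  assumes "continuous_on {0..1} h"
  shows "exp_primitive h \<in> carrier Diff_I"
    and "x \<in> {0..1} \<Longrightarrow> log_deriv_I (exp_primitive h) x = h x - ln (exp_integral h)"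
proof -
  show "exp_primitive h \<in> carrier Diff_I"
    unfolding carrier_Diff_I_iff using pos_C1_exp_primitive[OF assms] exp_primitive_0 exp_primitive_1[OF assms]
    by (auto simp: exp_primitive_def)
  show "x \<in> {0..1} \<Longrightarrow> log_deriv_I (exp_primitive h) x = h x - ln (exp_integral h)"
    using deriv_I_eq[OF pos_C1_exp_primitive[OF assms]] by (simp add: log_deriv_I_def)
qed

lemma exp_integral_log_deriv_I:
  assumes f: "f \<in> carrier Diff_I" shows "exp_integral (log_deriv_I f) = 1"
proof (rule exp_integral_log_derivative)
  show "pos_C1 {0..1} f (\<lambda>x. exp (log_deriv_I f x))"
    by (rule pos_C1_deriv_cong[OF pos_C1_deriv_I[OF f] exp_log_deriv_I[OF f]])
qed (use f in \<open>simp_all add: carrier_Diff_I_iff\<close>)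

lemma exp_primitive_log_deriv_I:
  assumes f: "f \<in> carrier Diff_I" shows "exp_primitive (log_deriv_I f) = f"
proof -
  have c: "continuous_on {0..1} (log_deriv_I f)" using log_deriv_I_C01[OF f] by (simp add: mspace_C01)
  show ?thesis
    by (rule Diff_I_eqI[OF exp_primitive_Diff_I(1)[OF c] f])
      (simp add: exp_primitive_Diff_I(2)[OF c] exp_integral_log_deriv_I[OF f])
qed

text \<open>One \<open>c\<close> accounts for the functions, the other for their normalising constants.\<close>

lemma log_dist_exp_primitive_le:
  assumes h: "continuous_on {0..1} h" and k: "continuous_on {0..1} k"
    and c: "\<And>x. x \<in> {0..1} \<Longrightarrow> \<bar>h x - k x\<bar> \<le> c"
  shows "log_dist_I (exp_primitive h) (exp_primitive k) \<le> 2 * c"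
proof -
  note D = exp_primitive_Diff_I(1)[OF h] exp_primitive_Diff_I(1)[OF k]
  have "mdist C01 (log_deriv_I (exp_primitive h)) (log_deriv_I (exp_primitive k)) \<le> 2 * c"
    unfolding mdist_C01_le_iff[OF log_deriv_I_C01[OF D(1)] log_deriv_I_C01[OF D(2)]]
  proof
    fix x :: real assume x: "x \<in> {0..1}"
    show "\<bar>log_deriv_I (exp_primitive h) x - log_deriv_I (exp_primitive k) x\<bar> \<le> 2 * c"
      using exp_primitive_Diff_I(2)[OF h x] exp_primitive_Diff_I(2)[OF k x] c[OF x]
        ln_exp_integral_lipschitz[OF h k c] by linarith
  qed
  then show ?thesis using D by (simp add: log_dist_I_def)
qed

text \<open>The paths scale the logarithmic derivative and renormalise.\<close>

lemma path_group_Diff_I: "path_group Diff_I Diff_I_topology log_dist_I"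
proof (intro path_group.intro path_group_axioms.intro group_Diff_I compatible_log_dist_I exI[of _ 2] ballI)
  fix f assume f: "f \<in> carrier Diff_I"
  interpret group Diff_I by (rule group_Diff_I)
  interpret Metric_space "carrier Diff_I" log_dist_I by (rule Metric_space_log_dist_I)
  let ?u = "log_deriv_I f"
  let ?\<gamma> = "\<lambda>t. exp_primitive (\<lambda>x. t * ?u x)"
  have c: "continuous_on {0..1} (\<lambda>x. t * ?u x)" for t
    using log_deriv_I_C01[OF f] by (intro continuous_intros) (auto simp: mspace_C01)
  have one: "log_deriv_I \<one>\<^bsub>Diff_I\<^esub> x = 0" if x: "x \<in> {0..1}" for x
  proof -
    have "pos_C1 {0..1} \<one>\<^bsub>Diff_I\<^esub> (\<lambda>x. 1)"
      by (rule pos_C1_cong[of _ "\<lambda>x. x"]) (auto simp: pos_C1_def one_Diff_I intro!: derivative_eq_intros)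
    from deriv_I_eq[OF this x] x show ?thesis by (simp add: log_deriv_I_def)
  qed
  have u: "\<bar>?u x\<bar> \<le> log_dist_I f \<one>\<^bsub>Diff_I\<^esub>" if x: "x \<in> {0..1}" for x
    using mdist_C01_upper[OF log_deriv_I_C01[OF f] log_deriv_I_C01[OF one_closed] x] one[OF x] f
    by (simp add: log_dist_I_def)
  have lip: "log_dist_I (?\<gamma> s) (?\<gamma> t) \<le> 2 * (log_dist_I f \<one>\<^bsub>Diff_I\<^esub> + 1) * \<bar>s - t\<bar>" for s t
  proof -
    have "log_dist_I (?\<gamma> s) (?\<gamma> t) \<le> 2 * ((log_dist_I f \<one>\<^bsub>Diff_I\<^esub> + 1) * \<bar>s - t\<bar>)"
    proof (rule log_dist_exp_primitive_le[OF c c])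
      fix x :: real assume x: "x \<in> {0..1}"
      have "\<bar>s * ?u x - t * ?u x\<bar> = \<bar>?u x\<bar> * \<bar>s - t\<bar>"
        by (simp add: left_diff_distrib[symmetric] abs_mult mult.commute)
      also have "\<dots> \<le> (log_dist_I f \<one>\<^bsub>Diff_I\<^esub> + 1) * \<bar>s - t\<bar>"
        using u[OF x] by (intro mult_right_mono) auto
      finally show "\<bar>s * ?u x - t * ?u x\<bar> \<le> (log_dist_I f \<one>\<^bsub>Diff_I\<^esub> + 1) * \<bar>s - t\<bar>" .
    qed
    then show ?thesis by (simp only: mult.assoc)
  qed
  have "?\<gamma> 0 = \<one>\<^bsub>Diff_I\<^esub>"
    using exp_primitive_Diff_I(2)[OF c[of 0]]
    by (intro Diff_I_eqI[OF exp_primitive_Diff_I(1)[OF c] one_closed]) (simp add: one exp_integral_def)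
  moreover have "?\<gamma> 1 = f" by (simp add: exp_primitive_log_deriv_I[OF f])
  ultimately show "\<exists>\<gamma>. \<gamma> 0 = \<one>\<^bsub>Diff_I\<^esub> \<and> \<gamma> 1 = f \<and> \<gamma> \<in> {0..1} \<rightarrow> carrier Diff_I \<and>
      (\<forall>s\<in>{0..1}. \<forall>t\<in>{0..1}. log_dist_I (\<gamma> s) (\<gamma> t) \<le> 2 * (log_dist_I f \<one>\<^bsub>Diff_I\<^esub> + 1) * \<bar>s - t\<bar>)"
    using lip exp_primitive_Diff_I(1)[OF c] by (intro exI[of _ ?\<gamma>]) auto
qed

text \<open>Subtracting the value at 0 makes the range a linear space. Nothing is lost, because
  \<open>exp_primitive\<close> ignores additive constants.\<close>

lemma quasi_isometric_Diff_I_vanishing_0: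
  "quasi_isometric (carrier Diff_I) log_dist_I {h \<in> mspace C01. h 0 = 0} (mdist C01)"
proof (rule quasi_isometricI_onto[where L = 2 and C = 0 and \<phi> = "\<lambda>f. \<lambda>x\<in>{0..1}. log_deriv_I f x - log_deriv_I f 0"])
  let ?\<phi> = "\<lambda>f. \<lambda>x\<in>{0..1}. log_deriv_I f x - log_deriv_I f 0"
  let ?Y = "{h \<in> mspace C01. h 0 = 0}"
  show "Metric_space ?Y (mdist C01)" by (intro C01_subset_metric) auto
  have \<phi>: "?\<phi> f \<in> mspace C01" if "f \<in> carrier Diff_I" for f
    using log_deriv_I_C01[OF that] by (intro restrict_C01 continuous_intros) (auto simp: mspace_C01)
  show "?\<phi> ` carrier Diff_I = ?Y"
  proof
    show "?\<phi> ` carrier Diff_I \<subseteq> ?Y" using \<phi> by auto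
    show "?Y \<subseteq> ?\<phi> ` carrier Diff_I"
    proof
      fix h assume h: "h \<in> ?Y"
      then have c: "continuous_on {0..1} h" by (simp add: mspace_C01)
      have "h = ?\<phi> (exp_primitive h)"
        using h exp_primitive_Diff_I(2)[OF c] by (auto simp: fun_eq_iff mspace_C01 extensional_def)
      then show "h \<in> ?\<phi> ` carrier Diff_I" using exp_primitive_Diff_I(1)[OF c] by (rule image_eqI)
    qed
  qed
  fix f g assume f: "f \<in> carrier Diff_I" and g: "g \<in> carrier Diff_I"
  have d: "log_dist_I f g = mdist C01 (log_deriv_I f) (log_deriv_I g)" using f g by (simp add: log_dist_I_def)
  note up = mdist_C01_upper[OF log_deriv_I_C01[OF f] log_deriv_I_C01[OF g]]
  show "mdist C01 (?\<phi> f) (?\<phi> g) \<le> 2 * log_dist_I f g + 0"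
    unfolding mdist_C01_le_iff[OF \<phi>[OF f] \<phi>[OF g]] d
  proof
    fix x :: real assume "x \<in> {0..1}"
    then show "\<bar>?\<phi> f x - ?\<phi> g x\<bar> \<le> 2 * mdist C01 (log_deriv_I f) (log_deriv_I g) + 0"
      using up[of x] up[of 0] by simp
  qed
  have rec: "exp_primitive (?\<phi> f) = f" if f: "f \<in> carrier Diff_I" for f
  proof -
    have c: "continuous_on {0..1} (?\<phi> f)" using \<phi>[OF f] by (simp add: mspace_C01)
    have c': "continuous_on {0..1} (log_deriv_I f)" using log_deriv_I_C01[OF f] by (simp add: mspace_C01)
    have "exp_integral (?\<phi> f) = exp_integral (\<lambda>x. log_deriv_I f x - log_deriv_I f 0)"
      unfolding exp_integral_def by (rule integral_cong) simp
    then have "exp_integral (?\<phi> f) = exp (- log_deriv_I f 0)"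
      using exp_integral_shift[OF c'] exp_integral_log_deriv_I[OF f] by simp
    then show ?thesis
      by (intro Diff_I_eqI[OF exp_primitive_Diff_I(1)[OF c] f]) (simp add: exp_primitive_Diff_I(2)[OF c])
  qed
  have "log_dist_I (exp_primitive (?\<phi> f)) (exp_primitive (?\<phi> g)) \<le> 2 * mdist C01 (?\<phi> f) (?\<phi> g)"
    using \<phi>[OF f] \<phi>[OF g] mdist_C01_upper[OF \<phi>[OF f] \<phi>[OF g]]
    by (intro log_dist_exp_primitive_le) (auto simp: mspace_C01)
  then show "log_dist_I f g \<le> 2 * mdist C01 (?\<phi> f) (?\<phi> g) + 0" using rec f g by simp
qed auto

section \<open>Lifts of circle diffeomorphisms\<close>

lemma norm_circle_pt [simp]: "norm (circle_pt x) = 1"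
  by (simp add: circle_pt_def)

lemma circle_pt_in_S1 [simp]: "circle_pt x \<in> S1"
  by simp

lemma circle_pt_add_int [simp]: "circle_pt (x + of_int n) = circle_pt x"
proof -
  have "circle_pt (x + of_int n) = cis (2 * pi * x) * cis (2 * pi * of_int n)"
    unfolding circle_pt_def cis_mult by (simp add: algebra_simps)
  then show ?thesis by (simp add: circle_pt_def)
qed

lemma circle_pt_eqD:
  assumes "circle_pt x = circle_pt y" shows "\<exists>n::int. x = y + of_int n"
proof -
  have "sin (2 * pi * x) = sin (2 * pi * y) \<and> cos (2 * pi * x) = cos (2 * pi * y)"
    using assms by (simp add: circle_pt_def complex_eq_iff)
  then obtain n :: int where "2 * pi * x = 2 * pi * y + 2 * pi * n"
    unfolding sin_cos_eq_iff by blast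
  then have "2 * pi * x = 2 * pi * (y + n)" by (simp add: algebra_simps)
  then have "x = y + of_int n" by simp
  then show ?thesis by blast
qed

lemma circle_pt_frac: "circle_pt (frac x) = circle_pt x"
  unfolding frac_def using circle_pt_add_int[of "x - of_int \<lfloor>x\<rfloor>" "\<lfloor>x\<rfloor>"] by simp

lemma dist_circle_pt_le: "dist (circle_pt x) (circle_pt y) \<le> 2 * pi * \<bar>x - y\<bar>"
proof -
  have "circle_pt x - circle_pt y = circle_pt y * (cis (2 * pi * (x - y)) - 1)"
    by (simp add: circle_pt_def right_diff_distrib cis_mult algebra_simps)
  then have "dist (circle_pt x) (circle_pt y) = norm (exp (\<i> * of_real (2 * pi * (x - y))) - 1)"
    by (simp add: dist_norm norm_mult cis_conv_exp)
  also have "\<dots> = 2 * \<bar>sin ((2 * pi * (x - y)) / 2)\<bar>" by (rule dist_exp_i_1)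
  also have "\<dots> \<le> 2 * \<bar>(2 * pi * (x - y)) / 2\<bar>" using abs_sin_x_le_abs_x by (intro mult_left_mono) auto
  also have "\<dots> = 2 * pi * \<bar>x - y\<bar>" by (simp add: abs_mult)
  finally show ?thesis .
qed

text \<open>The representative in \<open>[0, 1)\<close> of a point of the circle; an explicit section of \<open>circle_pt\<close>.\<close>

definition circle_arg :: "complex \<Rightarrow> real"
  where "circle_arg z = frac (Arg z / (2 * pi))"

lemma circle_arg_in: "circle_arg z \<in> {0..1}"
  by (simp add: circle_arg_def frac_lt_1 less_imp_le)

lemma circle_pt_arg:
  assumes "z \<in> S1" shows "circle_pt (circle_arg z) = z"
proof -
  have "z \<noteq> 0" "norm z = 1" using assms by auto
  then have "cis (Arg z) = z" by (simp add: cis_Arg sgn_eq)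
  then show ?thesis unfolding circle_arg_def circle_pt_frac by (simp add: circle_pt_def)
qed

lemma circle_arg_pt: "circle_arg (circle_pt x) = frac x"
proof -
  obtain n :: int where n: "circle_arg (circle_pt x) = x + of_int n"
    using circle_pt_eqD[OF circle_pt_arg[of "circle_pt x"]] by auto
  have "frac (circle_arg (circle_pt x)) = circle_arg (circle_pt x)" by (simp add: circle_arg_def)
  then show ?thesis unfolding n by simp
qed

lemma circle_pt_image: "circle_pt ` {0..1} = S1"
proof
  show "S1 \<subseteq> circle_pt ` {0..1}"
  proof
    fix z assume "z \<in> S1"
    then have "z = circle_pt (circle_arg z)" by (simp add: circle_pt_arg)
    then show "z \<in> circle_pt ` {0..1}" using circle_arg_in by (rule image_eqI)
  qed
qed auto

lemma continuous_integer_valued_const: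
  fixes \<delta> :: "real \<Rightarrow> real"
  assumes "continuous_on UNIV \<delta>" "\<And>x. \<exists>n::int. \<delta> x = of_int n"
  shows "\<exists>n::int. \<forall>x. \<delta> x = of_int n"
proof -
  have "\<delta> constant_on UNIV"
  proof (rule continuous_discrete_range_constant[OF connected_UNIV assms(1)])
    fix x
    have "1 \<le> norm (\<delta> y - \<delta> x)" if "\<delta> y \<noteq> \<delta> x" for y
    proof -
      obtain m n :: int where "\<delta> x = m" "\<delta> y = n" using assms(2) by meson
      then show ?thesis using that by (simp flip: of_int_diff)
    qed
    then show "\<exists>e>0. \<forall>y. y \<in> UNIV \<and> \<delta> y \<noteq> \<delta> x \<longrightarrow> e \<le> norm (\<delta> y - \<delta> x)"
      by (intro exI[of _ 1]) auto
  qed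
  then obtain c where c: "\<And>x. \<delta> x = c" unfolding constant_on_def by blast
  obtain n :: int where "\<delta> 0 = of_int n" using assms(2) by blast
  then have "\<forall>x. \<delta> x = of_int n" using c by simp
  then show ?thesis by blast
qed

lemma circle_lift_unique:
  assumes "circle_lift f F" "circle_lift f G"
  shows "\<exists>n::int. \<forall>x. G x = F x + of_int n"
proof -
  have "\<exists>n::int. G x - F x = of_int n" for x
  proof -
    have "circle_pt (G x) = circle_pt (F x)" using assms unfolding circle_lift_def by metis
    then show ?thesis using circle_pt_eqD by force
  qed
  moreover have "continuous_on UNIV (\<lambda>x. G x - F x)"
    using assms unfolding circle_lift_def by (intro continuous_intros) auto
  ultimately obtain n :: int where "\<And>x. G x - F x = of_int n"
    using continuous_integer_valued_const[of "\<lambda>x. G x - F x"] by blast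
  then show ?thesis by (intro exI[of _ n]) (simp add: algebra_simps)
qed

text \<open>The condition of degree one is part of the definition: a lift with \<open>F (x + 1) = F x + k\<close>, \<open>k > 0\<close>, would
  cover the circle \<open>k\<close> times.\<close>

definition circle_diffeo_lift :: "(complex \<Rightarrow> complex) \<Rightarrow> (real \<Rightarrow> real) \<Rightarrow> (real \<Rightarrow> real) \<Rightarrow> bool"
  where "circle_diffeo_lift f F p \<longleftrightarrow>
    circle_lift f F \<and> pos_C1 UNIV F p \<and> (\<forall>x. F (x + 1) = F x + 1)"

lemma add_one_int:
  fixes F :: "real \<Rightarrow> real"
  assumes "\<And>x. F (x + 1) = F x + c" shows "F (x + of_int n) = F x + of_int n * c"
proof (induction n rule: int_induct[of _ 0])
  case (step1 i)
  then show ?case using assms[of "x + of_int i"] by (simp add: algebra_simps)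
next
  case (step2 i)
  then show ?case using assms[of "x + of_int (i - 1)"] by (simp add: algebra_simps)
qed simp

lemma pos_C1_UNIV: "pos_C1 UNIV F p \<Longrightarrow> (F has_real_derivative p x) (at x)"
  by (simp add: pos_C1_def)

text \<open>Since \<open>F\<close> increases by 1 over each unit interval, it is unbounded in both directions.\<close>

lemma circle_diffeo_lift_bij:
  assumes F: "circle_diffeo_lift f F p" shows "bij F"
proof -
  have mono: "strict_mono_on UNIV F"
    using F by (intro pos_C1_strict_mono[of _ _ p]) (auto simp: circle_diffeo_lift_def)
  have "\<exists>x. F x = y" for y
  proof -
    define n where "n = \<lfloor>y - F 0\<rfloor>"
    have n: "of_int n \<le> y - F 0" "y - F 0 \<le> of_int (n + 1)" unfolding n_def by linarith+
    have per: "F (0 + of_int k) = F 0 + of_int k * 1" for k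
      using F unfolding circle_diffeo_lift_def by (intro add_one_int) auto
    have c: "continuous_on {of_int n..of_int (n + 1)} F"
      using F pos_C1_continuous continuous_on_subset unfolding circle_diffeo_lift_def by blast
    show ?thesis using IVT'[of F "of_int n" y "of_int (n + 1)"] c n per[of n] per[of "n + 1"] by auto
  qed
  then show ?thesis
    using strict_mono_on_imp_inj_on[OF mono] unfolding bij_def surj_def by metis
qed

text \<open>Integer translations commute with \<open>F\<close>, so its bijectivity descends to the circle.\<close>

lemma circle_diffeo_lift_Bij:
  assumes f: "f \<in> extensional S1" and F: "circle_diffeo_lift f F p"
  shows "f \<in> Bij S1"
proof -
  have lift: "f (circle_pt x) = circle_pt (F x)" for x
    using F by (simp add: circle_diffeo_lift_def circle_lift_def)
  have per: "F (x + of_int k) = F x + of_int k * 1" for x k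
    using F unfolding circle_diffeo_lift_def by (intro add_one_int) auto
  note bij = circle_diffeo_lift_bij[OF F]
  have "inj_on f S1"
  proof (rule inj_onI)
    fix z w assume zw: "z \<in> S1" "w \<in> S1" "f z = f w"
    obtain x y where xy: "z = circle_pt x" "w = circle_pt y" using zw circle_pt_arg by metis
    obtain n :: int where "F x = F y + of_int n" using zw(3) circle_pt_eqD unfolding xy lift by blast
    then have "F x = F (y + of_int n)" using per[of y n] by simp
    then have "x = y + of_int n" using bij by (simp add: bij_def inj_eq)
    then show "z = w" unfolding xy by simp
  qed
  moreover have "f ` S1 = S1"
  proof
    show "f ` S1 \<subseteq> S1"
    proof
      fix w assume "w \<in> f ` S1"
      then obtain z where "z \<in> S1" "w = f z" by blast
      then have "w = circle_pt (F (circle_arg z))" using lift[of "circle_arg z"] circle_pt_arg by simp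
      then show "w \<in> S1" by simp
    qed
    show "S1 \<subseteq> f ` S1"
    proof
      fix z assume "z \<in> S1"
      then have "z = circle_pt (F (inv_into UNIV F (circle_arg z)))"
        using bij by (simp add: circle_pt_arg bij_is_surj surj_f_inv_f)
      then have "z = f (circle_pt (inv_into UNIV F (circle_arg z)))" by (simp add: lift)
      then show "z \<in> f ` S1" by (rule image_eqI) simp
    qed
  qed
  ultimately show ?thesis using f by (simp add: Bij_def bij_betw_def)
qed

lemma circle_diffeo_lift_inverse:
  assumes f: "f \<in> Bij S1" and F: "circle_diffeo_lift f F p"
  shows "circle_diffeo_lift (inv_into S1 f) (inv_into UNIV F) (\<lambda>y. 1 / p (inv_into UNIV F y))"
proof -
  have lift: "f (circle_pt x) = circle_pt (F x)" for x
    using F by (simp add: circle_diffeo_lift_def circle_lift_def)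
  have p: "pos_C1 UNIV F p" using F by (simp add: circle_diffeo_lift_def)
  note bij = circle_diffeo_lift_bij[OF F]
  have FG: "F (inv_into UNIV F y) = y" for y using bij by (simp add: bij_is_surj surj_f_inv_f)
  have GF: "inv_into UNIV F (F x) = x" for x using bij by (simp add: bij_is_inj)
  have "isCont (inv_into UNIV F) y" for y
    using isCont_inverse_function[of 1 "inv_into UNIV F y" "inv_into UNIV F" F] GF FG
      DERIV_isCont[OF pos_C1_UNIV[OF p]] by simp
  then have cont: "continuous_on UNIV (inv_into UNIV F)" by (simp add: continuous_at_imp_continuous_on)
  have "range F = UNIV" using bij by (simp add: bij_is_surj)
  then have inv: "pos_C1 UNIV (inv_into UNIV F) (\<lambda>y. 1 / p (inv_into UNIV F y))"
    using pos_C1_inverse[OF p, of "inv_into UNIV F"] cont GF by simp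
  have "inv_into UNIV F (y + 1) = inv_into UNIV F y + 1" for y
  proof -
    have "F (inv_into UNIV F y + 1) = y + 1" using F FG by (simp add: circle_diffeo_lift_def)
    then show ?thesis using GF by metis
  qed
  moreover have "inv_into S1 f (circle_pt y) = circle_pt (inv_into UNIV F y)" for y
  proof (rule inv_into_f_eq)
    show "inj_on f S1" using f by (simp add: Bij_def bij_betw_def)
  qed (simp_all add: lift FG)
  ultimately show ?thesis using inv cont by (simp add: circle_diffeo_lift_def circle_lift_def)
qed

lemma circle_lift_cong:
  assumes "circle_lift f F" "\<And>z. z \<in> S1 \<Longrightarrow> g z = f z" shows "circle_lift g F"
  using assms by (simp add: circle_lift_def)

text \<open>A strictly increasing lift \<open>M\<close> and a \<open>C\<^sup>1\<close> lift \<open>F\<close> differ by an integer, so \<open>F\<close> has both properties.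
  Composed with a lift \<open>G\<close> of the inverse it is a translation, which gives the positivity of the
  derivative. The degrees of \<open>F\<close> and \<open>G\<close> are integers with product 1, and that of \<open>F\<close> is positive.\<close>

lemma circle_lift_C1_diffeo:
  assumes b: "bij_betw f S1 S1" and F: "circle_lift f F" "C1_on UNIV F"
    and m: "circle_lift f M" "strict_mono M"
    and G: "circle_lift (inv_into S1 f) G" "C1_on UNIV G"
  shows "\<exists>p. circle_diffeo_lift f F p"
proof -
  note C1 = C1_on_iff[of UNIV 0 "1::real", simplified]
  obtain p where p: "continuous_on UNIV p" "\<And>x. (F has_real_derivative p x) (at x)"
    using F(2) unfolding C1 by blast
  obtain q where q: "\<And>x. (G has_real_derivative q x) (at x)"
    using G(2) unfolding C1 by blast
  obtain n :: int where "\<And>x. F x = M x + of_int n" using circle_lift_unique[OF m(1) F(1)] by blast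
  then have mono: "strict_mono F" using m(2) by (simp add: strict_mono_def)
  have id: "circle_lift id id" by (simp add: circle_lift_def continuous_on_id)
  have shift: "circle_lift f (\<lambda>x. F (x + 1))"
  proof -
    have "f (circle_pt x) = circle_pt (F (x + 1))" for x
      using F(1) circle_pt_add_int[of x 1] unfolding circle_lift_def by (metis of_int_1)
    moreover have "continuous_on UNIV (\<lambda>x. F (x + 1))"
      using F(1) unfolding circle_lift_def
      by (auto intro!: continuous_on_compose2[of UNIV F] continuous_intros)
    ultimately show ?thesis by (simp add: circle_lift_def)
  qed
  have shiftG: "circle_lift (inv_into S1 f) (\<lambda>x. G (x + 1))"
  proof -
    have "inv_into S1 f (circle_pt x) = circle_pt (G (x + 1))" for x
      using G(1) circle_pt_add_int[of x 1] unfolding circle_lift_def by (metis of_int_1)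
    moreover have "continuous_on UNIV (\<lambda>x. G (x + 1))"
      using G(1) unfolding circle_lift_def
      by (auto intro!: continuous_on_compose2[of UNIV G] continuous_intros)
    ultimately show ?thesis by (simp add: circle_lift_def)
  qed
  have "circle_lift id (\<lambda>x. G (F x))"
  proof -
    have "circle_pt x = circle_pt (G (F x))" for x
    proof -
      have "inv_into S1 f (f (circle_pt x)) = circle_pt x"
        using b by (intro inv_into_f_f) (auto simp: bij_betw_def)
      then show ?thesis using F(1) G(1) unfolding circle_lift_def by metis
    qed
    moreover have "continuous_on UNIV (\<lambda>x. G (F x))"
      using F(1) G(1) unfolding circle_lift_def by (auto intro: continuous_on_compose2)
    ultimately show ?thesis by (simp add: circle_lift_def)
  qed
  then obtain c :: int where c: "\<And>x. G (F x) = x + of_int c"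
    using circle_lift_unique[OF id] by auto
  have pos: "pos_C1 UNIV F p"
    by (rule pos_C1_of_invertible[OF _ _ _ _ mono p q, of 0 1 "of_int c"]) (simp_all add: c)
  obtain k :: int where k: "\<And>x. F (x + 1) = F x + of_int k" using circle_lift_unique[OF F(1) shift] by blast
  obtain m :: int where m: "\<And>x. G (x + 1) = G x + of_int m" using circle_lift_unique[OF G(1) shiftG] by blast
  have "F 0 < F (0 + 1)" using mono by (simp add: strict_mono_def)
  then have k0: "k > 0" unfolding k by simp
  have "G (F 0 + of_int k) = G (F 0) + of_int k * of_int m" by (rule add_one_int[where F = G, OF m])
  moreover have "G (F 0 + of_int k) = G (F 0) + 1" using k[of 0] c[of 0] c[of 1] by simp
  ultimately have "of_int (k * m) = (1::real)" by simp
  then have "k * m = 1" by linarith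
  then have "k = 1" using k0 by (simp add: zmult_eq_1_iff)
  then show ?thesis using F(1) pos k by (auto simp: circle_diffeo_lift_def)
qed

lemma carrier_Diff_S1_iff:
  "f \<in> carrier Diff_S1 \<longleftrightarrow> f \<in> extensional S1 \<and> (\<exists>F p. circle_diffeo_lift f F p)"
proof
  assume "f \<in> carrier Diff_S1"
  then have f: "f \<in> extensional S1" "bij_betw f S1 S1" "C1_circle f" "C1_circle (inv_into S1 f)"
    "orientation_preserving_circle f" by (auto simp: Diff_S1_def Bij_def)
  obtain F G M where "circle_lift f F" "C1_on UNIV F" "circle_lift (inv_into S1 f) G" "C1_on UNIV G"
    "circle_lift f M" "strict_mono M"
    using f(3-5) unfolding C1_circle_def orientation_preserving_circle_def by blast
  then show "f \<in> extensional S1 \<and> (\<exists>F p. circle_diffeo_lift f F p)"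
    using circle_lift_C1_diffeo[OF f(2)] f(1) by blast
next
  assume "f \<in> extensional S1 \<and> (\<exists>F p. circle_diffeo_lift f F p)"
  then obtain F p where f: "f \<in> extensional S1" and F: "circle_diffeo_lift f F p" by blast
  have B: "f \<in> Bij S1" by (rule circle_diffeo_lift_Bij[OF f F])
  note C1 = C1_on_iff[of UNIV 0 "1::real", simplified]
  have C1c: "C1_circle g" if "circle_diffeo_lift g H q" for g H q
    using that unfolding C1_circle_def circle_diffeo_lift_def pos_C1_def C1 by blast
  have "orientation_preserving_circle f"
    using F pos_C1_strict_mono[of UNIV F p]
    unfolding orientation_preserving_circle_def circle_diffeo_lift_def by auto
  then show "f \<in> carrier Diff_S1"
    using B C1c[OF F] C1c[OF circle_diffeo_lift_inverse[OF B F]] by (simp add: Diff_S1_def)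
qed

lemma carrier_Diff_S1_Bij: "carrier Diff_S1 \<subseteq> Bij S1"
  by (auto simp: Diff_S1_def)

lemma circle_diffeo_lift_compose:
  assumes F: "circle_diffeo_lift f F p" and G: "circle_diffeo_lift g G q"
  shows "circle_diffeo_lift (compose S1 f g) (F \<circ> G) (\<lambda>x. p (G x) * q x)"
proof -
  have "continuous_on UNIV (\<lambda>x. F (G x))"
    using F G continuous_on_compose2[of UNIV F UNIV G] by (simp add: circle_diffeo_lift_def circle_lift_def)
  then have "circle_lift (compose S1 f g) (F \<circ> G)"
    using F G by (simp add: circle_diffeo_lift_def circle_lift_def compose_def comp_def)
  then show ?thesis
    using F G pos_C1_compose[of UNIV F p UNIV G q] by (simp add: circle_diffeo_lift_def)
qed

lemma circle_diffeo_lift_id: "circle_diffeo_lift (\<lambda>z\<in>S1. z) (\<lambda>x. x) (\<lambda>x. 1)"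
  by (simp add: circle_diffeo_lift_def circle_lift_def pos_C1_def continuous_on_id)

lemma subgroup_Diff_S1: "subgroup (carrier Diff_S1) (BijGroup S1)"
proof
  show "carrier Diff_S1 \<subseteq> carrier (BijGroup S1)"
    using carrier_Diff_S1_Bij by (simp add: BijGroup_def)
  show "\<one>\<^bsub>BijGroup S1\<^esub> \<in> carrier Diff_S1"
    using circle_diffeo_lift_id unfolding carrier_Diff_S1_iff by (auto simp: BijGroup_def)
next
  fix f g assume fg: "f \<in> carrier Diff_S1" "g \<in> carrier Diff_S1"
  then obtain F p G q where "circle_diffeo_lift f F p" "circle_diffeo_lift g G q"
    unfolding carrier_Diff_S1_iff by blast
  from circle_diffeo_lift_compose[OF this] have "compose S1 f g \<in> carrier Diff_S1"
    unfolding carrier_Diff_S1_iff by (auto simp: compose_def)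
  then show "f \<otimes>\<^bsub>BijGroup S1\<^esub> g \<in> carrier Diff_S1"
    using fg carrier_Diff_S1_Bij by (simp add: BijGroup_def subset_iff)
next
  fix f assume f: "f \<in> carrier Diff_S1"
  then have B: "f \<in> Bij S1" using carrier_Diff_S1_Bij by auto
  obtain F p where F: "circle_diffeo_lift f F p" using f carrier_Diff_S1_iff by blast
  have "circle_diffeo_lift (restrict (inv_into S1 f) S1) (inv_into UNIV F) (\<lambda>y. 1 / p (inv_into UNIV F y))"
    using circle_diffeo_lift_inverse[OF B F] circle_lift_cong[of "inv_into S1 f" "inv_into UNIV F" "restrict (inv_into S1 f) S1"]
    unfolding circle_diffeo_lift_def by simp
  then have "restrict (inv_into S1 f) S1 \<in> carrier Diff_S1"
    unfolding carrier_Diff_S1_iff using restrict_extensional by blast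
  then show "inv\<^bsub>BijGroup S1\<^esub> f \<in> carrier Diff_S1" using inv_BijGroup[OF B] by simp
qed

lemma group_Diff_S1: "group Diff_S1"
proof -
  have "Diff_S1 = BijGroup S1 \<lparr>carrier := carrier Diff_S1\<rparr>" by (simp add: Diff_S1_def)
  then show ?thesis using subgroup.subgroup_is_group[OF subgroup_Diff_S1 group_BijGroup] by simp
qed

lemma mult_Diff_S1:
  assumes "f \<in> carrier Diff_S1" "g \<in> carrier Diff_S1"
  shows "f \<otimes>\<^bsub>Diff_S1\<^esub> g = compose S1 f g"
proof -
  have "f \<in> Bij S1" "g \<in> Bij S1" using assms carrier_Diff_S1_Bij by auto
  then show ?thesis by (simp add: Diff_S1_def BijGroup_def)
qed

lemma one_Diff_S1: "\<one>\<^bsub>Diff_S1\<^esub> = (\<lambda>z\<in>S1. z)"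
  by (simp add: Diff_S1_def BijGroup_def)

text \<open>The choice of the lift in \<open>circle_deriv\<close> is immaterial, because lifts differ by constants.\<close>

lemma circle_deriv_eq:
  assumes F: "circle_diffeo_lift f F p" shows "circle_deriv f = p"
proof
  fix x
  have lift: "circle_lift f F" and p: "pos_C1 UNIV F p" using F by (auto simp: circle_diffeo_lift_def)
  from lift have "circle_lift f (SOME F. circle_lift f F)" by (rule someI[of "circle_lift f"])
  then obtain n :: int where n: "\<And>x. (SOME F. circle_lift f F) x = F x + of_int n"
    using circle_lift_unique[OF lift] by blast
  have "((\<lambda>x. F x + of_int n) has_real_derivative p x) (at x)"
    using pos_C1_UNIV[OF p, of x] by (auto intro!: derivative_eq_intros)
  moreover have "(SOME F. circle_lift f F) = (\<lambda>x. F x + of_int n)" using n by (rule ext)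
  ultimately show "circle_deriv f x = p x"
    unfolding circle_deriv_def
    by (simp only: has_real_derivative_iff_has_vector_derivative vector_derivative_at)
qed

lemma circle_deriv_lift:
  assumes f: "f \<in> carrier Diff_S1"
  obtains F where "circle_diffeo_lift f F (circle_deriv f)"
proof -
  obtain F p where "circle_diffeo_lift f F p" using f carrier_Diff_S1_iff by blast
  then show thesis using circle_deriv_eq that by metis
qed

lemma circle_deriv_props:
  assumes f: "f \<in> carrier Diff_S1"
  shows "circle_deriv f x > 0" "continuous_on S (circle_deriv f)" "circle_deriv f (x + 1) = circle_deriv f x"
proof -
  obtain F where F: "circle_diffeo_lift f F (circle_deriv f)" using circle_deriv_lift[OF f] .
  then have p: "pos_C1 UNIV F (circle_deriv f)" by (simp add: circle_diffeo_lift_def)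
  show "circle_deriv f x > 0" "continuous_on S (circle_deriv f)"
    using p continuous_on_subset unfolding pos_C1_def by blast+
  have "((\<lambda>x. F (x + 1)) has_real_derivative circle_deriv f (x + 1)) (at x)"
    using DERIV_shift[of F "circle_deriv f (x + 1)" x 1] pos_C1_UNIV[OF p, of "x + 1"] by simp
  moreover have "((\<lambda>x. F x + 1) has_real_derivative circle_deriv f x) (at x)"
    using pos_C1_UNIV[OF p, of x] by (auto intro!: derivative_eq_intros)
  moreover have "(\<lambda>x. F (x + 1)) = (\<lambda>x. F x + 1)" using F by (simp add: circle_diffeo_lift_def)
  ultimately show "circle_deriv f (x + 1) = circle_deriv f x" using DERIV_unique by metis
qed

section \<open>A right-invariant metric on the circle diffeomorphisms\<close>

definition sup_dist_S1 :: "(complex \<Rightarrow> complex) \<Rightarrow> (complex \<Rightarrow> complex) \<Rightarrow> real"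
  where "sup_dist_S1 f g = (SUP x\<in>{0..1}. dist (f (circle_pt x)) (g (circle_pt x)))"

lemma Diff_S1_maps: "f \<in> carrier Diff_S1 \<Longrightarrow> f ` S1 = S1"
  using carrier_Diff_S1_Bij by (auto simp: Bij_def bij_betw_def)

lemma sup_dist_S1_le_iff:
  assumes f: "f \<in> carrier Diff_S1" and g: "g \<in> carrier Diff_S1"
  shows "sup_dist_S1 f g \<le> c \<longleftrightarrow> (\<forall>z\<in>S1. dist (f z) (g z) \<le> c)"
proof -
  have le2: "dist (f (circle_pt x)) (g (circle_pt x)) \<le> 2" for x
  proof -
    have "f (circle_pt x) \<in> S1" "g (circle_pt x) \<in> S1"
      using Diff_S1_maps[OF f] Diff_S1_maps[OF g] circle_pt_in_S1[of x] by blast+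
    then show ?thesis using dist_triangle2[of "f (circle_pt x)" "g (circle_pt x)" 0] by simp
  qed
  have "bdd_above ((\<lambda>x. dist (f (circle_pt x)) (g (circle_pt x))) ` {0..1})"
    by (rule bdd_aboveI2[OF le2])
  then have "sup_dist_S1 f g \<le> c \<longleftrightarrow> (\<forall>x\<in>{0..1}. dist (f (circle_pt x)) (g (circle_pt x)) \<le> c)"
    unfolding sup_dist_S1_def by (intro cSUP_le_iff) auto
  also have "\<dots> \<longleftrightarrow> (\<forall>z\<in>circle_pt ` {0..1}. dist (f z) (g z) \<le> c)" by blast
  finally show ?thesis unfolding circle_pt_image .
qed

lemma sup_dist_S1_upper:
  assumes "f \<in> carrier Diff_S1" "g \<in> carrier Diff_S1" "z \<in> S1"
  shows "dist (f z) (g z) \<le> sup_dist_S1 f g"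
  using sup_dist_S1_le_iff[OF assms(1,2)] assms(3) by blast

lemma sup_dist_S1_nonneg:
  assumes "f \<in> carrier Diff_S1" "g \<in> carrier Diff_S1" shows "0 \<le> sup_dist_S1 f g"
  using sup_dist_S1_upper[OF assms circle_pt_in_S1[of 0]] order_trans[OF zero_le_dist] by blast

lemma sup_dist_S1_commute: "sup_dist_S1 f g = sup_dist_S1 g f"
  by (simp add: sup_dist_S1_def dist_commute)

lemma sup_dist_S1_triangle:
  assumes f: "f \<in> carrier Diff_S1" and g: "g \<in> carrier Diff_S1" and h: "h \<in> carrier Diff_S1"
  shows "sup_dist_S1 f h \<le> sup_dist_S1 f g + sup_dist_S1 g h"
  unfolding sup_dist_S1_le_iff[OF f h]
proof
  fix z assume z: "z \<in> S1"
  show "dist (f z) (h z) \<le> sup_dist_S1 f g + sup_dist_S1 g h"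
    using dist_triangle[of "f z" "h z" "g z"] sup_dist_S1_upper[OF f g z] sup_dist_S1_upper[OF g h z] by linarith
qed

lemma sup_dist_S1_eq_0D:
  assumes f: "f \<in> carrier Diff_S1" and g: "g \<in> carrier Diff_S1" and 0: "sup_dist_S1 f g \<le> 0"
  shows "f = g"
proof
  fix z show "f z = g z"
  proof (cases "z \<in> S1")
    case True
    have "dist (f z) (g z) \<le> 0" using sup_dist_S1_upper[OF f g True] 0 by linarith
    then show ?thesis by simp
  next
    case False
    then show ?thesis using f g unfolding carrier_Diff_S1_iff extensional_def by auto
  qed
qed

lemma sup_dist_S1_le_2:
  assumes f: "f \<in> carrier Diff_S1" and g: "g \<in> carrier Diff_S1" shows "sup_dist_S1 f g \<le> 2"
  unfolding sup_dist_S1_le_iff[OF assms]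
proof
  fix z assume "z \<in> S1"
  then have "f z \<in> S1" "g z \<in> S1" using Diff_S1_maps f g by blast+
  then show "dist (f z) (g z) \<le> 2" using dist_triangle2[of "f z" "g z" 0] by simp
qed

text \<open>The metric \<open>rho_S1\<close> and the logarithmic metric have the same shape and differ only in the function
  \<open>K f\<close> that represents the derivative.\<close>

definition jet_dist_S1 :: "((complex \<Rightarrow> complex) \<Rightarrow> real \<Rightarrow> real) \<Rightarrow> (complex \<Rightarrow> complex) \<Rightarrow> (complex \<Rightarrow> complex) \<Rightarrow> real"
  where "jet_dist_S1 K f g = (if f \<in> carrier Diff_S1 \<and> g \<in> carrier Diff_S1
    then sup_dist_S1 f g + mdist C01 (K f) (K g) else 0)"

lemma Metric_space_jet_dist_S1:
  assumes K: "\<And>f. f \<in> carrier Diff_S1 \<Longrightarrow> K f \<in> mspace C01"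
  shows "Metric_space (carrier Diff_S1) (jet_dist_S1 K)"
proof
  show "0 \<le> jet_dist_S1 K f g" for f g using sup_dist_S1_nonneg by (simp add: jet_dist_S1_def)
  show "jet_dist_S1 K f g = jet_dist_S1 K g f" for f g
    by (simp add: jet_dist_S1_def mdist_commute sup_dist_S1_commute)
  fix f g h assume f: "f \<in> carrier Diff_S1" and g: "g \<in> carrier Diff_S1"
  show "jet_dist_S1 K f g = 0 \<longleftrightarrow> f = g"
  proof
    assume "jet_dist_S1 K f g = 0"
    then have "sup_dist_S1 f g + mdist C01 (K f) (K g) = 0" using f g by (simp add: jet_dist_S1_def)
    moreover have "0 \<le> mdist C01 (K f) (K g)" by simp
    ultimately have "sup_dist_S1 f g \<le> 0" by linarith
    then show "f = g" by (rule sup_dist_S1_eq_0D[OF f g])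
  next
    assume "f = g"
    moreover have "sup_dist_S1 f f = 0" by (simp add: sup_dist_S1_def)
    ultimately show "jet_dist_S1 K f g = 0" using f K[OF f] by (simp add: jet_dist_S1_def)
  qed
  assume h: "h \<in> carrier Diff_S1"
  show "jet_dist_S1 K f h \<le> jet_dist_S1 K f g + jet_dist_S1 K g h"
    using mdist_triangle[OF K[OF f] K[OF g] K[OF h]] sup_dist_S1_triangle[OF f g h] f g h
    by (simp add: jet_dist_S1_def)
qed

definition deriv_S1 :: "(complex \<Rightarrow> complex) \<Rightarrow> real \<Rightarrow> real"
  where "deriv_S1 f = restrict (circle_deriv f) {0..1}"

definition log_deriv_S1 :: "(complex \<Rightarrow> complex) \<Rightarrow> real \<Rightarrow> real"
  where "log_deriv_S1 f = (\<lambda>x\<in>{0..1}. ln (circle_deriv f x))"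

definition log_dist_S1 :: "(complex \<Rightarrow> complex) \<Rightarrow> (complex \<Rightarrow> complex) \<Rightarrow> real"
  where "log_dist_S1 = jet_dist_S1 log_deriv_S1"

lemma deriv_S1_C01: "f \<in> carrier Diff_S1 \<Longrightarrow> deriv_S1 f \<in> mspace C01"
  unfolding deriv_S1_def by (intro restrict_C01 circle_deriv_props)

lemma log_deriv_S1_C01:
  assumes f: "f \<in> carrier Diff_S1" shows "log_deriv_S1 f \<in> mspace C01"
proof -
  have "circle_deriv f x \<noteq> 0" for x using circle_deriv_props(1)[OF f, of x] by simp
  then show ?thesis
    unfolding log_deriv_S1_def by (intro restrict_C01 continuous_intros circle_deriv_props(2)[OF f]) auto
qed

lemma exp_log_deriv_S1: "f \<in> carrier Diff_S1 \<Longrightarrow> x \<in> {0..1} \<Longrightarrow> exp (log_deriv_S1 f x) = circle_deriv f x"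
  using circle_deriv_props(1) by (simp add: log_deriv_S1_def)

lemma rho_S1_eq: "rho_S1 = jet_dist_S1 deriv_S1"
proof (intro ext)
  fix f g
  show "rho_S1 f g = jet_dist_S1 deriv_S1 f g"
  proof (cases "f \<in> carrier Diff_S1 \<and> g \<in> carrier Diff_S1")
    case True
    then have "mdist C01 (deriv_S1 f) (deriv_S1 g) = (SUP x\<in>{0..1}. \<bar>deriv_S1 f x - deriv_S1 g x\<bar>)"
      by (intro mdist_C01_eq_SUP deriv_S1_C01) auto
    then show ?thesis
      using True by (simp add: rho_S1_def jet_dist_S1_def sup_dist_S1_def deriv_S1_def)
  next
    case False
    then show ?thesis unfolding rho_S1_def jet_dist_S1_def by (simp only: if_False)
  qed
qed

lemma Metric_space_log_dist_S1: "Metric_space (carrier Diff_S1) log_dist_S1"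
  unfolding log_dist_S1_def by (intro Metric_space_jet_dist_S1 log_deriv_S1_C01)

text \<open>The uniform distance of the maps is common to both metrics, so only the derivative parts have to
  be compared.\<close>

lemma jet_dist_S1_coarsen:
  assumes f: "f \<in> carrier Diff_S1" and e: "\<epsilon> > 0"
    and small: "\<And>e. e > 0 \<Longrightarrow> \<exists>\<delta>>0. \<forall>g\<in>carrier Diff_S1.
      mdist C01 (K f) (K g) < \<delta> \<longrightarrow> mdist C01 (K' f) (K' g) < e"
  shows "\<exists>\<delta>>0. \<forall>g\<in>carrier Diff_S1. jet_dist_S1 K f g < \<delta> \<longrightarrow> jet_dist_S1 K' f g < \<epsilon>"
proof -
  obtain \<delta> where d: "\<delta> > 0"
    "\<And>g. g \<in> carrier Diff_S1 \<Longrightarrow> mdist C01 (K f) (K g) < \<delta> \<Longrightarrow> mdist C01 (K' f) (K' g) < \<epsilon> / 2"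
    using small[of "\<epsilon> / 2"] e by auto
  have "jet_dist_S1 K' f g < \<epsilon>" if g: "g \<in> carrier Diff_S1" and lt: "jet_dist_S1 K f g < min \<delta> (\<epsilon> / 2)" for g
  proof -
    have eq: "jet_dist_S1 L f g = sup_dist_S1 f g + mdist C01 (L f) (L g)" for L
      using f g by (simp add: jet_dist_S1_def)
    have "0 \<le> mdist C01 (K f) (K g)" by simp
    then have "mdist C01 (K f) (K g) < \<delta>" "sup_dist_S1 f g < \<epsilon> / 2"
      using lt sup_dist_S1_nonneg[OF f g] unfolding eq by linarith+
    then show ?thesis using d(2)[OF g] unfolding eq by linarith
  qed
  then show ?thesis using d(1) e by (intro exI[of _ "min \<delta> (\<epsilon> / 2)"]) auto
qed

lemma mtopology_log_dist_S1: "Metric_space.mtopology (carrier Diff_S1) log_dist_S1 = Diff_S1_topology"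
  unfolding Diff_S1_topology_def rho_S1_eq log_dist_S1_def
proof (rule mtopology_eqI)
  show "Metric_space (carrier Diff_S1) (jet_dist_S1 log_deriv_S1)"
    "Metric_space (carrier Diff_S1) (jet_dist_S1 deriv_S1)"
    by (intro Metric_space_jet_dist_S1 log_deriv_S1_C01 deriv_S1_C01; assumption)+
  fix f and \<epsilon> :: real assume f: "f \<in> carrier Diff_S1" and e: "\<epsilon> > 0"
  have ex: "(\<lambda>x\<in>{0..1}. exp (log_deriv_S1 g x)) = deriv_S1 g" if "g \<in> carrier Diff_S1" for g
    using exp_log_deriv_S1[OF that] by (auto simp: fun_eq_iff deriv_S1_def)
  have pos: "deriv_S1 g ` {0..1} \<subseteq> {0<..}" if "g \<in> carrier Diff_S1" for g
    using circle_deriv_props(1)[OF that] by (auto simp: deriv_S1_def)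
  have log: "(\<lambda>x\<in>{0..1}. ln (deriv_S1 g x)) = log_deriv_S1 g" for g
    by (auto simp: fun_eq_iff deriv_S1_def log_deriv_S1_def)
  show "\<exists>\<delta>>0. \<forall>g\<in>carrier Diff_S1. jet_dist_S1 log_deriv_S1 f g < \<delta> \<longrightarrow> jet_dist_S1 deriv_S1 f g < \<epsilon>"
  proof (rule jet_dist_S1_coarsen[OF f e])
    fix e :: real assume "e > 0"
    from mdist_C01_compose_continuous[OF log_deriv_S1_C01[OF f] subset_UNIV open_UNIV continuous_on_exp[OF continuous_on_id] this]
    obtain \<delta> where "\<delta> > 0" "\<And>v. v \<in> mspace C01 \<Longrightarrow> mdist C01 (log_deriv_S1 f) v < \<delta> \<Longrightarrow>
      mdist C01 (\<lambda>x\<in>{0..1}. exp (log_deriv_S1 f x)) (\<lambda>x\<in>{0..1}. exp (v x)) < e" by auto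
    then show "\<exists>\<delta>>0. \<forall>g\<in>carrier Diff_S1. mdist C01 (log_deriv_S1 f) (log_deriv_S1 g) < \<delta> \<longrightarrow>
      mdist C01 (deriv_S1 f) (deriv_S1 g) < e"
      using log_deriv_S1_C01 ex[OF f] ex by metis
  qed
  show "\<exists>\<delta>>0. \<forall>g\<in>carrier Diff_S1. jet_dist_S1 deriv_S1 f g < \<delta> \<longrightarrow> jet_dist_S1 log_deriv_S1 f g < \<epsilon>"
  proof (rule jet_dist_S1_coarsen[OF f e])
    fix e :: real assume e: "e > 0"
    have ln: "continuous_on {0<..} (ln :: real \<Rightarrow> real)" by (intro continuous_intros) auto
    from mdist_C01_compose_continuous[OF deriv_S1_C01[OF f] pos[OF f] open_greaterThan ln e]
    obtain \<delta> where "\<delta> > 0" "\<And>v. v \<in> mspace C01 \<Longrightarrow> v ` {0..1} \<subseteq> {0<..} \<Longrightarrow> mdist C01 (deriv_S1 f) v < \<delta> \<Longrightarrow>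
      mdist C01 (\<lambda>x\<in>{0..1}. ln (deriv_S1 f x)) (\<lambda>x\<in>{0..1}. ln (v x)) < e" by blast
    then show "\<exists>\<delta>>0. \<forall>g\<in>carrier Diff_S1. mdist C01 (deriv_S1 f) (deriv_S1 g) < \<delta> \<longrightarrow>
      mdist C01 (log_deriv_S1 f) (log_deriv_S1 g) < e"
      using deriv_S1_C01 pos log by metis
  qed
qed

lemma periodic_ball_iff:
  fixes q :: "real \<Rightarrow> real"
  assumes "\<And>x. q (x + 1) = q x"
  shows "(\<forall>x\<in>{0..1}. P (q x)) \<longleftrightarrow> (\<forall>x. P (q x))"
proof
  have per: "q (x + of_int n) = q x" for x n
    using add_one_int[of q 0 x n] assms by simp
  assume P: "\<forall>x\<in>{0..1}. P (q x)"
  show "\<forall>x. P (q x)"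
  proof
    fix x :: real
    have "q x = q (frac x)" using per[of "frac x" "\<lfloor>x\<rfloor>"] by (simp add: frac_def)
    moreover have "frac x \<in> {0..1}" by (simp add: frac_lt_1 less_imp_le)
    ultimately show "P (q x)" using P by simp
  qed
qed simp

text \<open>The uniform distance is invariant because \<open>h\<close> permutes the circle. For the logarithmic part the
  supremum over the unit interval equals, by periodicity, the supremum over the line, and there the
  lift of \<open>h\<close> is an onto change of variables.\<close>

lemma compatible_log_dist_S1: "compatible_right_invariant_metric Diff_S1 Diff_S1_topology log_dist_S1"
  unfolding compatible_right_invariant_metric_def
proof (intro conjI ballI Metric_space_log_dist_S1 mtopology_log_dist_S1)
  fix f g h assume f: "f \<in> carrier Diff_S1" and g: "g \<in> carrier Diff_S1" and h: "h \<in> carrier Diff_S1"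
  interpret group Diff_S1 by (rule group_Diff_S1)
  have c: "compose S1 f h \<in> carrier Diff_S1" "compose S1 g h \<in> carrier Diff_S1"
    using m_closed[OF f h] m_closed[OF g h] f g h by (simp_all add: mult_Diff_S1)
  have sup: "sup_dist_S1 (compose S1 f h) (compose S1 g h) = sup_dist_S1 f g"
  proof -
    have "sup_dist_S1 (compose S1 f h) (compose S1 g h) \<le> b \<longleftrightarrow> sup_dist_S1 f g \<le> b" for b
    proof -
      have "(\<forall>z\<in>S1. dist (compose S1 f h z) (compose S1 g h z) \<le> b) \<longleftrightarrow> (\<forall>w\<in>h ` S1. dist (f w) (g w) \<le> b)"
        by (simp add: compose_def)
      then show ?thesis
        unfolding sup_dist_S1_le_iff[OF c] sup_dist_S1_le_iff[OF f g] Diff_S1_maps[OF h] .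
    qed
    then show ?thesis by (metis order_antisym order_refl)
  qed
  obtain H where H: "circle_diffeo_lift h H (circle_deriv h)" using circle_deriv_lift[OF h] .
  have comp: "circle_deriv (compose S1 f' h) x = circle_deriv f' (H x) * circle_deriv h x"
    if f': "f' \<in> carrier Diff_S1" for f' x
  proof -
    obtain F where F: "circle_diffeo_lift f' F (circle_deriv f')" using circle_deriv_lift[OF f'] .
    show ?thesis using circle_deriv_eq[OF circle_diffeo_lift_compose[OF F H]] by simp
  qed
  define q where "q x = ln (circle_deriv f x) - ln (circle_deriv g x)" for x
  have q_per: "q (x + 1) = q x" for x
    using circle_deriv_props(3)[OF f] circle_deriv_props(3)[OF g] by (simp add: q_def)
  have H1: "H (x + 1) = H x + 1" for x using H by (simp add: circle_diffeo_lift_def)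
  have eq: "ln (circle_deriv (compose S1 f h) x) - ln (circle_deriv (compose S1 g h) x) = q (H x)" for x
    unfolding comp[OF f] comp[OF g] q_def
    using circle_deriv_props(1)[OF f, of "H x"] circle_deriv_props(1)[OF g, of "H x"] circle_deriv_props(1)[OF h, of x]
    by (simp add: ln_mult)
  have surj: "surj H" using circle_diffeo_lift_bij[OF H] by (simp add: bij_is_surj)
  have "mdist C01 (log_deriv_S1 (compose S1 f h)) (log_deriv_S1 (compose S1 g h))
    = mdist C01 (log_deriv_S1 f) (log_deriv_S1 g)"
  proof (rule mdist_C01_eqI)
    fix b :: real
    have "(\<forall>x\<in>{0..1}. \<bar>log_deriv_S1 (compose S1 f h) x - log_deriv_S1 (compose S1 g h) x\<bar> \<le> b)
      \<longleftrightarrow> (\<forall>x\<in>{0..1}. \<bar>q (H x)\<bar> \<le> b)" by (simp add: log_deriv_S1_def eq)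
    also have "\<dots> \<longleftrightarrow> (\<forall>x. \<bar>q (H x)\<bar> \<le> b)"
      using periodic_ball_iff[of "\<lambda>x. q (H x)" "\<lambda>y. \<bar>y\<bar> \<le> b"] by (simp add: H1 q_per)
    also have "\<dots> \<longleftrightarrow> (\<forall>y. \<bar>q y\<bar> \<le> b)" using surj by (metis surjD)
    also have "\<dots> \<longleftrightarrow> (\<forall>x\<in>{0..1}. \<bar>q x\<bar> \<le> b)"
      using periodic_ball_iff[of q "\<lambda>y. \<bar>y\<bar> \<le> b"] q_per by simp
    also have "\<dots> \<longleftrightarrow> (\<forall>x\<in>{0..1}. \<bar>log_deriv_S1 f x - log_deriv_S1 g x\<bar> \<le> b)"
      by (simp add: log_deriv_S1_def q_def)
    finally show "(\<forall>x\<in>{0..1}. \<bar>log_deriv_S1 (compose S1 f h) x - log_deriv_S1 (compose S1 g h) x\<bar> \<le> b)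
      \<longleftrightarrow> (\<forall>x\<in>{0..1}. \<bar>log_deriv_S1 f x - log_deriv_S1 g x\<bar> \<le> b)" .
  qed (use f g c log_deriv_S1_C01 in auto)
  then show "log_dist_S1 (f \<otimes>\<^bsub>Diff_S1\<^esub> h) (g \<otimes>\<^bsub>Diff_S1\<^esub> h) = log_dist_S1 f g"
    using f g h c sup by (simp add: mult_Diff_S1 log_dist_S1_def jet_dist_S1_def)
qed

section \<open>Circle diffeomorphisms with prescribed logarithmic derivative\<close>

text \<open>On the circle cut open at the point 1, \<open>exp_primitive h\<close> followed by the rotation by \<open>c\<close>.\<close>

definition circle_exp :: "real \<Rightarrow> (real \<Rightarrow> real) \<Rightarrow> complex \<Rightarrow> complex"
  where "circle_exp c h = (\<lambda>z\<in>S1. circle_pt (c + exp_primitive h (circle_arg z)))"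

lemma frac_extension_eq:
  fixes h :: "real \<Rightarrow> 'a"
  assumes "h 0 = h 1" "x \<in> {0..1}" shows "h (frac x) = h x"
proof (cases "x = 1")
  case False
  then have "frac x = x" using assms(2) by (simp add: frac_eq)
  then show ?thesis by simp
qed (use assms(1) in \<open>simp add: frac_def\<close>)

text \<open>On each closed interval between consecutive integers the extension is a translate of \<open>h\<close>, the value
  at the right end being correct because \<open>h 0 = h 1\<close>. Two adjacent intervals are a neighbourhood of
  every point of the second one except its right end.\<close>

lemma continuous_on_periodic_extension:
  fixes h :: "real \<Rightarrow> real"
  assumes h: "continuous_on {0..1} h" and ends: "h 0 = h 1"
  shows "continuous_on UNIV (\<lambda>x. h (frac x))"
proof -
  have piece: "continuous_on {of_int n..of_int n + 1} (\<lambda>x. h (frac x))" for n :: int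
  proof -
    have "h (x - of_int n) = h (frac x)" if "x \<in> {of_int n..of_int n + 1}" for x
    proof (cases "x = of_int n + 1")
      case True
      then have "frac x = 0" by (simp add: frac_def)
      then show ?thesis using True ends by simp
    next
      case False
      then have "frac x = x - of_int n" unfolding frac_unique_iff using that by auto
      then show ?thesis by simp
    qed
    moreover have "continuous_on {of_int n..of_int n + 1} (\<lambda>x. h (x - of_int n))"
      by (rule continuous_on_compose2[OF h]) (auto intro!: continuous_intros)
    ultimately show ?thesis by (rule continuous_on_eq[rotated])
  qed
  have "isCont (\<lambda>x. h (frac x)) x" for x
  proof -
    define n where "n = \<lfloor>x\<rfloor>"
    have x: "of_int n \<le> x" "x < of_int n + 1" unfolding n_def by linarith+
    have "continuous_on ({of_int (n - 1)..of_int (n - 1) + 1} \<union> {of_int n..of_int n + 1}) (\<lambda>x. h (frac x))"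
      by (intro continuous_on_closed_Un piece) auto
    moreover have "x \<in> interior ({of_int (n - 1)..of_int (n - 1) + 1} \<union> {of_int n..of_int n + 1})"
    proof (rule interiorI[of "{of_int n - 1<..<of_int n + 1}"])
      show "x \<in> {of_int n - 1<..<of_int n + 1}" using x by auto
    qed auto
    ultimately show ?thesis by (rule continuous_on_interior)
  qed
  then show ?thesis by (simp add: continuous_at_imp_continuous_on)
qed

text \<open>A lift is obtained as an antiderivative on the whole line of the periodic function
  \<open>exp (h (frac x) - ln (exp_integral h))\<close>. It has degree one, as the derivative is periodic and has
  integral 1 over a period, and so no differentiability has to be checked at the cut.\<close>

lemma circle_exp_lift:
  assumes h: "continuous_on {0..1} h" and ends: "h 0 = h 1"
  shows "\<exists>F. circle_diffeo_lift (circle_exp c h) F (\<lambda>x. exp (h (frac x) - ln (exp_integral h)))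
    \<and> (\<forall>x\<in>{0..1}. F x = c + exp_primitive h x)"
proof -
  let ?p = "\<lambda>x. exp (h (frac x) - ln (exp_integral h))"
  have p: "continuous_on UNIV ?p"
    by (intro continuous_intros continuous_on_periodic_extension h ends)
  then obtain F0 where F0: "\<And>x. (F0 has_real_derivative ?p x) (at x)"
    using einterval_antiderivative[of "-\<infinity>" "\<infinity>" ?p]
    by (auto simp: continuous_on_eq_continuous_at has_real_derivative_iff_has_vector_derivative)
  define F where "F x = F0 x - F0 0 + c" for x
  have F: "(F has_real_derivative ?p x) (at x)" for x
    unfolding F_def using F0[of x] by (auto intro!: derivative_eq_intros)
  have pos: "pos_C1 UNIV F ?p" using p F by (simp add: pos_C1_def)
  have "pos_C1 {0..1} (\<lambda>x. F x - c) (\<lambda>x. exp (h x - ln (exp_integral h)))"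
  proof (rule pos_C1_deriv_cong)
    show "pos_C1 {0..1} (\<lambda>x. F x - c) ?p"
      unfolding pos_C1_def
    proof (intro conjI ballI)
      fix x
      have "((\<lambda>x. F x - c) has_real_derivative ?p x) (at x)"
        using F[of x] by (auto intro!: derivative_eq_intros)
      then show "((\<lambda>x. F x - c) has_real_derivative ?p x) (at x within {0..1})"
        by (rule has_field_derivative_at_within)
    qed (use p continuous_on_subset in auto)
    show "exp (h x - ln (exp_integral h)) = ?p x" if "x \<in> {0..1}" for x
      using frac_extension_eq[of h, OF ends that] by simp
  qed
  from C1_diff_bound[OF this pos_C1_exp_primitive[OF h], of 0]
  have on_I: "F x = c + exp_primitive h x" if "x \<in> {0..1}" for x
    using that by (simp add: F_def exp_primitive_0)
  have per: "F (x + 1) = F x + 1" for x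
  proof -
    have "((\<lambda>x. F (x + 1) - F x) has_real_derivative 0) (at x)" for x
    proof -
      have "((\<lambda>x. F (x + 1)) has_real_derivative ?p (x + 1)) (at x)"
        using F[of "x + 1"] DERIV_shift[of F _ x 1] by simp
      moreover have "frac (x + 1) = frac x" using frac_add_of_int_right[of x 1] by simp
      ultimately show ?thesis using DERIV_diff[OF _ F[of x]] by fastforce
    qed
    then have "F (x + 1) - F x = F (0 + 1) - F 0"
      using DERIV_isconst_all[of "\<lambda>x. F (x + 1) - F x"] by blast
    also have "\<dots> = 1" using on_I[of 0] on_I[of 1] exp_primitive_0 exp_primitive_1[OF h] by simp
    finally show ?thesis by simp
  qed
  have "circle_exp c h (circle_pt x) = circle_pt (F x)" for x
  proof -
    have "frac x \<in> {0..1}" by (simp add: frac_lt_1 less_imp_le)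
    then have "circle_exp c h (circle_pt x) = circle_pt (F (frac x))"
      by (simp add: circle_exp_def circle_arg_pt on_I)
    also have "\<dots> = circle_pt (F (frac x) + of_int \<lfloor>x\<rfloor> * 1)" by simp
    also have "F (frac x) + of_int \<lfloor>x\<rfloor> * 1 = F (frac x + of_int \<lfloor>x\<rfloor>)"
      by (rule add_one_int[where F = F and c = 1, OF per, symmetric])
    finally show ?thesis by (simp add: frac_def)
  qed
  then have "circle_diffeo_lift (circle_exp c h) F ?p"
    using pos per pos_C1_continuous[OF pos] by (simp add: circle_diffeo_lift_def circle_lift_def)
  then show ?thesis using on_I by blast
qed

lemma circle_exp_Diff_S1:
  assumes h: "continuous_on {0..1} h" and ends: "h 0 = h 1"
  shows "circle_exp c h \<in> carrier Diff_S1"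
    and "x \<in> {0..1} \<Longrightarrow> log_deriv_S1 (circle_exp c h) x = h x - ln (exp_integral h)"
    and "x \<in> {0..1} \<Longrightarrow> circle_exp c h (circle_pt x) = circle_pt (c + exp_primitive h x)"
proof -
  obtain F where F: "circle_diffeo_lift (circle_exp c h) F (\<lambda>x. exp (h (frac x) - ln (exp_integral h)))"
    and on_I: "\<And>x. x \<in> {0..1} \<Longrightarrow> F x = c + exp_primitive h x"
    using circle_exp_lift[OF h ends] by blast
  show "circle_exp c h \<in> carrier Diff_S1"
    unfolding carrier_Diff_S1_iff using F by (auto simp: circle_exp_def)
  show "log_deriv_S1 (circle_exp c h) x = h x - ln (exp_integral h)" if x: "x \<in> {0..1}"
  proof -
    have "h (frac x) = h x" by (rule frac_extension_eq[OF ends x])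
    then show ?thesis using circle_deriv_eq[OF F] x by (simp add: log_deriv_S1_def)
  qed
  show "circle_exp c h (circle_pt x) = circle_pt (c + exp_primitive h x)" if x: "x \<in> {0..1}"
    using F on_I[OF x] by (simp add: circle_diffeo_lift_def circle_lift_def)
qed

lemma log_deriv_S1_ends: "f \<in> carrier Diff_S1 \<Longrightarrow> log_deriv_S1 f 0 = log_deriv_S1 f 1"
  using circle_deriv_props(3)[of f 0] by (simp add: log_deriv_S1_def)

text \<open>A lift \<open>F\<close> restricted to the unit interval is \<open>F 0\<close> plus the primitive of its derivative. Reducing
  \<open>F 0\<close> modulo 1 keeps the rotation parameter bounded.\<close>

lemma Diff_S1_as_circle_exp:
  assumes f: "f \<in> carrier Diff_S1"
  shows "exp_integral (log_deriv_S1 f) = 1"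
    and "\<exists>c\<in>{0..1}. circle_exp c (log_deriv_S1 f) = f"
proof -
  let ?u = "log_deriv_S1 f"
  have u: "continuous_on {0..1} ?u" using log_deriv_S1_C01[OF f] by (simp add: mspace_C01)
  obtain F where F: "circle_diffeo_lift f F (circle_deriv f)" using circle_deriv_lift[OF f] .
  have p: "pos_C1 {0..1} (\<lambda>x. F x - F 0) (\<lambda>x. exp (?u x))"
  proof (rule pos_C1_deriv_cong[OF _ exp_log_deriv_S1[OF f]])
    show "pos_C1 {0..1} (\<lambda>x. F x - F 0) (circle_deriv f)"
      unfolding pos_C1_def
    proof (intro conjI ballI circle_deriv_props[OF f])
      fix x
      have "(F has_real_derivative circle_deriv f x) (at x)"
        using F by (intro pos_C1_UNIV) (simp add: circle_diffeo_lift_def)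
      then have "((\<lambda>x. F x - F 0) has_real_derivative circle_deriv f x) (at x)"
        by (auto intro!: derivative_eq_intros)
      then show "((\<lambda>x. F x - F 0) has_real_derivative circle_deriv f x) (at x within {0..1})"
        by (rule has_field_derivative_at_within)
    qed
  qed
  have F1: "F 1 = F 0 + 1"
  proof -
    have "F (0 + 1) = F 0 + 1" using F unfolding circle_diffeo_lift_def by blast
    then show ?thesis by simp
  qed
  show int: "exp_integral ?u = 1"
    by (rule exp_integral_log_derivative[OF p]) (simp_all add: F1)
  have "F x - F 0 = exp_primitive ?u x" if "x \<in> {0..1}" for x
    using C1_diff_bound[OF p pos_C1_exp_primitive[OF u], of 0 x] that
    by (simp add: int exp_primitive_0)
  then have Fx: "F x = F 0 + exp_primitive ?u x" if "x \<in> {0..1}" for x using that by force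
  have "circle_exp (frac (F 0)) ?u = f"
  proof
    fix z show "circle_exp (frac (F 0)) ?u z = f z"
    proof (cases "z \<in> S1")
      case True
      let ?x = "circle_arg z"
      have "f z = circle_pt (F ?x)"
        using F circle_pt_arg[OF True] unfolding circle_diffeo_lift_def circle_lift_def by metis
      also have "F ?x = frac (F 0) + exp_primitive ?u ?x + of_int \<lfloor>F 0\<rfloor>"
        using Fx[OF circle_arg_in] by (simp add: frac_def)
      finally show ?thesis using True by (simp add: circle_exp_def)
    next
      case False
      then show ?thesis using f unfolding carrier_Diff_S1_iff circle_exp_def extensional_def by auto
    qed
  qed
  then show "\<exists>c\<in>{0..1}. circle_exp c ?u = f"
    by (intro bexI[of _ "frac (F 0)"]) (auto simp: frac_lt_1 less_imp_le)
qed

text \<open>The first summand bounds the uniform distance of the maps, the factor \<open>2 * pi\<close> coming from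
  \<open>circle_pt\<close>; the second bounds the logarithmic derivatives.\<close>

lemma log_dist_circle_exp_le:
  assumes h: "continuous_on {0..1} h" "h 0 = h 1" and k: "continuous_on {0..1} k" "k 0 = k 1"
    and c: "\<And>x. x \<in> {0..1} \<Longrightarrow> \<bar>h x - k x\<bar> \<le> c"
  shows "log_dist_S1 (circle_exp a h) (circle_exp b k) \<le> 2 * pi * (\<bar>a - b\<bar> + 4 * c) + 2 * c"
proof -
  note D = circle_exp_Diff_S1(1)[OF h, of a] circle_exp_Diff_S1(1)[OF k, of b]
  have "sup_dist_S1 (circle_exp a h) (circle_exp b k) \<le> 2 * pi * (\<bar>a - b\<bar> + 4 * c)"
    unfolding sup_dist_S1_le_iff[OF D]
  proof
    fix z assume "z \<in> S1"
    then obtain x where x: "x \<in> {0..1}" "z = circle_pt x" using circle_pt_image by blast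
    have "\<bar>(a + exp_primitive h x) - (b + exp_primitive k x)\<bar> \<le> \<bar>a - b\<bar> + 4 * c"
      using exp_primitive_dist[OF h(1) k(1) c x(1)] by linarith
    then have "2 * pi * \<bar>(a + exp_primitive h x) - (b + exp_primitive k x)\<bar> \<le> 2 * pi * (\<bar>a - b\<bar> + 4 * c)"
      by (intro mult_left_mono) auto
    then show "dist (circle_exp a h z) (circle_exp b k z) \<le> 2 * pi * (\<bar>a - b\<bar> + 4 * c)"
      unfolding x(2) circle_exp_Diff_S1(3)[OF h x(1)] circle_exp_Diff_S1(3)[OF k x(1)]
      by (rule order_trans[OF dist_circle_pt_le])
  qed
  moreover have "mdist C01 (log_deriv_S1 (circle_exp a h)) (log_deriv_S1 (circle_exp b k)) \<le> 2 * c"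
    unfolding mdist_C01_le_iff[OF log_deriv_S1_C01[OF D(1)] log_deriv_S1_C01[OF D(2)]]
  proof
    fix x :: real assume x: "x \<in> {0..1}"
    show "\<bar>log_deriv_S1 (circle_exp a h) x - log_deriv_S1 (circle_exp b k) x\<bar> \<le> 2 * c"
    proof -
      have "\<bar>ln (exp_integral h) - ln (exp_integral k)\<bar> \<le> c"
        by (rule ln_exp_integral_lipschitz[OF h(1) k(1)]) (rule c)
      then show ?thesis
        using circle_exp_Diff_S1(2)[OF h x, of a] circle_exp_Diff_S1(2)[OF k x, of b] c[OF x] by linarith
    qed
  qed
  ultimately show ?thesis using D by (simp add: log_dist_S1_def jet_dist_S1_def)
qed

lemma log_deriv_S1_one: "x \<in> {0..1} \<Longrightarrow> log_deriv_S1 \<one>\<^bsub>Diff_S1\<^esub> x = 0"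
  unfolding one_Diff_S1 log_deriv_S1_def circle_deriv_eq[OF circle_diffeo_lift_id] by simp

text \<open>The path scales the logarithmic derivative and at the same time unwinds the rotation. The rotation
  contributes a bounded speed, whatever \<open>f\<close> is.\<close>

lemma path_group_Diff_S1: "path_group Diff_S1 Diff_S1_topology log_dist_S1"
proof (intro path_group.intro path_group_axioms.intro group_Diff_S1 compatible_log_dist_S1 exI[of _ "10 * pi + 2"] ballI)
  fix f assume f: "f \<in> carrier Diff_S1"
  interpret group Diff_S1 by (rule group_Diff_S1)
  interpret Metric_space "carrier Diff_S1" log_dist_S1 by (rule Metric_space_log_dist_S1)
  let ?u = "log_deriv_S1 f"
  let ?D = "log_dist_S1 f \<one>\<^bsub>Diff_S1\<^esub>"
  obtain a where a: "a \<in> {0..1}" "circle_exp a ?u = f" using Diff_S1_as_circle_exp(2)[OF f] by blast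
  let ?\<gamma> = "\<lambda>t. circle_exp (t * a) (\<lambda>x. t * ?u x)"
  have c: "continuous_on {0..1} (\<lambda>x. t * ?u x)" for t
    using log_deriv_S1_C01[OF f] by (intro continuous_intros) (auto simp: mspace_C01)
  have e: "t * ?u 0 = t * ?u 1" for t using log_deriv_S1_ends[OF f] by simp
  have u: "\<bar>?u x\<bar> \<le> ?D" if x: "x \<in> {0..1}" for x
    using mdist_C01_upper[OF log_deriv_S1_C01[OF f] log_deriv_S1_C01[OF one_closed] x]
      log_deriv_S1_one[OF x] f sup_dist_S1_nonneg[OF f one_closed]
    by (simp add: log_dist_S1_def jet_dist_S1_def)
  have D0: "0 \<le> ?D" by simp
  have lip: "log_dist_S1 (?\<gamma> s) (?\<gamma> t) \<le> (10 * pi + 2) * (?D + 1) * \<bar>s - t\<bar>" for s t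
  proof -
    have "log_dist_S1 (?\<gamma> s) (?\<gamma> t) \<le> 2 * pi * (\<bar>s * a - t * a\<bar> + 4 * (?D * \<bar>s - t\<bar>)) + 2 * (?D * \<bar>s - t\<bar>)"
    proof (rule log_dist_circle_exp_le[OF c e c e])
      fix x :: real assume x: "x \<in> {0..1}"
      have "\<bar>s * ?u x - t * ?u x\<bar> = \<bar>?u x\<bar> * \<bar>s - t\<bar>"
        by (simp add: left_diff_distrib[symmetric] abs_mult mult.commute)
      also have "\<dots> \<le> ?D * \<bar>s - t\<bar>" using u[OF x] by (intro mult_right_mono) auto
      finally show "\<bar>s * ?u x - t * ?u x\<bar> \<le> ?D * \<bar>s - t\<bar>" .
    qed
    also have "s * a - t * a = a * (s - t)" by (simp add: algebra_simps)
    also have "\<bar>a * (s - t)\<bar> = a * \<bar>s - t\<bar>" using a(1) by (simp add: abs_mult)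
    also have "2 * pi * (a * \<bar>s - t\<bar> + 4 * (?D * \<bar>s - t\<bar>)) + 2 * (?D * \<bar>s - t\<bar>)
      = (2 * pi * (a + 4 * ?D) + 2 * ?D) * \<bar>s - t\<bar>" by (simp add: algebra_simps)
    also have "\<dots> \<le> (2 * pi * (5 * (?D + 1)) + 2 * (?D + 1)) * \<bar>s - t\<bar>"
    proof -
      have "a \<le> 1" using a(1) by simp
      then have "a + 4 * ?D \<le> 5 * ?D + 5" using D0 by linarith
      then have "a + 4 * ?D \<le> 5 * (?D + 1)" by (simp only: distrib_left mult_1_right)
      then show ?thesis by (intro mult_right_mono add_mono mult_left_mono) auto
    qed
    also have "\<dots> = (10 * pi + 2) * (?D + 1) * \<bar>s - t\<bar>" by (simp add: algebra_simps)
    finally show ?thesis .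
  qed
  have "?\<gamma> 0 = \<one>\<^bsub>Diff_S1\<^esub>"
  proof
    fix z
    have "exp_primitive (\<lambda>x. 0) x = x" if "x \<in> {0..1}" for x
      using that by (simp add: exp_primitive_def exp_integral_def)
    then show "?\<gamma> 0 z = \<one>\<^bsub>Diff_S1\<^esub> z"
      using circle_arg_in[of z] by (simp add: circle_exp_def one_Diff_S1 circle_pt_arg)
  qed
  moreover have "?\<gamma> 1 = f" using a(2) by simp
  ultimately show "\<exists>\<gamma>. \<gamma> 0 = \<one>\<^bsub>Diff_S1\<^esub> \<and> \<gamma> 1 = f \<and> \<gamma> \<in> {0..1} \<rightarrow> carrier Diff_S1 \<and>
      (\<forall>s\<in>{0..1}. \<forall>t\<in>{0..1}. log_dist_S1 (\<gamma> s) (\<gamma> t) \<le> (10 * pi + 2) * (?D + 1) * \<bar>s - t\<bar>)"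
    using lip circle_exp_Diff_S1(1)[OF c e] by (intro exI[of _ ?\<gamma>]) auto
qed

text \<open>The map forgets the rotation. Since the uniform distance of two circle maps is at most 2, this
  costs no more than an additive constant.\<close>

lemma quasi_isometric_Diff_S1_vanishing_01:
  "quasi_isometric (carrier Diff_S1) log_dist_S1 {h \<in> mspace C01. h 0 = 0 \<and> h 1 = 0} (mdist C01)"
proof (rule quasi_isometricI_onto[where L = 2 and C = 2 and \<phi> = "\<lambda>f. \<lambda>x\<in>{0..1}. log_deriv_S1 f x - log_deriv_S1 f 0"])
  let ?\<phi> = "\<lambda>f. \<lambda>x\<in>{0..1}. log_deriv_S1 f x - log_deriv_S1 f 0"
  let ?Y = "{h \<in> mspace C01. h 0 = 0 \<and> h 1 = 0}"
  show "Metric_space ?Y (mdist C01)" by (intro C01_subset_metric) auto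
  have \<phi>: "?\<phi> f \<in> mspace C01" if "f \<in> carrier Diff_S1" for f
    using log_deriv_S1_C01[OF that] by (intro restrict_C01 continuous_intros) (auto simp: mspace_C01)
  show "?\<phi> ` carrier Diff_S1 = ?Y"
  proof
    show "?\<phi> ` carrier Diff_S1 \<subseteq> ?Y" using \<phi> log_deriv_S1_ends by auto
    show "?Y \<subseteq> ?\<phi> ` carrier Diff_S1"
    proof
      fix h assume h: "h \<in> ?Y"
      then have c: "continuous_on {0..1} h" "h 0 = h 1" by (simp_all add: mspace_C01)
      have "h = ?\<phi> (circle_exp 0 h)"
        using h circle_exp_Diff_S1(2)[OF c] by (auto simp: fun_eq_iff mspace_C01 extensional_def)
      then show "h \<in> ?\<phi> ` carrier Diff_S1" using circle_exp_Diff_S1(1)[OF c] by (rule image_eqI)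
    qed
  qed
  fix f g assume f: "f \<in> carrier Diff_S1" and g: "g \<in> carrier Diff_S1"
  have d: "log_dist_S1 f g = sup_dist_S1 f g + mdist C01 (log_deriv_S1 f) (log_deriv_S1 g)"
    using f g by (simp add: log_dist_S1_def jet_dist_S1_def)
  note up = mdist_C01_upper[OF log_deriv_S1_C01[OF f] log_deriv_S1_C01[OF g]]
  show "mdist C01 (?\<phi> f) (?\<phi> g) \<le> 2 * log_dist_S1 f g + 2"
    unfolding mdist_C01_le_iff[OF \<phi>[OF f] \<phi>[OF g]] d
  proof
    fix x :: real assume x: "x \<in> {0..1}"
    have "\<bar>(log_deriv_S1 f x - log_deriv_S1 f 0) - (log_deriv_S1 g x - log_deriv_S1 g 0)\<bar>
      \<le> 2 * (sup_dist_S1 f g + mdist C01 (log_deriv_S1 f) (log_deriv_S1 g)) + 2"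
      using up[OF x] up[of 0] sup_dist_S1_nonneg[OF f g] by simp
    then show "\<bar>?\<phi> f x - ?\<phi> g x\<bar> \<le> 2 * (sup_dist_S1 f g + mdist C01 (log_deriv_S1 f) (log_deriv_S1 g)) + 2"
      using x by simp
  qed
  let ?d = "mdist C01 (?\<phi> f) (?\<phi> g)"
  have base: "ln (exp_integral (?\<phi> f)) = - log_deriv_S1 f 0" if f: "f \<in> carrier Diff_S1" for f
  proof -
    have c: "continuous_on {0..1} (log_deriv_S1 f)" using log_deriv_S1_C01[OF f] by (simp add: mspace_C01)
    have "exp_integral (?\<phi> f) = exp_integral (\<lambda>x. log_deriv_S1 f x - log_deriv_S1 f 0)"
      unfolding exp_integral_def by (rule integral_cong) simp
    then show ?thesis using exp_integral_shift[OF c] Diff_S1_as_circle_exp(1)[OF f] by simp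
  qed
  note dd = mdist_C01_upper[OF \<phi>[OF f] \<phi>[OF g]]
  have "\<bar>ln (exp_integral (?\<phi> f)) - ln (exp_integral (?\<phi> g))\<bar> \<le> ?d"
    using \<phi>[OF f] \<phi>[OF g] dd by (intro ln_exp_integral_lipschitz) (auto simp: mspace_C01)
  then have b: "\<bar>log_deriv_S1 f 0 - log_deriv_S1 g 0\<bar> \<le> ?d" unfolding base[OF f] base[OF g] by linarith
  have "mdist C01 (log_deriv_S1 f) (log_deriv_S1 g) \<le> 2 * ?d"
    unfolding mdist_C01_le_iff[OF log_deriv_S1_C01[OF f] log_deriv_S1_C01[OF g]]
  proof
    fix x :: real assume x: "x \<in> {0..1}"
    have "\<bar>(log_deriv_S1 f x - log_deriv_S1 f 0) - (log_deriv_S1 g x - log_deriv_S1 g 0)\<bar> \<le> ?d"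
      using dd[OF x] x by simp
    then show "\<bar>log_deriv_S1 f x - log_deriv_S1 g x\<bar> \<le> 2 * ?d" using b by linarith
  qed
  then show "log_dist_S1 f g \<le> 2 * ?d + 2" using sup_dist_S1_le_2[OF f g] unfolding d by linarith
qed auto

section \<open>The quasi-isometries\<close>

lemma C01_triangle:
  "x \<in> mspace C01 \<Longrightarrow> y \<in> mspace C01 \<Longrightarrow> z \<in> mspace C01 \<Longrightarrow> mdist C01 x z \<le> mdist C01 x y + mdist C01 y z"
  by (rule Metric_space.triangle[OF Metric_space_mspace_mdist])

lemma quasi_isometric_Diff_I_C01: "quasi_isometric (carrier Diff_I) log_dist_I (mspace C01) (mdist C01)"
  by (rule quasi_isometric_trans[OF quasi_isometric_Diff_I_vanishing_0 quasi_isometric_vanishing_0_C01 C01_triangle])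

lemma quasi_isometric_Diff_S1_C01: "quasi_isometric (carrier Diff_S1) log_dist_S1 (mspace C01) (mdist C01)"
  by (rule quasi_isometric_trans[OF quasi_isometric_Diff_S1_vanishing_01 quasi_isometric_vanishing_01_C01 C01_triangle])

lemma quasi_isometric_C01_group_C01: "quasi_isometric (carrier C01_group) (mdist C01) (mspace C01) (mdist C01)"
  by (rule quasi_isometricI_onto[where L = 1 and C = 0 and \<phi> = id]) (auto simp: C01_group_def)

theorem theorem1p3:
  shows "groups_quasi_isometric Diff_I Diff_I_topology Diff_S1 Diff_S1_topology
    \<and> group_quasi_isometric_to_metric Diff_I Diff_I_topology (mspace C01) (mdist C01)
    \<and> groups_quasi_isometric Diff_I Diff_I_topology C01_group (mtopology_of C01)
    \<and> group_quasi_isometric_to_metric Diff_S1 Diff_S1_topology (mspace C01) (mdist C01)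
    \<and> groups_quasi_isometric Diff_S1 Diff_S1_topology C01_group (mtopology_of C01)
    \<and> group_quasi_isometric_to_metric C01_group (mtopology_of C01) (mspace C01) (mdist C01)"
proof (intro conjI)
  note C = Metric_space_mspace_mdist[of C01]
  note via = groups_quasi_isometric_via_metric[OF _ _ C]
  note to = path_group.group_quasi_isometric_to_metric[OF _ C]
  note I = path_group_Diff_I quasi_isometric_Diff_I_C01
  note S = path_group_Diff_S1 quasi_isometric_Diff_S1_C01
  note V = path_group_C01_group quasi_isometric_C01_group_C01
  show "groups_quasi_isometric Diff_I Diff_I_topology Diff_S1 Diff_S1_topology"
    by (rule via[OF I(1) S(1) I(2) S(2)])
  show "groups_quasi_isometric Diff_I Diff_I_topology C01_group (mtopology_of C01)"
    by (rule via[OF I(1) V(1) I(2) V(2)])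
  show "groups_quasi_isometric Diff_S1 Diff_S1_topology C01_group (mtopology_of C01)"
    by (rule via[OF S(1) V(1) S(2) V(2)])
  show "group_quasi_isometric_to_metric Diff_I Diff_I_topology (mspace C01) (mdist C01)" by (rule to[OF I])
  show "group_quasi_isometric_to_metric Diff_S1 Diff_S1_topology (mspace C01) (mdist C01)" by (rule to[OF S])
  show "group_quasi_isometric_to_metric C01_group (mtopology_of C01) (mspace C01) (mdist C01)" by (rule to[OF V])
qed

end
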